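(* Let $\mathcal X$ be a finite set, $P$ a probability distribution on $\mathcal X$, and $\rho_x^{BE}$ ($x\in\mathcal X$) density operators on a finite-dimensional bipartite system $BE$. For the cqq-state $\rho=\rho^{ABE}=\sum_{x\in\mathcal X}P(x)\,|x\rangle\langle x|^A\otimes\rho_x^{BE}$, with $X$ a random variable of distribution $P$, the one-way (forward) secret key capacity satisfies $$K_\rightarrow(\rho)\ \ge\ I(X;B)-I(X;E).$$
   Context: All Hilbert spaces are finite-dimensional; $\log$ is to base 2; $H(\sigma)=-\operatorname{Tr}\sigma\log\sigma$ is the von Neumann entropy. $\{|x\rangle\}$ is an orthonormal basis of $A$. Write $\rho_x^B,\rho_x^E$ for the partial traces of $\rho_x^{BE}$ and $\rho^B=\sum_xP(x)\rho_x^B$, $\rho^E=\sum_xP(x)\rho_x^E$. The Holevo quantities are $I(X;B)=H(\rho^B)-\sum_xP(x)H(\rho^B_x)$ and $I(X;E)=H(\rho^E)-\sum_xP(x)H(\rho^E_x)$. For $x^n=x_1\ldots x_n\in\mathcal X^n$ put $\rho^{BE}_{x^n}=\rho^{BE}_{x_1}\otimes\cdots\otimes\rho^{BE}_{x_n}$, with reductions $\rho^B_{x^n}$, $\rho^E_{x^n}$. Let $X^n=X_1\ldots X_n$ be i.i.d. with distribution $P$. One-way key distillation protocol (on $n$ copies): a stochastic map (classical channel) $T$ from $\mathcal X^n$ to pairs $(\ell,m)\in\{1,\ldots,L\}\times\{1,\ldots,M\}$, and for every $\ell$ a POVM $D^{(\ell)}=(D^{(\ell)}_m)_{m=1}^M$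 on $B^{n}$ (the $n$-fold tensor power of $B$). Alice generates $(\Lambda,K)=T(X^n)$, keeps $K$ as her key, and publicly announces $\Lambda$; Bob obtains $K'$ by measuring: $\Pr\{K'=m\mid\Lambda=\ell,X^n=x^n\}=\operatorname{Tr}(D^{(\ell)}_m\rho^B_{x^n})$. It is assumed that $L\le2^{nF}$ for some constant $F$ (not depending on $n$ along the sequence of protocols considered). It is an $(n,\epsilon)$-protocol if: (1) $\Pr\{K\ne K'\}\le\epsilon$; (2) $\sum_{m=1}^M|\Pr\{K=m\}-\tfrac1M|\le\epsilon$; (3) there is a state $\sigma_0$ such that for all $m$, $\bigl\|\sum_{x^n,\ell}\Pr\{X^n=x^n,\Lambda=\ell\mid K=m\}\,|\ell\rangle\langle\ell|\otimes\rho^E_{x^n}-\sigma_0\bigr\|_1\le\epsilon$. $R$ is an achievable rate if for all $n$ there exist $(n,\epsilon)$-protocols with $\epsilon=\epsilon_n\to0$ and $\frac1n\log M\to R$ as $n\to\infty$. $K_\rightarrow(\rho):=\sup\{R: R\text{ achievable}\}$. *)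

theory Defs
  imports "HOL-Probability.Probability" "Jordan_Normal_Form.Schur_Decomposition"
begin

definition mat_trace :: "complex mat \<Rightarrow> complex" where
  "mat_trace A = (\<Sum>i<dim_row A. A $$ (i, i))"

definition mat_sum :: "nat \<Rightarrow> ('i \<Rightarrow> complex mat) \<Rightarrow> 'i set \<Rightarrow> complex mat" where
  "mat_sum d F S = mat d d (\<lambda>(i, j). \<Sum>s\<in>S. F s $$ (i, j))"

text \<open>In the complex order, \<open>0 \<le> z\<close> means that \<open>z\<close> is real and nonnegative;
  hence the matrices below are automatically Hermitian.\<close>

definition psd :: "nat \<Rightarrow> complex mat \<Rightarrow> bool" where
  "psd d A \<longleftrightarrow> A \<in> carrier_mat d d \<and> (\<forall>v \<in> carrier_vec d. 0 \<le> (A *\<^sub>v v) \<bullet>c v)"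

definition density_op :: "nat \<Rightarrow> complex mat \<Rightarrow> bool" where
  "density_op d \<rho> \<longleftrightarrow> psd d \<rho> \<and> mat_trace \<rho> = 1"

definition povm :: "nat \<Rightarrow> nat \<Rightarrow> (nat \<Rightarrow> complex mat) \<Rightarrow> bool" where
  "povm d M D \<longleftrightarrow> (\<forall>m<M. psd d (D m)) \<and> mat_sum d D {..<M} = 1\<^sub>m d"


text \<open>Functional calculus for Hermitian matrices, \<open>f(U diag(e) U\<^sup>*) = U diag(f(e)) U\<^sup>*\<close>.\<close>

definition spectral_decomp :: "complex mat \<Rightarrow> complex mat \<Rightarrow> (nat \<Rightarrow> real) \<Rightarrow> bool" where
  "spectral_decomp A U e \<longleftrightarrow>
     (let d = dim_row A in
        U \<in> carrier_mat d d \<and> U * mat_adjoint U = 1\<^sub>m d \<and> mat_adjoint U * U = 1\<^sub>m d \<and>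
        A = U * mat_diag d (\<lambda>i. complex_of_real (e i)) * mat_adjoint U)"

definition mat_fun :: "(real \<Rightarrow> real) \<Rightarrow> complex mat \<Rightarrow> complex mat" where
  "mat_fun f A = (THE C. \<exists>U e. spectral_decomp A U e \<and>
     C = U * mat_diag (dim_row A) (\<lambda>i. complex_of_real (f (e i))) * mat_adjoint U)"

lemma mat_fun_eq:
  assumes "spectral_decomp A U e"
  shows "mat_fun f A = U * mat_diag (dim_row A) (\<lambda>i. complex_of_real (f (e i))) * mat_adjoint U"
proof -
  let ?d = "dim_row A"
  let ?\<Delta> = "\<lambda>g. mat_diag ?d (\<lambda>i. complex_of_real (g i))"
  have carrier: "U \<in> carrier_mat ?d ?d" "mat_adjoint U \<in> carrier_mat ?d ?d"
    if "spectral_decomp A U e" for U e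
    using that by (auto simp: spectral_decomp_def Let_def mat_adjoint_def)
  have "U * ?\<Delta> (\<lambda>i. f (e i)) * mat_adjoint U = V * ?\<Delta> (\<lambda>i. f (r i)) * mat_adjoint V"
    if U: "spectral_decomp A U e" and V: "spectral_decomp A V r" for U e V r
  proof -
    note [simp] = carrier[OF U] carrier[OF V] mult_carrier_mat[of _ ?d ?d _ ?d]
      left_mult_one_mat[of _ ?d ?d] right_mult_one_mat[of _ ?d ?d]
    define W where "W = mat_adjoint V * U"
    have W[simp]: "W \<in> carrier_mat ?d ?d" by (simp add: W_def)
    have uni: "mat_adjoint U * U = 1\<^sub>m ?d" "mat_adjoint V * V = 1\<^sub>m ?d"
      "U * mat_adjoint U = 1\<^sub>m ?d" "V * mat_adjoint V = 1\<^sub>m ?d"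
      and A: "U * ?\<Delta> e * mat_adjoint U = A" "V * ?\<Delta> r * mat_adjoint V = A"
      using U V by (auto simp: spectral_decomp_def Let_def)
    have VW: "V * W = U"
    proof -
      have "V * W = V * mat_adjoint V * U"
        unfolding W_def by (rule assoc_mult_mat[symmetric, of _ ?d ?d _ ?d _ ?d]) auto
      then show ?thesis by (simp add: uni)
    qed
    have WU: "W * mat_adjoint U = mat_adjoint V"
    proof -
      have "W * mat_adjoint U = mat_adjoint V * (U * mat_adjoint U)"
        unfolding W_def by (rule assoc_mult_mat[of _ ?d ?d _ ?d _ ?d]) auto
      then show ?thesis by (simp add: uni)
    qed
    have cancel: "X = Y" if "V * X * mat_adjoint U = V * Y * mat_adjoint U"
      and [simp]: "X \<in> carrier_mat ?d ?d" "Y \<in> carrier_mat ?d ?d" for X Y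
    proof -
      have "mat_adjoint V * (V * Z * mat_adjoint U) * U = Z" if [simp]: "Z \<in> carrier_mat ?d ?d" for Z
      proof -
        have "mat_adjoint V * (V * Z * mat_adjoint U) * U
            = (mat_adjoint V * V) * Z * (mat_adjoint U * U)"
          by (simp add: assoc_mult_mat[of _ ?d ?d _ ?d _ ?d])
        then show ?thesis by (simp add: uni)
      qed
      from this[of X] this[of Y] that(1) show ?thesis by (metis that(2,3))
    qed
    have move: "U * Z * mat_adjoint U = V * (W * Z) * mat_adjoint U"
      "V * Z * mat_adjoint V = V * (Z * W) * mat_adjoint U" if [simp]: "Z \<in> carrier_mat ?d ?d" for Z
    proof -
      have "V * (W * Z) * mat_adjoint U = (V * W) * Z * mat_adjoint U"
        by (simp add: assoc_mult_mat[of _ ?d ?d _ ?d _ ?d])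
      then show "U * Z * mat_adjoint U = V * (W * Z) * mat_adjoint U" by (simp add: VW)
      have "V * (Z * W) * mat_adjoint U = V * Z * (W * mat_adjoint U)"
        by (simp add: assoc_mult_mat[of _ ?d ?d _ ?d _ ?d])
      then show "V * Z * mat_adjoint V = V * (Z * W) * mat_adjoint U" by (simp add: WU)
    qed
    have "V * (W * ?\<Delta> e) * mat_adjoint U = V * (?\<Delta> r * W) * mat_adjoint U"
      by (simp only: A flip: move[OF mat_diag_dim])
    then have "W * ?\<Delta> e = ?\<Delta> r * W"
      by (rule cancel) (intro mult_carrier_mat[of _ ?d ?d _ ?d] mat_diag_dim W)+
    then have entry: "W $$ (i, j) * complex_of_real (e j) = complex_of_real (r i) * W $$ (i, j)"
      if "i < ?d" "j < ?d" for i j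
      using that by (auto simp: mat_diag_mult_left[OF W] mat_diag_mult_right[OF W] mat_eq_iff)
    have "W * ?\<Delta> (\<lambda>i. f (e i)) = ?\<Delta> (\<lambda>i. f (r i)) * W"
    proof (rule eq_matI)
      fix i j
      assume "i < dim_row (?\<Delta> (\<lambda>i. f (r i)) * W)" "j < dim_col (?\<Delta> (\<lambda>i. f (r i)) * W)"
      then have ij: "i < ?d" "j < ?d" using W by (auto simp: mat_diag_def)
      have "W $$ (i, j) = 0 \<or> e j = r i" using entry[OF ij] by auto
      with ij show "(W * ?\<Delta> (\<lambda>i. f (e i))) $$ (i, j) = (?\<Delta> (\<lambda>i. f (r i)) * W) $$ (i, j)"
        by (auto simp: mat_diag_mult_left[OF W] mat_diag_mult_right[OF W])
    qed (use carrier_matD[OF W] in \<open>auto simp: mat_diag_def\<close>)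
    then show ?thesis by (simp only: move[OF mat_diag_dim])
  qed
  with assms show ?thesis
    unfolding mat_fun_def by (intro the_equality) blast+
qed

text \<open>The value of \<open>log 2 0\<close> is irrelevant below: it is multiplied by the eigenvalue \<open>0\<close>.\<close>

definition vn_entropy :: "complex mat \<Rightarrow> real" where
  "vn_entropy \<sigma> = - Re (mat_trace (\<sigma> * mat_fun (log 2) \<sigma>))"

definition trace_norm :: "complex mat \<Rightarrow> real" where
  "trace_norm A = Re (mat_trace (mat_fun sqrt (mat_adjoint A * A)))"


text \<open>The space \<open>B\<close> is \<open>\<complex>\<^bsup>dB\<^esup>\<close> and \<open>E\<close> is \<open>\<complex>\<^bsup>dE\<^esup>\<close>. The basis vector
  \<open>b \<otimes> e\<close> of \<open>B \<otimes> E\<close> has index \<open>b * dE + e\<close>.\<close>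

definition kron :: "complex mat \<Rightarrow> complex mat \<Rightarrow> complex mat" where
  "kron A B = mat (dim_row A * dim_row B) (dim_col A * dim_col B)
     (\<lambda>(i, j). A $$ (i div dim_row B, j div dim_col B) * B $$ (i mod dim_row B, j mod dim_col B))"

definition trace_out_E :: "nat \<Rightarrow> nat \<Rightarrow> complex mat \<Rightarrow> complex mat" where
  "trace_out_E dB dE \<rho> = mat dB dB (\<lambda>(b, b'). \<Sum>e<dE. \<rho> $$ (b * dE + e, b' * dE + e))"

definition trace_out_B :: "nat \<Rightarrow> nat \<Rightarrow> complex mat \<Rightarrow> complex mat" where
  "trace_out_B dB dE \<rho> = mat dE dE (\<lambda>(e, e'). \<Sum>b<dB. \<rho> $$ (b * dE + e, b * dE + e'))"

text \<open>For \<open>\<omega> x\<close> the reduction of \<open>\<rho> x\<close> to \<open>B\<close> (or \<open>E\<close>), \<open>product_state \<omega> xs\<close> is the reduction of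
  \<open>\<rho> x\<^sub>1 \<otimes> \<dots> \<otimes> \<rho> x\<^sub>n\<close> to the \<open>n\<close>-fold tensor power of \<open>B\<close> (or \<open>E\<close>), since the partial trace
  of a product is the product of the partial traces.\<close>

definition product_state :: "('x \<Rightarrow> complex mat) \<Rightarrow> 'x list \<Rightarrow> complex mat" where
  "product_state \<omega> xs = foldr kron (map \<omega> xs) (1\<^sub>m 1)"

definition holevo :: "nat \<Rightarrow> 'x::finite pmf \<Rightarrow> ('x \<Rightarrow> complex mat) \<Rightarrow> real" where
  "holevo d P \<omega> =
     vn_entropy (mat_sum d (\<lambda>x. complex_of_real (pmf P x) \<cdot>\<^sub>m \<omega> x) UNIV)
     - (\<Sum>x\<in>UNIV. pmf P x * vn_entropy (\<omega> x))"


text \<open>Messages are numbered \<open>0, \<dots>, L - 1\<close> and keys \<open>0, \<dots>, M - 1\<close>. The stochastic map \<open>T\<close> and the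
  POVMs \<open>D l\<close> constitute a protocol on \<open>n\<close> copies.\<close>

definition one_way_protocol ::
  "nat \<Rightarrow> nat \<Rightarrow> nat \<Rightarrow> nat \<Rightarrow> ('x list \<Rightarrow> (nat \<times> nat) pmf) \<Rightarrow> (nat \<Rightarrow> nat \<Rightarrow> complex mat) \<Rightarrow> bool"
  where
  "one_way_protocol dB n L M T D \<longleftrightarrow>
     (\<forall>xs. length xs = n \<longrightarrow> set_pmf (T xs) \<subseteq> {..<L} \<times> {..<M}) \<and>
     (\<forall>l<L. povm (dB ^ n) M (D l))"

definition measure_outcome :: "nat \<Rightarrow> (nat \<Rightarrow> complex mat) \<Rightarrow> complex mat \<Rightarrow> nat pmf" where
  "measure_outcome M D \<sigma> = embed_pmf (\<lambda>m. if m < M then Re (mat_trace (D m * \<sigma>)) else 0)"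

text \<open>The joint law of \<open>(X\<^sup>n, \<Lambda>, K, K')\<close>; the argument \<open>\<omega>\<close> is the family of Bob's states.\<close>

definition protocol_law ::
  "'x pmf \<Rightarrow> ('x \<Rightarrow> complex mat) \<Rightarrow> nat \<Rightarrow> nat \<Rightarrow> ('x list \<Rightarrow> (nat \<times> nat) pmf) \<Rightarrow>
   (nat \<Rightarrow> nat \<Rightarrow> complex mat) \<Rightarrow> ('x list \<times> nat \<times> nat \<times> nat) pmf" where
  "protocol_law P \<omega> n M T D = do {
     xs \<leftarrow> replicate_pmf n P;
     (l, k) \<leftarrow> T xs;
     k' \<leftarrow> measure_outcome M (D l) (product_state \<omega> xs);
     return_pmf (xs, l, k, k')
   }"

definition ketbra :: "nat \<Rightarrow> nat \<Rightarrow> complex mat" where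
  "ketbra L l = mat L L (\<lambda>(i, j). if i = l \<and> j = l then 1 else 0)"

text \<open>The state of \<open>\<Lambda>\<close> and the \<open>n\<close>-fold tensor power of \<open>E\<close> given \<open>K = m\<close>, for \<open>J\<close> the joint law
  above and \<open>\<omega>\<close> the family of Eve's states.\<close>

definition eve_state ::
  "nat \<Rightarrow> ('x \<Rightarrow> complex mat) \<Rightarrow> nat \<Rightarrow> nat \<Rightarrow> ('x list \<times> nat \<times> nat \<times> nat) pmf \<Rightarrow> nat \<Rightarrow> complex mat"
  where
  "eve_state dE \<omega> n L J m =
     mat_sum (L * dE ^ n)
       (\<lambda>(xs, l). complex_of_real (\<P>((ys, l', k, k') in measure_pmf J. ys = xs \<and> l' = l \<bar> k = m))
          \<cdot>\<^sub>m kron (ketbra L l) (product_state \<omega> xs))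
       ({xs. length xs = n} \<times> {..<L})"

text \<open>The secrecy condition conditions on every event \<open>K = m\<close>, so each of these is required to have
  positive probability.\<close>

definition key_protocol ::
  "nat \<Rightarrow> nat \<Rightarrow> 'x pmf \<Rightarrow> ('x \<Rightarrow> complex mat) \<Rightarrow> nat \<Rightarrow> real \<Rightarrow> nat \<Rightarrow> nat \<Rightarrow>
   ('x list \<Rightarrow> (nat \<times> nat) pmf) \<Rightarrow> (nat \<Rightarrow> nat \<Rightarrow> complex mat) \<Rightarrow> bool" where
  "key_protocol dB dE P \<rho> n \<epsilon> L M T D \<longleftrightarrow>
     one_way_protocol dB n L M T D \<and>
     (let J = protocol_law P (\<lambda>x. trace_out_E dB dE (\<rho> x)) n M T D in
        \<P>((xs, l, k, k') in measure_pmf J. k \<noteq> k') \<le> \<epsilon> \<and>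
        (\<Sum>m<M. \<bar>\<P>((xs, l, k, k') in measure_pmf J. k = m) - 1 / real M\<bar>) \<le> \<epsilon> \<and>
        (\<exists>\<sigma>\<^sub>0. density_op (L * dE ^ n) \<sigma>\<^sub>0 \<and>
          (\<forall>m<M. \<P>((xs, l, k, k') in measure_pmf J. k = m) > 0 \<and>
             trace_norm (eve_state dE (\<lambda>x. trace_out_B dB dE (\<rho> x)) n L J m - \<sigma>\<^sub>0) \<le> \<epsilon>)))"

definition achievable_rate ::
  "nat \<Rightarrow> nat \<Rightarrow> 'x pmf \<Rightarrow> ('x \<Rightarrow> complex mat) \<Rightarrow> real \<Rightarrow> bool" where
  "achievable_rate dB dE P \<rho> R \<longleftrightarrow>
     (\<exists>(F :: real) (\<epsilon> :: nat \<Rightarrow> real) (L :: nat \<Rightarrow> nat) (M :: nat \<Rightarrow> nat).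
        (\<forall>n\<ge>1. real (L n) \<le> 2 powr (real n * F) \<and>
           (\<exists>T D. key_protocol dB dE P \<rho> n (\<epsilon> n) (L n) (M n) T D)) \<and>
        \<epsilon> \<longlonglongrightarrow> 0 \<and>
        (\<lambda>n. log 2 (real (M n)) / real n) \<longlonglongrightarrow> R)"

definition key_capacity :: "nat \<Rightarrow> nat \<Rightarrow> 'x pmf \<Rightarrow> ('x \<Rightarrow> complex mat) \<Rightarrow> ereal" where
  "key_capacity dB dE P \<rho> = Sup (ereal ` {R. achievable_rate dB dE P \<rho> R})"

end

theory Submission
  imports Defs "Jordan_Normal_Form.Spectral_Radius"
begin

text \<open>Alice hashes \<open>x\<^sup>n\<close> by a function \<open>h\<close> into pairs (bin, key), announces the bin together with a uniform shift \<open>s\<close>,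
  and keeps \<open>key + s\<close> modulo \<open>M\<close>. The shift makes the key exactly uniform, and it turns the secrecy condition for
  every single key value into one for the average over all key values. For a uniformly random \<open>h\<close> both
  error terms are small on average, so a good \<open>h\<close> exists.

  \<^emph>\<open>Bob\<close> projects onto the typical subspace of \<open>\<rho>\<^sup>B\<close> and then measures, one after the other, the conditionally typical
  projectors of the candidates in the announced bin. Telescoping and Cauchy-Schwarz in the Frobenius
  inner product give a noncommutative union bound for such a sequence of tests; on average, the wrong candidates
  contribute \<open>2\<^bsup>n(H(XB) - H(B))\<^esup>\<close> divided by the number of bins.

  \<^emph>\<open>Eve's\<close> states are cut down to typical subspaces, a gentle modification. The remaining deviation of a hash cell from the
  mean lives on a space of dimension about \<open>2\<^bsup>nH(E)\<^esup>\<close>, so its trace norm is controlled by its Frobenius norm,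
  whose mean square is a variance of pairwise independent terms, about \<open>2\<^bsup>-nH(XE)\<^esup>\<close> in total.

  Hence any rate below \<open>H(XE) - H(E) - H(XB) + H(B) = I(X;B) - I(X;E)\<close> is achievable.\<close>

section \<open>Adjoint, trace and Frobenius norm\<close>

text \<open>Everything quantum is reduced to the Frobenius norm. A state is written as
  \<open>R * mat_adjoint R\<close>, with a square matrix \<open>R\<close> in place of a purifying
  vector, so probabilities become squared norms of products \<open>K * R\<close> and arguments about
  vectors carry over. Trace norms are not estimated directly: a Hermitian \<open>A\<close> attains
  its trace norm as \<open>Re (mat_trace (W * A))\<close> at a contraction \<open>W\<close>, and
  such pairings obey Cauchy-Schwarz.

  Typicality is cut by thresholds on the eigenvalues \<open>p x * e x k\<close> of the
  classical-quantum state, not on sequences and conditional spectra separately. One Chebyshev bound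
  covers both, and the averaged state is the same case over a one-letter alphabet.

  With slack \<delta>, the bins get exponent H(X|B) + 3\<delta>, and bins times keys get H(X|E) -
  3\<delta>; this is why the rate loses 6\<delta>. Rounding the number of bins is harmless only if
  its exponent is nonnegative, which calls for H(X|B) \<ge> 0 up to the slack; this comes out of
  Bob's own projectors. A nonpositive difference of the Holevo quantities is covered by a protocol
  with a single key value.\<close>

lemma mult_mat_entry:
  assumes "A \<in> carrier_mat n m" "B \<in> carrier_mat m k" "i < n" "j < k"
  shows "(A * B) $$ (i, j) = (\<Sum>l<m. A $$ (i, l) * B $$ (l, j))"
  using assms by (auto simp: scalar_prod_def atLeast0LessThan)

lemma adjoint_dim [simp]:
  "dim_row (mat_adjoint A) = dim_col A" "dim_col (mat_adjoint A) = dim_row A"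
  by (auto simp: mat_adjoint_def)

lemma adjoint_carrier [simp]:
  "mat_adjoint A \<in> carrier_mat n m \<longleftrightarrow> A \<in> carrier_mat m n"
  unfolding carrier_mat_def by (simp only: mem_Collect_eq adjoint_dim) blast

lemma adjoint_entry [simp]:
  fixes A :: "complex mat"
  assumes "i < dim_col A" "j < dim_row A"
  shows "mat_adjoint A $$ (i, j) = cnj (A $$ (j, i))"
  using assms by (simp add: mat_adjoint_def mat_of_rows_index)

lemma adjoint_adjoint [simp]:
  fixes A :: "complex mat"
  shows "mat_adjoint (mat_adjoint A) = A"
  by (rule eq_matI) auto

lemma adjoint_mult:
  fixes A B :: "complex mat"
  assumes "A \<in> carrier_mat n m" "B \<in> carrier_mat m k"
  shows "mat_adjoint (A * B) = mat_adjoint B * mat_adjoint A"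
proof (rule eq_matI)
  fix i j assume "i < dim_row (mat_adjoint B * mat_adjoint A)" "j < dim_col (mat_adjoint B * mat_adjoint A)"
  then have ij: "i < k" "j < n" using assms by auto
  have "(mat_adjoint B * mat_adjoint A) $$ (i, j) = (\<Sum>l<m. cnj (B $$ (l, i)) * cnj (A $$ (j, l)))"
    using assms ij by (subst mult_mat_entry[of _ k m _ n]) (auto intro!: sum.cong)
  then show "mat_adjoint (A * B) $$ (i, j) = (mat_adjoint B * mat_adjoint A) $$ (i, j)"
    using assms ij
    by (simp add: mult_mat_entry[of A n m B k] mult.commute del: index_mult_mat(1))
qed (use assms in auto)

lemma adjoint_one [simp]: "mat_adjoint (1\<^sub>m n :: complex mat) = 1\<^sub>m n"
  by (rule eq_matI) auto

lemma adjoint_minus: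
  fixes A B :: "complex mat"
  assumes "A \<in> carrier_mat n m" "B \<in> carrier_mat n m"
  shows "mat_adjoint (A - B) = mat_adjoint A - mat_adjoint B"
  by (rule eq_matI) (use assms in auto)

lemma adjoint_smult:
  fixes A :: "complex mat"
  shows "mat_adjoint (c \<cdot>\<^sub>m A) = cnj c \<cdot>\<^sub>m mat_adjoint A"
  by (rule eq_matI) auto

lemma adjoint_diag: "mat_adjoint (mat_diag n f) = mat_diag n (\<lambda>i. cnj (f i))"
  by (rule eq_matI) (auto simp: mat_diag_def)

lemma mat_sum_carrier [simp]: "mat_sum d F S \<in> carrier_mat d d"
  by (simp add: mat_sum_def)

lemma mat_sum_dim [simp]: "dim_row (mat_sum d F S) = d" "dim_col (mat_sum d F S) = d"
  by (simp_all add: mat_sum_def)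

lemma mat_sum_entry [simp]: "i < d \<Longrightarrow> j < d \<Longrightarrow> mat_sum d F S $$ (i, j) = (\<Sum>s\<in>S. F s $$ (i, j))"
  by (simp add: mat_sum_def)

lemma adjoint_mat_sum:
  assumes "\<And>s. s \<in> S \<Longrightarrow> F s \<in> carrier_mat d d"
  shows "mat_adjoint (mat_sum d F S) = mat_sum d (\<lambda>s. mat_adjoint (F s)) S"
  proof (rule eq_matI)
  have [simp]: "dim_row (F s) = d" "dim_col (F s) = d" if "s \<in> S" for s
    using assms[OF that] by auto
  fix i j assume "i < dim_row (mat_sum d (\<lambda>s. mat_adjoint (F s)) S)"
    "j < dim_col (mat_sum d (\<lambda>s. mat_adjoint (F s)) S)"
  then show "mat_adjoint (mat_sum d F S) $$ (i, j) = mat_sum d (\<lambda>s. mat_adjoint (F s)) S $$ (i, j)"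
    by (auto intro!: sum.cong)
qed auto

lemma trace_mult:
  assumes "A \<in> carrier_mat n m" "B \<in> carrier_mat m n"
  shows "mat_trace (A * B) = (\<Sum>i<n. \<Sum>j<m. A $$ (i, j) * B $$ (j, i))"
  using assms by (auto simp: mat_trace_def mult_mat_entry[of A n m B n] simp del: index_mult_mat(1))

lemma trace_comm:
  assumes "A \<in> carrier_mat n m" "B \<in> carrier_mat m n"
  shows "mat_trace (A * B) = mat_trace (B * A)"
  unfolding trace_mult[OF assms] trace_mult[OF assms(2,1)]
  by (subst sum.swap) (simp add: mult.commute)

lemma trace_add:
  assumes "A \<in> carrier_mat n n" "B \<in> carrier_mat n n"
  shows "mat_trace (A + B) = mat_trace A + mat_trace B"
  using assms by (auto simp: mat_trace_def sum.distrib)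

lemma trace_minus:
  assumes "A \<in> carrier_mat n n" "B \<in> carrier_mat n n"
  shows "mat_trace (A - B) = mat_trace A - mat_trace B"
  using assms by (auto simp: mat_trace_def sum_subtractf)

lemma trace_smult:
  assumes "A \<in> carrier_mat n n"
  shows "mat_trace (c \<cdot>\<^sub>m A) = c * mat_trace A"
  using assms by (auto simp: mat_trace_def sum_distrib_left)

lemma trace_mult_mat_sum:
  assumes "V \<in> carrier_mat d d" "\<And>s. s \<in> S \<Longrightarrow> F s \<in> carrier_mat d d"
  shows "mat_trace (V * mat_sum d F S) = (\<Sum>s\<in>S. mat_trace (V * F s))"
proof -
  have "mat_trace (V * mat_sum d F S) = (\<Sum>i<d. \<Sum>j<d. \<Sum>s\<in>S. V $$ (i, j) * F s $$ (j, i))"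
    using assms by (subst trace_mult[of _ d d]) (auto intro!: sum.cong simp: sum_distrib_left)
  also have "\<dots> = (\<Sum>i<d. \<Sum>s\<in>S. \<Sum>j<d. V $$ (i, j) * F s $$ (j, i))"
    by (intro sum.cong refl sum.swap)
  also have "\<dots> = (\<Sum>s\<in>S. \<Sum>i<d. \<Sum>j<d. V $$ (i, j) * F s $$ (j, i))"
    by (rule sum.swap)
  also have "\<dots> = (\<Sum>s\<in>S. mat_trace (V * F s))"
    using assms by (intro sum.cong refl) (auto simp: trace_mult[of _ d d])
  finally show ?thesis .
qed

text \<open>Going through \<open>L2_set\<close> hands over Cauchy-Schwarz and Minkowski for the
  entries; \<open>frob_sq\<close> expands the square when sums are needed.\<close>

definition frob :: "complex mat \<Rightarrow> real" where
  "frob A = L2_set (\<lambda>p. cmod (A $$ p)) ({..<dim_row A} \<times> {..<dim_col A})"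

definition frob_inner :: "complex mat \<Rightarrow> complex mat \<Rightarrow> complex" where
  "frob_inner A B = mat_trace (A * mat_adjoint B)"

lemma frob_nonneg [simp]: "0 \<le> frob A"
  by (simp add: frob_def L2_set_nonneg)

lemma frob_sq: "A \<in> carrier_mat n m \<Longrightarrow> (frob A)\<^sup>2 = (\<Sum>i<n. \<Sum>j<m. (cmod (A $$ (i, j)))\<^sup>2)"
  by (auto simp: frob_def L2_set_def sum_nonneg sum.cartesian_product case_prod_beta)

lemma frob_inner_eq:
  assumes "A \<in> carrier_mat n m" "B \<in> carrier_mat n m"
  shows "frob_inner A B = (\<Sum>i<n. \<Sum>j<m. A $$ (i, j) * cnj (B $$ (i, j)))"
  unfolding frob_inner_def using assms
  by (subst trace_mult[of _ n m]) (auto intro!: sum.cong)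

lemma frob_inner_self:
  assumes "A \<in> carrier_mat n m"
  shows "frob_inner A A = complex_of_real ((frob A)\<^sup>2)"
  using assms
  by (subst frob_inner_eq[of _ n m]) (auto simp: frob_sq[of A n m] complex_norm_square simp del: of_real_power)

lemma trace_adjoint_self:
  assumes "A \<in> carrier_mat n m"
  shows "mat_trace (A * mat_adjoint A) = complex_of_real ((frob A)\<^sup>2)"
  using frob_inner_self[OF assms] by (simp add: frob_inner_def)

lemma frob_cauchy:
  assumes "A \<in> carrier_mat n m" "B \<in> carrier_mat n m"
  shows "cmod (frob_inner A B) \<le> frob A * frob B"
proof -
  let ?S = "{..<n} \<times> {..<m}"
  have "frob_inner A B = (\<Sum>(i, j)\<in>?S. A $$ (i, j) * cnj (B $$ (i, j)))"
    by (simp add: frob_inner_eq[OF assms] sum.cartesian_product)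
  also have "cmod \<dots> \<le> (\<Sum>p\<in>?S. \<bar>cmod (A $$ p)\<bar> * \<bar>cmod (B $$ p)\<bar>)"
    by (rule sum_norm_le) (auto simp: norm_mult)
  also have "\<dots> \<le> L2_set (\<lambda>p. cmod (A $$ p)) ?S * L2_set (\<lambda>p. cmod (B $$ p)) ?S"
    by (rule L2_set_mult_ineq)
  also have "\<dots> = frob A * frob B"
    using assms by (auto simp: frob_def case_prod_beta)
  finally show ?thesis .
qed

lemma frob_add_le:
  assumes "A \<in> carrier_mat n m" "B \<in> carrier_mat n m"
  shows "frob (A + B) \<le> frob A + frob B"
proof -
  let ?S = "{..<n} \<times> {..<m}"
  have "frob (A + B) = L2_set (\<lambda>p. cmod ((A + B) $$ p)) ?S"
    using assms by (auto simp: frob_def case_prod_beta)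
  also have "\<dots> \<le> L2_set (\<lambda>p. cmod (A $$ p) + cmod (B $$ p)) ?S"
    by (rule L2_set_mono) (use assms in \<open>auto intro: norm_triangle_ineq\<close>)
  also have "\<dots> \<le> L2_set (\<lambda>p. cmod (A $$ p)) ?S + L2_set (\<lambda>p. cmod (B $$ p)) ?S"
    by (rule L2_set_triangle_ineq)
  also have "\<dots> = frob A + frob B"
    using assms by (auto simp: frob_def case_prod_beta)
  finally show ?thesis .
qed

lemma frob_adjoint [simp]: "frob (mat_adjoint A) = frob A"
proof -
  have "(frob (mat_adjoint A))\<^sup>2 = (frob A)\<^sup>2"
    by (subst (1 2) frob_sq[OF carrier_matI[OF refl refl]], simp, subst sum.swap) simp
  then show ?thesis by simp
qed

lemma frob_smult: "frob (c \<cdot>\<^sub>m A) = cmod c * frob A"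
proof -
  have "(frob (c \<cdot>\<^sub>m A))\<^sup>2 = (cmod c * frob A)\<^sup>2"
    unfolding power_mult_distrib
    by (subst (1 2) frob_sq[OF carrier_matI[OF refl refl]])
      (simp add: norm_mult power_mult_distrib sum_distrib_left)
  then show ?thesis by (simp only: power2_eq_iff_nonneg frob_nonneg mult_nonneg_nonneg norm_ge_zero)
qed

lemma frob_minus_le:
  assumes "A \<in> carrier_mat n m" "B \<in> carrier_mat n m"
  shows "frob (A - B) \<le> frob A + frob B"
proof -
  have "A - B = A + (-1) \<cdot>\<^sub>m B"
    using assms by (intro eq_matI) auto
  then show ?thesis using frob_add_le[of A n m "(-1) \<cdot>\<^sub>m B"] assms by (simp add: frob_smult)
qed

text \<open>\<open>V\<close> is a contraction in the operator norm; testing on \<open>d \<times> d\<close> matrices in the Frobenius norm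
  amounts to testing on vectors.\<close>

definition contraction :: "nat \<Rightarrow> complex mat \<Rightarrow> bool" where
  "contraction d V \<longleftrightarrow> V \<in> carrier_mat d d \<and> (\<forall>A \<in> carrier_mat d d. frob (V * A) \<le> frob A)"

lemma frob_isometry:
  assumes "W \<in> carrier_mat d d" "mat_adjoint W * W = 1\<^sub>m d" "A \<in> carrier_mat d k"
  shows "frob (W * A) = frob A"
proof -
  have "mat_adjoint W * (W * A) = (mat_adjoint W * W) * A"
    using assms by (intro assoc_mult_mat[symmetric, of _ d d _ d _ k]) auto
  then have WA: "mat_adjoint W * (W * A) = A" using assms by simp
  have "complex_of_real ((frob (W * A))\<^sup>2) = mat_trace (mat_adjoint (W * A) * (W * A))"
    using assms by (subst trace_comm[of _ k d]) (auto simp: trace_adjoint_self[of "W * A" d k])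
  also have "mat_adjoint (W * A) * (W * A) = mat_adjoint A * (mat_adjoint W * (W * A))"
    using assms by (subst adjoint_mult[of _ d d _ k]) (auto intro!: assoc_mult_mat[of _ k d _ d _ k])
  also have "mat_trace \<dots> = complex_of_real ((frob A)\<^sup>2)"
    using assms by (simp only: WA, subst trace_comm[of _ k d]) (auto simp: trace_adjoint_self[of A d k])
  finally have "(frob (W * A))\<^sup>2 = (frob A)\<^sup>2" using of_real_eq_iff by blast
  then show ?thesis by simp
qed

lemma frob_isometry_right:
  assumes "W \<in> carrier_mat d d" "W * mat_adjoint W = 1\<^sub>m d" "A \<in> carrier_mat k d"
  shows "frob (A * W) = frob A"
proof -
  have "frob (mat_adjoint W * mat_adjoint A) = frob (mat_adjoint A)"
    using assms by (intro frob_isometry[of _ d _ k]) auto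
  then show ?thesis using assms by (simp flip: adjoint_mult[of A k d W d])
qed

section \<open>Orthogonal projectors in the Frobenius geometry\<close>

definition projector :: "nat \<Rightarrow> complex mat \<Rightarrow> bool" where
  "projector d Q \<longleftrightarrow> Q \<in> carrier_mat d d \<and> mat_adjoint Q = Q \<and> Q * Q = Q"

lemma projectorD:
  assumes "projector d Q"
  shows "Q \<in> carrier_mat d d" "mat_adjoint Q = Q" "Q * Q = Q"
  using assms by (auto simp: projector_def)

lemma complement_mult:
  fixes Q :: "complex mat"
  assumes "Q \<in> carrier_mat d d" "A \<in> carrier_mat d m"
  shows "(1\<^sub>m d - Q) * A = A - Q * A"
  using minus_mult_distrib_mat[of "1\<^sub>m d" d d Q A m] assms by simp

lemma projector_complement:
  assumes "projector d Q"
  shows "projector d (1\<^sub>m d - Q)"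
proof -
  note Q = projectorD[OF assms]
  have C: "1\<^sub>m d - Q \<in> carrier_mat d d" using Q(1) by (rule minus_carrier_mat)
  have "Q * (1\<^sub>m d - Q) = 0\<^sub>m d d"
    using mult_minus_distrib_mat[of Q d d "1\<^sub>m d" d Q] Q by simp
  then have "(1\<^sub>m d - Q) * (1\<^sub>m d - Q) = 1\<^sub>m d - Q"
    unfolding complement_mult[OF Q(1) C] by (intro eq_matI) (use Q(1) in auto)
  then show ?thesis
    using Q C adjoint_minus[of "1\<^sub>m d" d d Q] by (simp add: projector_def)
qed

lemma frob_inner_mult_left:
  assumes "P \<in> carrier_mat n n" "A \<in> carrier_mat n m" "B \<in> carrier_mat n m"
  shows "frob_inner (P * A) B = frob_inner A (mat_adjoint P * B)"
proof -
  have "mat_trace (P * A * mat_adjoint B) = mat_trace (P * (A * mat_adjoint B))"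
    using assms by (simp add: assoc_mult_mat[of _ n n _ m _ n])
  also have "\<dots> = mat_trace (A * mat_adjoint B * P)"
    using assms by (intro trace_comm[of _ n n]) auto
  also have "A * mat_adjoint B * P = A * (mat_adjoint B * P)"
    using assms by (intro assoc_mult_mat[of _ n m _ n _ n]) auto
  also have "mat_adjoint B * P = mat_adjoint (mat_adjoint P * B)"
    using assms by (simp add: adjoint_mult[of _ n n _ m])
  finally show ?thesis by (simp add: frob_inner_def)
qed

lemma frob_inner_diff_left:
  assumes "A \<in> carrier_mat n m" "B \<in> carrier_mat n m" "C \<in> carrier_mat n m"
  shows "frob_inner (A - B) C = frob_inner A C - frob_inner B C"
  using assms by (simp add: frob_inner_eq[of _ n m] sum_subtractf left_diff_distrib minus_carrier_mat)

lemma frob_inner_diff_right: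
  assumes "A \<in> carrier_mat n m" "B \<in> carrier_mat n m" "C \<in> carrier_mat n m"
  shows "frob_inner A (B - C) = frob_inner A B - frob_inner A C"
  using assms by (simp add: frob_inner_eq[of _ n m] sum_subtractf right_diff_distrib minus_carrier_mat)

lemma projector_frob_inner:
  assumes "projector d Q" "A \<in> carrier_mat d m" "B \<in> carrier_mat d m"
  shows "frob_inner A (Q * B) = frob_inner (Q * A) (Q * B)"
proof -
  note Q = projectorD[OF assms(1)]
  have "frob_inner (Q * A) (Q * B) = frob_inner A (Q * (Q * B))"
    using frob_inner_mult_left[of Q d A m "Q * B"] Q assms by simp
  also have "Q * (Q * B) = (Q * Q) * B"
    using Q assms by (intro assoc_mult_mat[symmetric, of _ d d _ d _ m]) auto
  finally show ?thesis by (simp add: Q)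
qed

lemma frob_pythagoras:
  assumes "projector d Q" "A \<in> carrier_mat d m"
  shows "(frob ((1\<^sub>m d - Q) * A))\<^sup>2 + (frob (Q * A))\<^sup>2 = (frob A)\<^sup>2"
proof -
  note Q = projectorD[OF assms(1)] and A = assms(2)
  have QA: "Q * A \<in> carrier_mat d m" using Q A by simp
  have "complex_of_real ((frob A)\<^sup>2) = frob_inner A A"
    by (simp add: frob_inner_self[OF A])
  also have "\<dots> = frob_inner A ((1\<^sub>m d - Q) * A) + frob_inner A (Q * A)"
    by (simp only: complement_mult[OF Q(1) A] frob_inner_diff_right[OF A A QA] diff_add_cancel)
  also have "\<dots> = frob_inner ((1\<^sub>m d - Q) * A) ((1\<^sub>m d - Q) * A) + frob_inner (Q * A) (Q * A)"
    using projector_frob_inner[OF assms(1) A A]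
      projector_frob_inner[OF projector_complement[OF assms(1)] A A] by simp
  also have "\<dots> = complex_of_real ((frob ((1\<^sub>m d - Q) * A))\<^sup>2 + (frob (Q * A))\<^sup>2)"
    using frob_inner_self[OF mult_carrier_mat[OF minus_carrier_mat[OF Q(1), of "1\<^sub>m d"] A]] frob_inner_self[OF QA]
    by simp
  finally show ?thesis using of_real_eq_iff by metis
qed

lemma frob_projector_le:
  assumes "projector d Q" "A \<in> carrier_mat d m"
  shows "frob (Q * A) \<le> frob A"
  using frob_pythagoras[OF assms] by (metis frob_nonneg le_add_same_cancel2 power2_le_imp_le zero_le_power2)

section \<open>Spectral theorem and trace norm\<close>

text \<open>\<open>gram_schmidt\<close> applied to a completed basis keeps \<open>v\<close> in front
  and makes the vectors orthogonal without normalising them. Dividing column \<open>j\<close> by its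
  length \<open>s j\<close> gives a unitary, and \<open>c\<close> is the reciprocal length of
  \<open>v\<close>.\<close>

lemma unitary_with_first_column:
  fixes v :: "complex vec"
  assumes v: "v \<in> carrier_vec n" and v0: "v \<noteq> 0\<^sub>v n"
  shows "\<exists>U c. U \<in> carrier_mat n n \<and> mat_adjoint U * U = 1\<^sub>m n \<and> (\<forall>i<n. U $$ (i, 0) = c * v $ i)"
proof -
  have n: "0 < n"
  proof (rule ccontr)
    assume "\<not> 0 < n"
    then have "v = 0\<^sub>v n" using v by (intro eq_vecI) auto
    with v0 show False by simp
  qed
  define b where "b = basis_completion v"
  define ws where "ws = gram_schmidt n b"
  interpret cof_vec_space n "TYPE(complex)" .
  from basis_completion[OF v v0, folded b_def]
  have dist_b: "distinct b" and indep: "\<not> lin_dep (set b)" and b: "set b \<subseteq> carrier_vec n"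
    and hdb: "hd b = v" and len_b: "length b = n" by auto
  from hdb len_b n obtain vs where bv: "b = v # vs" by (cases b) auto
  from gram_schmidt_result[OF b dist_b indep refl, folded ws_def]
  have ws: "set ws \<subseteq> carrier_vec n" "corthogonal ws" "length ws = n"
    by (auto simp: len_b)
  from gram_schmidt_hd[OF v, of vs, folded bv] have hdws: "hd ws = v" unfolding ws_def .
  have wsc: "ws ! i \<in> carrier_vec n" if "i < n" for i using ws that by auto
  define s where "s i = sqrt (\<Sum>l<n. (cmod (ws ! i $ l))\<^sup>2)" for i
  have ip: "ws ! i \<bullet>c ws ! j = (\<Sum>l<n. ws ! i $ l * cnj (ws ! j $ l))" if "i < n" "j < n" for i j
    using wsc[OF that(1)] wsc[OF that(2)] by (auto simp: scalar_prod_def atLeast0LessThan)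
  have ss: "(\<Sum>l<n. ws ! i $ l * cnj (ws ! i $ l)) = complex_of_real ((s i)\<^sup>2)" for i
    by (simp add: s_def sum_nonneg complex_norm_square del: of_real_power)
  have spos: "s i \<noteq> 0" if "i < n" for i
    using corthogonalD[OF ws(2), of i i] ws(3) that ss[of i] by (auto simp: ip)
  define U where "U = mat n n (\<lambda>(i, j). ws ! j $ i / complex_of_real (s j))"
  have U: "U \<in> carrier_mat n n" by (simp add: U_def)
  have "mat_adjoint U * U = 1\<^sub>m n"
  proof (rule eq_matI)
    fix i j assume "i < dim_row (1\<^sub>m n)" "j < dim_col (1\<^sub>m n)"
    then have ij: "i < n" "j < n" by auto
    have "(mat_adjoint U * U) $$ (i, j)
        = (\<Sum>l<n. ws ! j $ l * cnj (ws ! i $ l)) / (complex_of_real (s i) * complex_of_real (s j))"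
      using U ij by (subst mult_mat_entry[of _ n n _ n])
        (auto simp: U_def sum_divide_distrib mult.commute intro!: sum.cong)
    also have "\<dots> = (if i = j then 1 else 0)"
    proof (cases "i = j")
      case True
      then show ?thesis using spos[OF ij(1)] by (simp add: ss power2_eq_square)
    next
      case False
      then show ?thesis using corthogonalD[OF ws(2), of j i] ws(3) ij by (simp add: ip)
    qed
    finally show "(mat_adjoint U * U) $$ (i, j) = 1\<^sub>m n $$ (i, j)" using ij by simp
  qed (use U in auto)
  moreover have "U $$ (i, 0) = (1 / complex_of_real (s 0)) * v $ i" if "i < n" for i
  proof -
    have "ws ! 0 = v" using hdws ws(3) n by (metis hd_conv_nth length_greater_0_conv)
    then show ?thesis using that n by (simp add: U_def)
  qed
  ultimately show ?thesis using U by blast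
qed

lemma unitary_right:
  fixes U :: "complex mat"
  assumes "U \<in> carrier_mat n n" "mat_adjoint U * U = 1\<^sub>m n"
  shows "U * mat_adjoint U = 1\<^sub>m n"
  by (rule mat_mult_left_right_inverse[OF _ assms(1) assms(2)]) (use assms in simp)

lemma spectral_decompI:
  assumes "A \<in> carrier_mat n n" "U \<in> carrier_mat n n" "mat_adjoint U * U = 1\<^sub>m n"
    and "A = U * mat_diag n (\<lambda>i. complex_of_real (e i)) * mat_adjoint U"
  shows "spectral_decomp A U e"
  using assms unitary_right[OF assms(2,3)] by (auto simp: spectral_decomp_def Let_def)

lemma spectral_decompD:
  assumes "spectral_decomp A U e" "A \<in> carrier_mat n n"
  shows "U \<in> carrier_mat n n" "U * mat_adjoint U = 1\<^sub>m n" "mat_adjoint U * U = 1\<^sub>m n"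
    "A = U * mat_diag n (\<lambda>i. complex_of_real (e i)) * mat_adjoint U"
  using assms by (auto simp: spectral_decomp_def Let_def)

text \<open>Deflation by induction on the dimension. An eigenvector becomes the first column of a
  unitary \<open>W\<close>; conjugating by \<open>W\<close> clears the first column below the
  corner, Hermitian symmetry clears the first row as well, and a smaller Hermitian block
  \<open>C\<close> remains.\<close>

lemma hermitian_spectral:
  fixes A :: "complex mat"
  assumes "A \<in> carrier_mat n n" "mat_adjoint A = A"
  shows "\<exists>U e. spectral_decomp A U e"
  using assms
proof (induction n arbitrary: A)
  case 0
  have "spectral_decomp A (1\<^sub>m 0) (\<lambda>_. 0)"
    using 0 by (intro spectral_decompI[of _ 0]) auto
  then show ?case by blast
next
  case (Suc n A)
  let ?m = "Suc n"
  note A = Suc.prems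
  obtain k where "eigenvalue A k"
    using spectrum_non_empty[OF A(1)] by (auto simp: spectrum_def)
  then obtain v where v: "v \<in> carrier_vec ?m" "v \<noteq> 0\<^sub>v ?m" "A *\<^sub>v v = k \<cdot>\<^sub>v v"
    using A(1) by (auto simp: eigenvalue_def eigenvector_def)
  obtain W c where W: "W \<in> carrier_mat ?m ?m" "mat_adjoint W * W = 1\<^sub>m ?m"
    and Wc: "\<And>i. i < ?m \<Longrightarrow> W $$ (i, 0) = c * v $ i"
    using unitary_with_first_column[OF v(1,2)] by blast
  note W' = unitary_right[OF W]
  define B where "B = mat_adjoint W * (A * W)"
  have B: "B \<in> carrier_mat ?m ?m" using W A by (auto simp: B_def)
  have Bh: "mat_adjoint B = B"
    using W A by (simp add: B_def adjoint_mult[of _ ?m ?m _ ?m] assoc_mult_mat[of _ ?m ?m _ ?m _ ?m])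
  have AWB: "W * B * mat_adjoint W = A"
  proof -
    have "W * B = W * mat_adjoint W * (A * W)"
      unfolding B_def using W A by (intro assoc_mult_mat[symmetric, of _ ?m ?m _ ?m _ ?m]) auto
    then have "W * B = A * W" using W' A W by simp
    then show ?thesis using W W' A assoc_mult_mat[of A ?m ?m W ?m "mat_adjoint W" ?m] by simp
  qed
  have AW0: "(A * W) $$ (i, 0) = k * W $$ (i, 0)" if i: "i < ?m" for i
  proof -
    have "(A * W) $$ (i, 0) = c * (\<Sum>l<?m. A $$ (i, l) * v $ l)"
      using W A i by (subst mult_mat_entry[of _ ?m ?m _ ?m]) (auto simp: Wc sum_distrib_left mult.left_commute simp del: sum.lessThan_Suc intro!: sum.cong)
    also have "(\<Sum>l<?m. A $$ (i, l) * v $ l) = (A *\<^sub>v v) $ i"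
      using A(1) v(1) i by (auto simp: scalar_prod_def atLeast0LessThan simp del: sum.lessThan_Suc)
    also have "\<dots> = k * v $ i" unfolding v(3) using i v(1) by simp
    finally show ?thesis by (simp only: Wc[OF i] mult.left_commute)
  qed
  have B0: "B $$ (i, 0) = (if i = 0 then k else 0)" if i: "i < ?m" for i
  proof -
    have "B $$ (i, 0) = (\<Sum>l<?m. mat_adjoint W $$ (i, l) * (A * W) $$ (l, 0))"
      unfolding B_def using W A i by (subst mult_mat_entry[of _ ?m ?m _ ?m]) auto
    also have "\<dots> = k * (\<Sum>l<?m. mat_adjoint W $$ (i, l) * W $$ (l, 0))"
      by (simp add: AW0 sum_distrib_left mult.left_commute del: sum.lessThan_Suc index_mult_mat)
    also have "(\<Sum>l<?m. mat_adjoint W $$ (i, l) * W $$ (l, 0)) = (mat_adjoint W * W) $$ (i, 0)"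
      using W i by (subst mult_mat_entry[of _ ?m ?m _ ?m]) auto
    finally show ?thesis using i by (simp add: W(2))
  qed
  \<comment> \<open>Symmetry reflects the cleared column into the first row; at the corner it makes
    \<open>k\<close> real.\<close>
  have B0': "B $$ (0, j) = (if j = 0 then k else 0)" if j: "j < ?m" for j
  proof -
    have "B $$ (0, j) = cnj (B $$ (j, 0))"
      using B j arg_cong[OF Bh, of "\<lambda>C. C $$ (0, j)"] by simp
    moreover have "cnj k = k"
      using B0[of 0] B arg_cong[OF Bh, of "\<lambda>C. C $$ (0, 0)"] by simp
    ultimately show ?thesis by (simp add: B0[OF j])
  qed
  have kr: "complex_of_real (Re k) = k"
    using B0[of 0] B arg_cong[OF Bh, of "\<lambda>C. C $$ (0, 0)"] by (simp add: complex_eq_iff)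
  define C where "C = mat n n (\<lambda>(i, j). B $$ (Suc i, Suc j))"
  have C: "C \<in> carrier_mat n n" by (simp add: C_def)
  have "mat_adjoint C = C"
  proof (rule eq_matI)
    fix i j assume "i < dim_row C" "j < dim_col C"
    then show "mat_adjoint C $$ (i, j) = C $$ (i, j)"
      using B arg_cong[OF Bh, of "\<lambda>C. C $$ (Suc i, Suc j)"] by (simp add: C_def)
  qed (simp_all add: C_def)
  from Suc.IH[OF C this] obtain U e where "spectral_decomp C U e" by blast
  note U = spectral_decompD[OF this C]
  let ?D = "mat_diag n (\<lambda>i. complex_of_real (e i))"
  define f where "f i = (case i of 0 \<Rightarrow> Re k | Suc j \<Rightarrow> e j)" for i
  define V where "V = four_block_mat (1\<^sub>m 1) (0\<^sub>m 1 n) (0\<^sub>m n 1) U"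
  have V: "V \<in> carrier_mat ?m ?m" using four_block_carrier_mat[of "1\<^sub>m 1" 1 1 U n n] U(1) by (simp add: V_def)
  have Va: "mat_adjoint V = four_block_mat (1\<^sub>m 1) (0\<^sub>m 1 n) (0\<^sub>m n 1) (mat_adjoint U)"
    by (rule eq_matI) (use U in \<open>auto simp: V_def index_mat_four_block\<close>)
  have VV: "mat_adjoint V * V = 1\<^sub>m ?m"
    unfolding Va using U
    by (subst V_def, subst mult_four_block_mat[of _ 1 1 _ n _ n _ _ 1 _ n]) (auto intro!: eq_matI)
  have Df: "mat_diag ?m (\<lambda>i. complex_of_real (f i)) = four_block_mat (mat 1 1 (\<lambda>_. k)) (0\<^sub>m 1 n) (0\<^sub>m n 1) ?D"
    by (rule eq_matI) (auto simp: mat_diag_def f_def index_mat_four_block kr split: nat.split)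
  have Bf: "B = four_block_mat (mat 1 1 (\<lambda>_. k)) (0\<^sub>m 1 n) (0\<^sub>m n 1) C"
    by (rule eq_matI) (use B B0 B0' in \<open>auto simp: C_def index_mat_four_block\<close>)
  have k1: "mat 1 1 (\<lambda>_. k) \<in> carrier_mat 1 1" by simp
  have BV: "V * mat_diag ?m (\<lambda>i. complex_of_real (f i)) * mat_adjoint V = B"
  proof -
    have "V * mat_diag ?m (\<lambda>i. complex_of_real (f i))
        = four_block_mat (mat 1 1 (\<lambda>_. k)) (0\<^sub>m 1 n) (0\<^sub>m n 1) (U * ?D)"
      unfolding V_def Df using U
      by (subst mult_four_block_mat[of _ 1 1 _ n _ n _ _ 1 _ n]) (auto simp: mult_carrier_mat[of _ n n _ n] left_mult_zero_mat[of _ n n] right_mult_zero_mat[of _ n n])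
    also have "\<dots> * mat_adjoint V = four_block_mat (mat 1 1 (\<lambda>_. k)) (0\<^sub>m 1 n) (0\<^sub>m n 1) (U * ?D * mat_adjoint U)"
      unfolding Va using U
      by (subst mult_four_block_mat[of _ 1 1 _ n _ n _ _ 1 _ n]) (auto simp: mult_carrier_mat[of _ n n _ n] left_mult_zero_mat[of _ n n] right_mult_zero_mat[of _ n n])
    finally show ?thesis by (simp add: Bf flip: U(4))
  qed
  have "spectral_decomp A (W * V) f"
  proof (rule spectral_decompI[OF A(1)])
    let ?E = "mat_diag ?m (\<lambda>i. complex_of_real (f i))"
    show WV: "W * V \<in> carrier_mat ?m ?m" using W V by simp
    have adj: "mat_adjoint (W * V) = mat_adjoint V * mat_adjoint W"
      using W(1) V by (rule adjoint_mult)
    have "mat_adjoint (W * V) * (W * V) = mat_adjoint V * (mat_adjoint W * W) * V"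
      unfolding adj using W(1) V by (simp add: assoc_mult_mat[of _ ?m ?m _ ?m _ ?m])
    then show "mat_adjoint (W * V) * (W * V) = 1\<^sub>m ?m" using V VV by (simp add: W(2))
    have "W * V * ?E * mat_adjoint (W * V) = W * (V * ?E * mat_adjoint V) * mat_adjoint W"
      unfolding adj using W(1) V by (simp add: assoc_mult_mat[of _ ?m ?m _ ?m _ ?m] mult_carrier_mat[of _ ?m ?m _ ?m])
    then show "A = W * V * ?E * mat_adjoint (W * V)" by (simp add: BV AWB)
  qed
  then show ?case by blast
qed

lemma mat_diag_cong: "(\<And>i. i < n \<Longrightarrow> f i = g i) \<Longrightarrow> mat_diag n f = mat_diag n g"
  by (rule eq_matI) (auto simp: mat_diag_def)

text \<open>The witness is the unitary \<open>U sgn(e) U\<^sup>*\<close>, with \<open>sgn 0 = 1\<close>.\<close>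

lemma trace_norm_hermitian:
  assumes A: "A \<in> carrier_mat d d" "mat_adjoint A = A"
  shows "\<exists>W. contraction d W \<and> trace_norm A = Re (mat_trace (W * A))"
proof -
  note [simp] = assoc_mult_mat[of _ d d _ d _ d] mult_carrier_mat[of _ d d _ d]
  obtain U e where "spectral_decomp A U e" using hermitian_spectral[OF A] by blast
  note U = spectral_decompD[OF this A(1)]
  let ?D = "\<lambda>f. mat_diag d (\<lambda>i. complex_of_real (f i))"
  have cancel: "mat_adjoint U * (U * X) = X" if [simp]: "X \<in> carrier_mat d d" for X
    using assoc_mult_mat[of "mat_adjoint U" d d U d X d] U that by simp
  have UDU: "U * ?D f * mat_adjoint U * (U * ?D g * mat_adjoint U) = U * ?D (\<lambda>i. f i * g i) * mat_adjoint U" for f g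
  proof -
    have "U * ?D f * mat_adjoint U * (U * ?D g * mat_adjoint U)
       = U * (?D f * (mat_adjoint U * (U * (?D g * mat_adjoint U))))" using U(1) by simp
    also have "\<dots> = U * ((?D f * ?D g) * mat_adjoint U)" using U(1) by (simp add: cancel del: mat_diag_diag)
    finally show ?thesis using U(1) by simp
  qed
  define s where "s i = (if 0 \<le> e i then 1 else - 1 :: real)" for i
  define W where "W = U * ?D s * mat_adjoint U"
  have W: "W \<in> carrier_mat d d" using U by (simp add: W_def)
  have Wa: "mat_adjoint W = W"
    using U(1) by (simp add: W_def adjoint_mult[of _ d d _ d] adjoint_diag)
  have WW: "mat_adjoint W * W = 1\<^sub>m d"
  proof -
    have "W * W = U * ?D (\<lambda>i. s i * s i) * mat_adjoint U" unfolding W_def by (rule UDU)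
    also have "(\<lambda>i. s i * s i) = (\<lambda>i. 1)" by (auto simp: s_def)
    finally show ?thesis using U by (simp add: Wa)
  qed
  have "mat_adjoint A * A = U * ?D (\<lambda>i. e i * e i) * mat_adjoint U"
    unfolding A(2) by (subst (1 2) U(4)) (rule UDU)
  then have "spectral_decomp (mat_adjoint A * A) U (\<lambda>i. e i * e i)"
    using U A by (intro spectral_decompI[of _ d]) auto
  then have "mat_fun sqrt (mat_adjoint A * A) = U * ?D (\<lambda>i. sqrt (e i * e i)) * mat_adjoint U"
    using mat_fun_eq A by force
  also have "(\<lambda>i. sqrt (e i * e i)) = (\<lambda>i. s i * e i)"
    by (auto simp: s_def)
  also have "U * ?D (\<lambda>i. s i * e i) * mat_adjoint U = W * A"
    unfolding W_def by (subst U(4)) (rule UDU[symmetric])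
  finally have "trace_norm A = Re (mat_trace (W * A))" by (simp add: trace_norm_def)
  moreover have "contraction d W"
    using W WW by (auto simp: contraction_def frob_isometry[of _ d _ d])
  ultimately show ?thesis by blast
qed

lemma vn_entropy_eq:
  assumes "A \<in> carrier_mat d d" "spectral_decomp A U e"
  shows "vn_entropy A = - (\<Sum>i<d. e i * log 2 (e i))"
proof -
  note [simp] = assoc_mult_mat[of _ d d _ d _ d] mult_carrier_mat[of _ d d _ d]
  note U = spectral_decompD[OF assms(2,1)]
  let ?D = "\<lambda>f. mat_diag d (\<lambda>i. complex_of_real (f i))"
  have cancel: "mat_adjoint U * (U * X) = X" if [simp]: "X \<in> carrier_mat d d" for X
    using assoc_mult_mat[of "mat_adjoint U" d d U d X d] U that by simp
  have "A * mat_fun (log 2) A = (U * ?D e * mat_adjoint U) * (U * ?D (\<lambda>i. log 2 (e i)) * mat_adjoint U)"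
    using mat_fun_eq[OF assms(2)] U(4) assms(1) by auto
  also have "\<dots> = U * (?D e * (mat_adjoint U * (U * (?D (\<lambda>i. log 2 (e i)) * mat_adjoint U))))"
    using U(1) by simp
  also have "\<dots> = U * (?D (\<lambda>i. e i * log 2 (e i)) * mat_adjoint U)"
    using U(1) by (simp add: cancel del: mat_diag_diag) (simp flip: assoc_mult_mat[of _ d d _ d _ d])
  finally have "mat_trace (A * mat_fun (log 2) A)
      = mat_trace (?D (\<lambda>i. e i * log 2 (e i)) * mat_adjoint U * U)"
    using U(1) by (subst trace_comm[of _ d d]) auto
  also have "?D (\<lambda>i. e i * log 2 (e i)) * mat_adjoint U * U = ?D (\<lambda>i. e i * log 2 (e i))"
    using U by (simp add: right_mult_one_mat[of _ d d])
  also have "mat_trace \<dots> = complex_of_real (\<Sum>i<d. e i * log 2 (e i))"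
    by (simp add: mat_trace_def mat_diag_def)
  finally show ?thesis by (simp add: vn_entropy_def)
qed

section \<open>Positive matrices, tensor products and partial traces\<close>

lemma quadratic_form:
  fixes A :: "complex mat"
  assumes "A \<in> carrier_mat d d" "v \<in> carrier_vec d"
  shows "(A *\<^sub>v v) \<bullet>c v = (\<Sum>i<d. \<Sum>j<d. A $$ (i, j) * v $ j * cnj (v $ i))"
  using assms by (auto simp: scalar_prod_def atLeast0LessThan sum_distrib_right)

text \<open>Polarisation. The form at e_a + c e_b is real; c = 0 makes the diagonal real, c = 1
  makes the imaginary parts of the entries (a, b) and (b, a) opposite, and c = \<i> makes their real
  parts equal.\<close>

lemma psd_hermitian:
  assumes "psd d A"
  shows "mat_adjoint A = A"
proof -
  have A: "A \<in> carrier_mat d d" using assms by (simp add: psd_def)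
  have q: "Im (A $$ (a, a) + c * A $$ (a, b) + cnj c * A $$ (b, a) + c * cnj c * A $$ (b, b)) = 0"
    if ab: "a < d" "b < d" for a b c
  proof -
    define v where "v = vec d (\<lambda>j. (if j = a then 1 else 0) + (if j = b then c else 0))"
    have v: "v \<in> carrier_vec d" by (simp add: v_def)
    have "(A *\<^sub>v v) \<bullet>c v = (\<Sum>i<d. (A $$ (i, a) + c * A $$ (i, b)) *
        ((if i = a then 1 else 0) + (if i = b then cnj c else 0)))"
      unfolding quadratic_form[OF A v] sum_distrib_right[symmetric] using ab
      by (intro sum.cong refl arg_cong2[of _ _ _ _ "(*)"])
        (auto simp: v_def distrib_left sum.distrib if_distrib[of "\<lambda>x. _ * x"] mult.commute cong: if_cong)
    also have "\<dots> = A $$ (a, a) + c * A $$ (a, b) + cnj c * A $$ (b, a) + c * cnj c * A $$ (b, b)"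
      using ab by (simp add: distrib_left sum.distrib if_distrib[of "\<lambda>x. _ * x"] algebra_simps cong: if_cong)
    finally show ?thesis using assms v by (auto simp: psd_def less_eq_complex_def)
  qed
  show ?thesis
  proof (rule eq_matI)
    fix i j assume "i < dim_row A" "j < dim_col A"
    then have ij: "i < d" "j < d" using A by auto
    have "A $$ (i, j) = cnj (A $$ (j, i))"
      using q[OF ij, of 1] q[OF ij, of \<i>] q[OF ij(1,1), of 0] q[OF ij(2,2), of 0]
      by (auto simp: complex_eq_iff)
    then show "mat_adjoint A $$ (i, j) = A $$ (i, j)" using A ij by simp
  qed (use A in auto)
qed

lemma psd_gram:
  assumes "Y \<in> carrier_mat d k"
  shows "psd d (Y * mat_adjoint Y)"
proof -
  have "0 \<le> (Y * mat_adjoint Y *\<^sub>v v) \<bullet>c v" if v: "v \<in> carrier_vec d" for v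
  proof -
    let ?w = "\<lambda>l. \<Sum>i<d. cnj (Y $$ (i, l)) * v $ i"
    have YY: "Y * mat_adjoint Y \<in> carrier_mat d d" using assms by simp
    have "(Y * mat_adjoint Y *\<^sub>v v) \<bullet>c v
        = (\<Sum>i<d. \<Sum>j<d. \<Sum>l<k. Y $$ (i, l) * cnj (Y $$ (j, l)) * v $ j * cnj (v $ i))"
      unfolding quadratic_form[OF YY v] using assms
      by (intro sum.cong refl) (simp add: mult_mat_entry[of _ d k _ d] sum_distrib_right del: index_mult_mat)
    also have "\<dots> = (\<Sum>i<d. \<Sum>l<k. \<Sum>j<d. Y $$ (i, l) * cnj (Y $$ (j, l)) * v $ j * cnj (v $ i))"
      by (intro sum.cong refl sum.swap)
    also have "\<dots> = (\<Sum>l<k. \<Sum>i<d. \<Sum>j<d. Y $$ (i, l) * cnj (Y $$ (j, l)) * v $ j * cnj (v $ i))"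
      by (rule sum.swap)
    also have "\<dots> = (\<Sum>l<k. ?w l * cnj (?w l))"
      by (intro sum.cong refl, simp add: sum_product, subst sum.swap, simp add: ac_simps)
    also have "0 \<le> \<dots>"
      by (intro sum_nonneg) (simp only: complex_norm_square[symmetric], simp add: less_eq_complex_def del: of_real_power)
    finally show ?thesis .
  qed
  then show ?thesis using assms by (auto simp: psd_def)
qed

lemma psd_mat_sum:
  assumes "\<And>s. s \<in> S \<Longrightarrow> psd d (F s)"
  shows "psd d (mat_sum d F S)"
proof -
  have "0 \<le> (mat_sum d F S *\<^sub>v v) \<bullet>c v" if v: "v \<in> carrier_vec d" for v
  proof -
    have "(mat_sum d F S *\<^sub>v v) \<bullet>c v = (\<Sum>i<d. \<Sum>j<d. \<Sum>s\<in>S. F s $$ (i, j) * v $ j * cnj (v $ i))"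
      using v by (subst quadratic_form[of _ d]) (auto simp: sum_distrib_right)
    also have "\<dots> = (\<Sum>i<d. \<Sum>s\<in>S. \<Sum>j<d. F s $$ (i, j) * v $ j * cnj (v $ i))"
      by (intro sum.cong refl sum.swap)
    also have "\<dots> = (\<Sum>s\<in>S. (\<Sum>i<d. \<Sum>j<d. F s $$ (i, j) * v $ j * cnj (v $ i)))"
      by (rule sum.swap)
    also have "\<dots> = (\<Sum>s\<in>S. (F s *\<^sub>v v) \<bullet>c v)"
      using assms v by (intro sum.cong refl quadratic_form[symmetric]) (auto simp: psd_def)
    also have "0 \<le> \<dots>"
      using assms v by (intro sum_nonneg) (auto simp: psd_def)
    finally show ?thesis .
  qed
  then show ?thesis by (auto simp: psd_def)
qed

text \<open>The weights are required to be nonnegative also beyond the dimension, where they are irrelevant.\<close>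

definition density_decomp :: "nat \<Rightarrow> complex mat \<Rightarrow> complex mat \<Rightarrow> (nat \<Rightarrow> real) \<Rightarrow> bool" where
  "density_decomp d \<omega> U e \<longleftrightarrow> \<omega> \<in> carrier_mat d d \<and> spectral_decomp \<omega> U e \<and>
     (\<forall>i. 0 \<le> e i) \<and> (\<Sum>i<d. e i) = 1"

lemma density_decompD:
  assumes "density_decomp d \<omega> U e"
  shows "\<omega> \<in> carrier_mat d d" "spectral_decomp \<omega> U e" "\<And>i. 0 \<le> e i" "(\<Sum>i<d. e i) = 1"
    "U \<in> carrier_mat d d" "U * mat_adjoint U = 1\<^sub>m d" "mat_adjoint U * U = 1\<^sub>m d"
    "\<omega> = U * mat_diag d (\<lambda>i. complex_of_real (e i)) * mat_adjoint U"
  using assms spectral_decompD[of \<omega> U e d] by (auto simp: density_decomp_def)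

lemma spectral_trace:
  assumes "A \<in> carrier_mat d d" "spectral_decomp A U e"
  shows "mat_trace A = complex_of_real (\<Sum>i<d. e i)"
proof -
  note U = spectral_decompD[OF assms(2,1)]
  let ?D = "mat_diag d (\<lambda>i. complex_of_real (e i))"
  have "mat_trace A = mat_trace (U * (?D * mat_adjoint U))"
    by (subst U(4)) (use U(1) in \<open>simp add: assoc_mult_mat[of _ d d _ d _ d]\<close>)
  also have "\<dots> = mat_trace (?D * mat_adjoint U * U)"
    using U(1) by (intro trace_comm[of _ d d] mult_carrier_mat[of _ d d _ d]) auto
  also have "?D * mat_adjoint U * U = ?D"
    using U by (simp add: assoc_mult_mat[of _ d d _ d _ d] right_mult_one_mat[of _ d d])
  also have "mat_trace ?D = complex_of_real (\<Sum>i<d. e i)"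
    by (simp add: mat_trace_def mat_diag_def)
  finally show ?thesis .
qed

lemma density_op_decomp:
  assumes "density_op d \<omega>"
  shows "\<exists>U e. density_decomp d \<omega> U e"
proof -
  have psd: "psd d \<omega>" and tr: "mat_trace \<omega> = 1" and \<omega>: "\<omega> \<in> carrier_mat d d"
    using assms by (auto simp: density_op_def psd_def)
  obtain U e where dec: "spectral_decomp \<omega> U e"
    using hermitian_spectral[OF \<omega> psd_hermitian[OF psd]] by blast
  note U = spectral_decompD[OF dec \<omega>]
  let ?D = "\<lambda>e. mat_diag d (\<lambda>i. complex_of_real (e i))"
  \<comment> \<open>The eigenvalue is the quadratic form of \<omega> at the corresponding column of
    \<open>U\<close>.\<close>
  have nonneg: "0 \<le> e k" if k: "k < d" for k
  proof -
    let ?v = "col U k"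
    have v: "?v \<in> carrier_vec d" using U(1) k by auto
    have "mat_adjoint U * \<omega> * U = mat_adjoint U * (U * (?D e * mat_adjoint U)) * U"
      using U(1) U(4) by (simp add: assoc_mult_mat[of _ d d _ d _ d])
    also have "mat_adjoint U * (U * (?D e * mat_adjoint U)) = ?D e * mat_adjoint U"
      using U by (subst assoc_mult_mat[symmetric, of _ d d _ d _ d])
        (auto simp: mult_carrier_mat[of _ d d _ d] left_mult_one_mat[of _ d d])
    also have "?D e * mat_adjoint U * U = ?D e"
      using U by (simp add: assoc_mult_mat[of _ d d _ d _ d] right_mult_one_mat[of _ d d])
    finally have "complex_of_real (e k) = (mat_adjoint U * \<omega> * U) $$ (k, k)"
      using k by (simp add: mat_diag_def)
    also have "\<dots> = (\<Sum>i<d. \<Sum>j<d. \<omega> $$ (i, j) * U $$ (j, k) * cnj (U $$ (i, k)))"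
      using U(1) \<omega> k by (simp add: mult_mat_entry[of _ d d _ d] sum_distrib_left sum_distrib_right
          mult_carrier_mat[of _ d d _ d] ac_simps del: index_mult_mat)
    also have "\<dots> = (\<omega> *\<^sub>v ?v) \<bullet>c ?v"
      using U(1) k by (subst quadratic_form[OF \<omega> v]) simp
    finally have "complex_of_real (e k) = (\<omega> *\<^sub>v ?v) \<bullet>c ?v" .
    moreover have "0 \<le> (\<omega> *\<^sub>v ?v) \<bullet>c ?v" using psd v by (simp add: psd_def)
    ultimately have "0 \<le> complex_of_real (e k)" by (simp only:)
    then show ?thesis by (simp add: less_eq_complex_def)
  qed
  let ?e = "\<lambda>i. if i < d then e i else 0"
  have "?D e = ?D ?e" by (rule mat_diag_cong) simp
  then have "spectral_decomp \<omega> U ?e"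
    using U \<omega> by (intro spectral_decompI[of _ d]) auto
  moreover have "(\<Sum>i<d. ?e i) = 1"
  proof -
    have "complex_of_real (\<Sum>i<d. e i) = 1"
      using spectral_trace[OF \<omega> dec] tr by (simp only:)
    then have "(\<Sum>i<d. e i) = 1" using of_real_eq_1_iff by blast
    then show ?thesis by simp
  qed
  ultimately show ?thesis
    using nonneg \<omega> unfolding density_decomp_def by (intro exI[of _ U] exI[of _ ?e]) auto
qed

text \<open>A square matrix \<open>R\<close> for which \<open>R * mat_adjoint R\<close> is the
  state; its column index acts as a purifying system. Without a final factor
  \<open>mat_adjoint U\<close> it stays of the form unitary times diagonal, on which spectral
  projectors act by deleting diagonal entries.\<close>

definition sqrt_factor :: "nat \<Rightarrow> complex mat \<Rightarrow> (nat \<Rightarrow> real) \<Rightarrow> complex mat" where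
  "sqrt_factor d U e = U * mat_diag d (\<lambda>i. complex_of_real (sqrt (e i)))"

lemma sqrt_factor_carrier: "U \<in> carrier_mat d d \<Longrightarrow> sqrt_factor d U e \<in> carrier_mat d d"
  by (simp add: sqrt_factor_def mult_carrier_mat[of _ d d _ d])

lemma sqrt_factor_gram:
  assumes "density_decomp d \<omega> U e"
  shows "sqrt_factor d U e * mat_adjoint (sqrt_factor d U e) = \<omega>"
proof -
  note D = density_decompD[OF assms]
  let ?S = "mat_diag d (\<lambda>i. complex_of_real (sqrt (e i)))"
  have sq: "complex_of_real (sqrt (e i)) * complex_of_real (sqrt (e i)) = complex_of_real (e i)" for i
    using D(3)[of i] by (simp flip: of_real_mult)
  have "U * ?S * mat_adjoint (U * ?S) = U * (?S * ?S) * mat_adjoint U"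
    using D(5) by (simp add: adjoint_mult[of _ d d _ d] adjoint_diag assoc_mult_mat[of _ d d _ d _ d]
        mult_carrier_mat[of _ d d _ d] del: mat_diag_diag)
  then show ?thesis by (simp add: sqrt_factor_def sq flip: D(8))
qed

text \<open>Tensor factors are encoded in one index as quotient and remainder; this is the change of
  variables behind the computations with \<open>kron\<close>, partial traces and blocks.\<close>

lemma sum_div_mod:
  fixes f :: "nat \<Rightarrow> nat \<Rightarrow> 'a::comm_monoid_add"
  shows "(\<Sum>l<m * n. f (l div n) (l mod n)) = (\<Sum>i<m. \<Sum>j<n. f i j)"
proof (cases "n = 0")
  case False
  have blk: "(\<Sum>l\<in>{i * n..<i * n + n}. f (l div n) (l mod n)) = (\<Sum>j<n. f i j)" for i
  proof -
    have "(\<Sum>l\<in>{i * n..<i * n + n}. f (l div n) (l mod n)) = (\<Sum>j\<in>{0..<n}. f ((j + i * n) div n) ((j + i * n) mod n))"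
      using sum.shift_bounds_nat_ivl[of "\<lambda>l. f (l div n) (l mod n)" 0 "i * n" n] by (simp only: add_0 add.commute)
    also have "\<dots> = (\<Sum>j<n. f i j)"
      by (rule sum.cong) (auto simp: atLeast0LessThan)
    finally show ?thesis .
  qed
  have "(\<Sum>l<m * n. f (l div n) (l mod n)) = (\<Sum>i<m. \<Sum>l\<in>{i * n..<i * n + n}. f (l div n) (l mod n))"
    by (rule sum.nat_group[symmetric])
  also have "\<dots> = (\<Sum>i<m. \<Sum>j<n. f i j)" by (simp only: blk)
  finally show ?thesis .
qed simp

section \<open>Kronecker products and product states\<close>

lemma kron_carrier:
  "A \<in> carrier_mat a b \<Longrightarrow> B \<in> carrier_mat c d \<Longrightarrow> kron A B \<in> carrier_mat (a * c) (b * d)"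
  by (auto simp: kron_def)

lemma kron_entry:
  assumes "A \<in> carrier_mat a b" "B \<in> carrier_mat c d" "i < a * c" "j < b * d"
  shows "kron A B $$ (i, j) = A $$ (i div c, j div d) * B $$ (i mod c, j mod d)"
  using assms by (auto simp: kron_def)

lemma div_mod_bounds:
  assumes "i < a * (c :: nat)"
  shows "i div c < a" "i mod c < c"
  using assms by (simp_all add: less_mult_imp_div_less mult_0_right)
    (metis mod_less_divisor mult_0_right not_gr_zero not_less_zero)

lemma kron_mult:
  assumes A: "A \<in> carrier_mat a b" and B: "B \<in> carrier_mat c d"
    and C: "C \<in> carrier_mat b k" and D: "D \<in> carrier_mat d l"
  shows "kron A B * kron C D = kron (A * C) (B * D)"
proof (rule eq_matI)
  have AC: "A * C \<in> carrier_mat a k" and BD: "B * D \<in> carrier_mat c l" using assms by auto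
  fix i j assume "i < dim_row (kron (A * C) (B * D))" "j < dim_col (kron (A * C) (B * D))"
  then have ij: "i < a * c" "j < k * l" using kron_carrier[OF AC BD] by auto
  note b = div_mod_bounds[OF ij(1)] div_mod_bounds[OF ij(2)]
  have "(kron A B * kron C D) $$ (i, j) = (\<Sum>q<b * d. kron A B $$ (i, q) * kron C D $$ (q, j))"
    using mult_mat_entry[OF kron_carrier[OF A B] kron_carrier[OF C D] ij] .
  also have "\<dots> = (\<Sum>q<b * d. (A $$ (i div c, q div d) * C $$ (q div d, j div l)) *
      (B $$ (i mod c, q mod d) * D $$ (q mod d, j mod l)))"
    using ij by (intro sum.cong refl) (simp add: kron_entry[OF A B] kron_entry[OF C D])
  also have "\<dots> = (\<Sum>r<b. \<Sum>s<d. (A $$ (i div c, r) * C $$ (r, j div l)) * (B $$ (i mod c, s) * D $$ (s, j mod l)))"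
    by (rule sum_div_mod)
  also have "\<dots> = (A * C) $$ (i div c, j div l) * (B * D) $$ (i mod c, j mod l)"
    using assms b by (simp add: mult_mat_entry[OF A C] mult_mat_entry[OF B D] sum_product del: index_mult_mat)
  finally show "(kron A B * kron C D) $$ (i, j) = kron (A * C) (B * D) $$ (i, j)"
    by (simp only: kron_entry[OF AC BD ij])
qed (use assms in \<open>auto simp: kron_def\<close>)

lemma kron_adjoint:
  shows "mat_adjoint (kron A B) = kron (mat_adjoint A) (mat_adjoint B)"
proof (rule eq_matI)
  fix i j assume "i < dim_row (kron (mat_adjoint A) (mat_adjoint B))"
    "j < dim_col (kron (mat_adjoint A) (mat_adjoint B))"
  then have ij: "i < dim_col A * dim_col B" "j < dim_row A * dim_row B"
    by (auto simp: kron_def)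
  then show "mat_adjoint (kron A B) $$ (i, j) = kron (mat_adjoint A) (mat_adjoint B) $$ (i, j)"
    using div_mod_bounds[OF ij(1)] div_mod_bounds[OF ij(2)] by (simp add: kron_def)
qed (auto simp: kron_def)

lemma kron_diag:
  "kron (mat_diag m f) (mat_diag n g) = mat_diag (m * n) (\<lambda>i. f (i div n) * g (i mod n))"
proof (rule eq_matI)
  fix i j assume "i < dim_row (mat_diag (m * n) (\<lambda>i. f (i div n) * g (i mod n)))"
    "j < dim_col (mat_diag (m * n) (\<lambda>i. f (i div n) * g (i mod n)))"
  then have ij: "i < m * n" "j < m * n" by (auto simp: mat_diag_def)
  have "i = j" if "i div n = j div n" "i mod n = j mod n"
    by (metis that mult_div_mod_eq)
  then show "kron (mat_diag m f) (mat_diag n g) $$ (i, j) = mat_diag (m * n) (\<lambda>i. f (i div n) * g (i mod n)) $$ (i, j)"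
    using ij div_mod_bounds[OF ij(1)] div_mod_bounds[OF ij(2)]
    by (auto simp: kron_def mat_diag_def)
qed (auto simp: kron_def mat_diag_def)

lemma product_state_Nil [simp]: "product_state \<omega> [] = 1\<^sub>m 1"
  by (simp add: product_state_def)

lemma product_state_Cons [simp]: "product_state \<omega> (x # xs) = kron (\<omega> x) (product_state \<omega> xs)"
  by (simp add: product_state_def)

lemma product_state_carrier:
  assumes "\<And>x. \<omega> x \<in> carrier_mat d d"
  shows "product_state \<omega> xs \<in> carrier_mat (d ^ length xs) (d ^ length xs)"
  by (induction xs) (auto intro!: kron_carrier assms)

lemma product_state_mult:
  assumes "\<And>x. \<omega> x \<in> carrier_mat d d" "\<And>x. \<tau> x \<in> carrier_mat d d"
  shows "product_state (\<lambda>x. \<omega> x * \<tau> x) xs = product_state \<omega> xs * product_state \<tau> xs"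
  by (induction xs)
    (simp_all add: kron_mult[OF assms(1) product_state_carrier[OF assms(1)] assms(2) product_state_carrier[OF assms(2)]])

lemma product_state_adjoint:
  "product_state (\<lambda>x. mat_adjoint (\<omega> x)) xs = mat_adjoint (product_state \<omega> xs)"
  by (induction xs) (simp_all add: kron_adjoint)

lemma product_state_one: "product_state (\<lambda>x. 1\<^sub>m d) xs = 1\<^sub>m (d ^ length xs)"
  by (induction xs) (simp_all add: kron_diag flip: mat_diag_one)

text \<open>Eigenvalues of a product state: read in base \<open>d\<close>, most significant digit
  first, the index \<open>i\<close> selects one eigenvalue for each letter.\<close>

fun product_weight :: "nat \<Rightarrow> ('x \<Rightarrow> nat \<Rightarrow> real) \<Rightarrow> 'x list \<Rightarrow> nat \<Rightarrow> real" where
  "product_weight d e [] i = 1"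
| "product_weight d e (x # xs) i = e x (i div d ^ length xs) * product_weight d e xs (i mod d ^ length xs)"

lemma product_state_diag:
  "product_state (\<lambda>x. mat_diag d (\<lambda>i. complex_of_real (e x i))) xs
     = mat_diag (d ^ length xs) (\<lambda>i. complex_of_real (product_weight d e xs i))"
proof (induction xs)
  case Nil
  then show ?case by (simp flip: mat_diag_one)
next
  case (Cons x xs)
  then show ?case by (simp add: kron_diag)
qed

lemma product_weight_sum:
  assumes "\<And>x. (\<Sum>i<d. e x i) = 1"
  shows "(\<Sum>i<d ^ length xs. product_weight d e xs i) = 1"
proof (induction xs)
  case (Cons x xs)
  have "(\<Sum>i<d * d ^ length xs. e x (i div d ^ length xs) * product_weight d e xs (i mod d ^ length xs))
    = (\<Sum>i<d. \<Sum>j<d ^ length xs. e x i * product_weight d e xs j)"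
    by (rule sum_div_mod)
  then show ?case by (simp add: Cons assms flip: sum_distrib_left)
qed simp

lemma product_weight_nonneg:
  assumes "\<And>x i. 0 \<le> e x i"
  shows "0 \<le> product_weight d e xs i"
  by (induction xs arbitrary: i) (auto intro!: mult_nonneg_nonneg assms)

lemma product_state_decomp:
  assumes dec: "\<And>x. density_decomp d (\<omega> x) (U x) (e x)"
  shows "density_decomp (d ^ length xs) (product_state \<omega> xs) (product_state U xs) (product_weight d e xs)"
proof -
  note D = density_decompD[OF dec]
  let ?E = "\<lambda>x. mat_diag d (\<lambda>i. complex_of_real (e x i))"
  have [simp]: "mat_adjoint (U x) \<in> carrier_mat d d" "U x * ?E x \<in> carrier_mat d d" for x
    using D(5)[of x] by (auto intro: mult_carrier_mat[of _ d d _ d])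
  have "product_state \<omega> xs = product_state (\<lambda>x. U x * ?E x * mat_adjoint (U x)) xs"
    by (simp flip: D(8))
  also have "\<dots> = product_state (\<lambda>x. U x * ?E x) xs * product_state (\<lambda>x. mat_adjoint (U x)) xs"
    by (rule product_state_mult[of _ d]) (simp_all add: D(5))
  also have "product_state (\<lambda>x. U x * ?E x) xs = product_state U xs * product_state ?E xs"
    by (rule product_state_mult[OF D(5) mat_diag_dim])
  also have "product_state ?E xs = mat_diag (d ^ length xs) (\<lambda>i. complex_of_real (product_weight d e xs i))"
    by (rule product_state_diag)
  finally have eq: "product_state \<omega> xs = product_state U xs *
      mat_diag (d ^ length xs) (\<lambda>i. complex_of_real (product_weight d e xs i)) * mat_adjoint (product_state U xs)"
    by (simp only: product_state_adjoint)
  have "mat_adjoint (product_state U xs) * product_state U xs = product_state (\<lambda>x. mat_adjoint (U x) * U x) xs"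
    unfolding product_state_adjoint[symmetric]
    by (rule product_state_mult[of _ d, symmetric]) (simp_all add: D(5))
  then have uni: "mat_adjoint (product_state U xs) * product_state U xs = 1\<^sub>m (d ^ length xs)"
    by (simp add: D product_state_one)
  have "spectral_decomp (product_state \<omega> xs) (product_state U xs) (product_weight d e xs)"
    by (rule spectral_decompI[OF product_state_carrier[OF D(1)] product_state_carrier[OF D(5)] uni eq])
  then show ?thesis
    using product_state_carrier[of \<omega> d xs] D
    by (auto simp: density_decomp_def product_weight_sum intro!: product_weight_nonneg)
qed

text \<open>The weights may be signed, so the same definition serves for mixtures and for the
  deviations in \<open>hash_state\<close>.\<close>

definition average :: "nat \<Rightarrow> ('i \<Rightarrow> real) \<Rightarrow> ('i \<Rightarrow> complex mat) \<Rightarrow> 'i set \<Rightarrow> complex mat" where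
  "average d p \<omega> S = mat_sum d (\<lambda>x. complex_of_real (p x) \<cdot>\<^sub>m \<omega> x) S"

lemma average_carrier [simp]: "average d p \<omega> S \<in> carrier_mat d d"
  by (simp add: average_def)

lemma average_entry:
  assumes "\<And>x. x \<in> S \<Longrightarrow> \<omega> x \<in> carrier_mat d d" "i < d" "j < d"
  shows "average d p \<omega> S $$ (i, j) = (\<Sum>x\<in>S. complex_of_real (p x) * \<omega> x $$ (i, j))"
proof -
  have [simp]: "dim_row (\<omega> x) = d" "dim_col (\<omega> x) = d" if "x \<in> S" for x
    using assms(1)[OF that] by auto
  show ?thesis using assms by (auto simp: average_def)
qed

lemma lists_Suc: "{xs. length xs = Suc n} = (\<lambda>(x, xs). x # xs) ` (UNIV \<times> {xs. length xs = n})"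
  by (auto simp: image_iff length_Suc_conv)

lemma finite_lists_length_eq_UNIV [simp]: "finite {xs :: 'x::finite list. length xs = n}"
  using finite_lists_length_eq[of "UNIV :: 'x set" n] by simp

lemma sum_lists_Suc:
  fixes f :: "'x::finite list \<Rightarrow> 'b::comm_monoid_add"
  shows "(\<Sum>xs | length xs = Suc n. f xs) = (\<Sum>x\<in>UNIV. \<Sum>xs | length xs = n. f (x # xs))"
  unfolding lists_Suc sum.cartesian_product
  by (subst sum.reindex) (auto simp: inj_on_def intro!: sum.cong)

text \<open>The tensor product is multilinear, so the average over all sequences factorises letter
  by letter. Of \<open>ys\<close> only the length matters; later it is a list of units, which makes
  the averaged state a product state over a one-letter alphabet.\<close>

lemma average_product_state:
  fixes p :: "'x::finite \<Rightarrow> real" and \<omega> :: "'x \<Rightarrow> complex mat"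
  assumes \<omega>: "\<And>x. \<omega> x \<in> carrier_mat d d" and "length ys = n"
  shows "average (d ^ n) (\<lambda>xs. prod_list (map p xs)) (product_state \<omega>) {xs. length xs = n}
    = product_state (\<lambda>_. average d p \<omega> UNIV) ys"
  using assms(2)
proof (induction ys arbitrary: n)
  case Nil
  then have "n = 0" "{xs :: 'x list. length xs = n} = {[]}" by auto
  then show ?case by (intro eq_matI) (auto simp: average_def)
next
  case (Cons y ys n')
  then obtain n where n: "n' = Suc n" "length ys = n" by auto
  let ?P = "product_state (\<lambda>_. average d p \<omega> UNIV) ys"
  have carr: "product_state \<omega> xs \<in> carrier_mat (d ^ k) (d ^ k)" if "length xs = k" for xs k
    using product_state_carrier[of \<omega> d xs] \<omega> that by simp
  have Pc: "?P \<in> carrier_mat (d ^ n) (d ^ n)"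
    using product_state_carrier[of "\<lambda>_. average d p \<omega> UNIV" d ys] n by simp
  show ?case
  proof (rule eq_matI)
    fix i j assume "i < dim_row (product_state (\<lambda>_. average d p \<omega> UNIV) (y # ys))"
      "j < dim_col (product_state (\<lambda>_. average d p \<omega> UNIV) (y # ys))"
    then have ij: "i < d * d ^ n" "j < d * d ^ n"
      using carrier_matD[OF kron_carrier[OF average_carrier[of d p \<omega> UNIV] Pc]] by auto
    note b = div_mod_bounds[OF ij(1)] div_mod_bounds[OF ij(2)]
    have "average (d ^ n') (\<lambda>xs. prod_list (map p xs)) (product_state \<omega>) {xs. length xs = n'} $$ (i, j)
      = (\<Sum>xs | length xs = n'. complex_of_real (prod_list (map p xs)) * product_state \<omega> xs $$ (i, j))"
      by (rule average_entry) (use ij n(1) carr[of _ n'] in auto)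
    also have "\<dots> = (\<Sum>x\<in>UNIV. \<Sum>xs | length xs = n.
        (complex_of_real (p x) * \<omega> x $$ (i div d ^ n, j div d ^ n)) *
        (complex_of_real (prod_list (map p xs)) * product_state \<omega> xs $$ (i mod d ^ n, j mod d ^ n)))"
      unfolding n(1) sum_lists_Suc
      using ij carr by (intro sum.cong refl) (auto simp: kron_entry[OF \<omega> carr[OF refl]] ac_simps)
    also have "\<dots> = average d p \<omega> UNIV $$ (i div d ^ n, j div d ^ n) *
       average (d ^ n) (\<lambda>xs. prod_list (map p xs)) (product_state \<omega>) {xs. length xs = n} $$ (i mod d ^ n, j mod d ^ n)"
      unfolding sum_product[symmetric]
      using b by (intro arg_cong2[of _ _ _ _ "(*)"] average_entry[symmetric]) (auto simp: \<omega> carr)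
    also have "average (d ^ n) (\<lambda>xs. prod_list (map p xs)) (product_state \<omega>) {xs. length xs = n} = ?P"
      by (rule Cons.IH[OF n(2)])
    finally show "average (d ^ n') (\<lambda>xs. prod_list (map p xs)) (product_state \<omega>) {xs. length xs = n'} $$ (i, j)
      = product_state (\<lambda>_. average d p \<omega> UNIV) (y # ys) $$ (i, j)"
      using kron_entry[OF average_carrier[of d p \<omega> UNIV] Pc ij] by simp
  qed (use carrier_matD[OF kron_carrier[OF average_carrier[of d p \<omega> UNIV] Pc]] n in \<open>auto simp: average_def\<close>)
qed

lemma density_op_average:
  assumes "finite S" "\<And>x. x \<in> S \<Longrightarrow> density_op d (\<omega> x)" "\<And>x. x \<in> S \<Longrightarrow> 0 \<le> p x" "(\<Sum>x\<in>S. p x) = 1"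
  shows "density_op d (average d p \<omega> S)"
proof -
  have carr: "\<omega> x \<in> carrier_mat d d" if "x \<in> S" for x
    using assms(2)[OF that] by (simp add: density_op_def psd_def)
  have [simp]: "dim_row (\<omega> x) = d" if "x \<in> S" for x
    using carr[OF that] by auto
  have "psd d (complex_of_real (p x) \<cdot>\<^sub>m \<omega> x)" if x: "x \<in> S" for x
  proof -
    have "(complex_of_real (p x) \<cdot>\<^sub>m \<omega> x *\<^sub>v v) \<bullet>c v = complex_of_real (p x) * ((\<omega> x *\<^sub>v v) \<bullet>c v)"
      if "v \<in> carrier_vec d" for v
      using carr[OF x] that by (auto simp: quadratic_form[of _ d] sum_distrib_left ac_simps)
    then show ?thesis
      using assms(2)[OF x] assms(3)[OF x] by (auto simp: density_op_def psd_def less_eq_complex_def)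
  qed
  then have "psd d (average d p \<omega> S)" unfolding average_def by (rule psd_mat_sum)
  moreover have "mat_trace (average d p \<omega> S) = (\<Sum>x\<in>S. complex_of_real (p x) * mat_trace (\<omega> x))"
    using carr by (simp add: mat_trace_def average_entry carrier_matD[OF average_carrier] sum_distrib_left)
      (rule sum.swap)
  ultimately show ?thesis
    using assms by (simp add: density_op_def flip: of_real_sum)
qed

section \<open>Partial traces of density operators\<close>

lemma sum_if_const: "(\<Sum>x\<in>A. if Q then f x else 0) = (if Q then sum f A else 0)"
  by simp

text \<open>Positivity: the form of the partial trace at \<open>v\<close> is the sum over
  \<open>e\<close> of the forms of \<rho> at the vectors \<open>w e\<close>, which are
  \<open>v\<close> tensored with the basis vectors of E.\<close>

lemma density_op_trace_out_E:
  assumes "density_op (dB * dE) \<rho>"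
  shows "density_op dB (trace_out_E dB dE \<rho>)"
proof -
  have \<rho>: "\<rho> \<in> carrier_mat (dB * dE) (dB * dE)" using assms by (simp add: density_op_def psd_def)
  have "0 \<le> (trace_out_E dB dE \<rho> *\<^sub>v v) \<bullet>c v" if v: "v \<in> carrier_vec dB" for v
  proof -
    define w where "w e = vec (dB * dE) (\<lambda>i. if i mod dE = e then v $ (i div dE) else 0)" for e
    have w: "w e \<in> carrier_vec (dB * dE)" for e by (simp add: w_def)
    \<comment> \<open>Both indicator conditions are moved to the front, where
      \<open>sum_if_const\<close> can pull them out of the inner sums.\<close>
    have key: "x * (if P then y else 0) * cnj (if Q then z else 0) = (if Q then if P then x * y * cnj z else 0 else 0)"
      for x y z :: complex and P Q by simp
    have "(\<rho> *\<^sub>v w e) \<bullet>c w e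
        = (\<Sum>b<dB. \<Sum>b'<dB. \<rho> $$ (b * dE + e, b' * dE + e) * v $ b' * cnj (v $ b))" if e: "e < dE" for e
    proof -
      have "(\<rho> *\<^sub>v w e) \<bullet>c w e = (\<Sum>i<dB * dE. \<Sum>j<dB * dE. \<rho> $$ (i div dE * dE + i mod dE, j div dE * dE + j mod dE) *
          (if j mod dE = e then v $ (j div dE) else 0) * cnj (if i mod dE = e then v $ (i div dE) else 0))"
        unfolding quadratic_form[OF \<rho> w] by (intro sum.cong refl) (simp add: w_def)
      also have "\<dots> = (\<Sum>b<dB. \<Sum>a<dE. \<Sum>b'<dB. \<Sum>a'<dE. \<rho> $$ (b * dE + a, b' * dE + a') *
          (if a' = e then v $ b' else 0) * cnj (if a = e then v $ b else 0))"
        by (subst sum_div_mod[of "\<lambda>b a. \<Sum>j<dB * dE. \<rho> $$ (b * dE + a, j div dE * dE + j mod dE) *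
          (if j mod dE = e then v $ (j div dE) else 0) * cnj (if a = e then v $ b else 0)"])
          (intro sum.cong refl sum_div_mod)
      also have "\<dots> = (\<Sum>b<dB. \<Sum>a<dE. \<Sum>b'<dB. \<Sum>a'<dE. if a = e then
          if a' = e then \<rho> $$ (b * dE + a, b' * dE + a') * v $ b' * cnj (v $ b) else 0 else 0)"
        by (simp only: key)
      also have "\<dots> = (\<Sum>b<dB. \<Sum>a<dE. if a = e then (\<Sum>b'<dB. \<Sum>a'<dE.
          if a' = e then \<rho> $$ (b * dE + a, b' * dE + a') * v $ b' * cnj (v $ b) else 0) else 0)"
        by (simp only: sum_if_const)
      finally show ?thesis using e by simp
    qed
    then have "(\<Sum>e<dE. (\<rho> *\<^sub>v w e) \<bullet>c w e)
        = (\<Sum>e<dE. \<Sum>b<dB. \<Sum>b'<dB. \<rho> $$ (b * dE + e, b' * dE + e) * v $ b' * cnj (v $ b))"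
      by simp
    also have "\<dots> = (\<Sum>b<dB. \<Sum>e<dE. \<Sum>b'<dB. \<rho> $$ (b * dE + e, b' * dE + e) * v $ b' * cnj (v $ b))"
      by (rule sum.swap)
    also have "\<dots> = (\<Sum>b<dB. \<Sum>b'<dB. \<Sum>e<dE. \<rho> $$ (b * dE + e, b' * dE + e) * v $ b' * cnj (v $ b))"
      by (intro sum.cong refl sum.swap)
    also have "\<dots> = (trace_out_E dB dE \<rho> *\<^sub>v v) \<bullet>c v"
      using v by (subst quadratic_form[of _ dB]) (auto simp: trace_out_E_def sum_distrib_right)
    finally have "(trace_out_E dB dE \<rho> *\<^sub>v v) \<bullet>c v = (\<Sum>e<dE. (\<rho> *\<^sub>v w e) \<bullet>c w e)" by simp
    also have "0 \<le> \<dots>" using assms w by (intro sum_nonneg) (auto simp: density_op_def psd_def)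
    finally show ?thesis .
  qed
  moreover have "mat_trace (trace_out_E dB dE \<rho>) = mat_trace \<rho>"
    using \<rho> sum_div_mod[of "\<lambda>b e. \<rho> $$ (b * dE + e, b * dE + e)" dE dB]
    by (simp add: mat_trace_def trace_out_E_def)
  ultimately show ?thesis using assms by (simp add: density_op_def psd_def trace_out_E_def)
qed

text \<open>As for the other partial trace, with \<open>w b\<close> the basis vector
  \<open>b\<close> of B tensored with \<open>v\<close>.\<close>

lemma density_op_trace_out_B:
  assumes "density_op (dB * dE) \<rho>"
  shows "density_op dE (trace_out_B dB dE \<rho>)"
proof -
  have \<rho>: "\<rho> \<in> carrier_mat (dB * dE) (dB * dE)" using assms by (simp add: density_op_def psd_def)
  have "0 \<le> (trace_out_B dB dE \<rho> *\<^sub>v v) \<bullet>c v" if v: "v \<in> carrier_vec dE" for v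
  proof -
    define w where "w b = vec (dB * dE) (\<lambda>i. if i div dE = b then v $ (i mod dE) else 0)" for b
    have w: "w b \<in> carrier_vec (dB * dE)" for b by (simp add: w_def)
    have key: "x * (if P then y else 0) * cnj (if Q then z else 0) = (if Q then if P then x * y * cnj z else 0 else 0)"
      for x y z :: complex and P Q by simp
    have "(\<rho> *\<^sub>v w b) \<bullet>c w b
        = (\<Sum>e<dE. \<Sum>e'<dE. \<rho> $$ (b * dE + e, b * dE + e') * v $ e' * cnj (v $ e))" if b: "b < dB" for b
    proof -
      have "(\<rho> *\<^sub>v w b) \<bullet>c w b = (\<Sum>i<dB * dE. \<Sum>j<dB * dE. \<rho> $$ (i div dE * dE + i mod dE, j div dE * dE + j mod dE) *
          (if j div dE = b then v $ (j mod dE) else 0) * cnj (if i div dE = b then v $ (i mod dE) else 0))"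
        unfolding quadratic_form[OF \<rho> w] by (intro sum.cong refl) (simp add: w_def)
      also have "\<dots> = (\<Sum>c<dB. \<Sum>a<dE. \<Sum>c'<dB. \<Sum>a'<dE. \<rho> $$ (c * dE + a, c' * dE + a') *
          (if c' = b then v $ a' else 0) * cnj (if c = b then v $ a else 0))"
        by (subst sum_div_mod[of "\<lambda>c a. \<Sum>j<dB * dE. \<rho> $$ (c * dE + a, j div dE * dE + j mod dE) *
          (if j div dE = b then v $ (j mod dE) else 0) * cnj (if c = b then v $ a else 0)"])
          (intro sum.cong refl sum_div_mod)
      also have "\<dots> = (\<Sum>c<dB. \<Sum>a<dE. \<Sum>c'<dB. \<Sum>a'<dE. if c = b then
          if c' = b then \<rho> $$ (c * dE + a, c' * dE + a') * v $ a' * cnj (v $ a) else 0 else 0)"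
        by (simp only: key)
      also have "\<dots> = (\<Sum>c<dB. if c = b then (\<Sum>a<dE. \<Sum>c'<dB. if c' = b then
          (\<Sum>a'<dE. \<rho> $$ (c * dE + a, c' * dE + a') * v $ a' * cnj (v $ a)) else 0) else 0)"
        by (simp only: sum_if_const)
      finally show ?thesis using b by simp
    qed
    then have "(\<Sum>b<dB. (\<rho> *\<^sub>v w b) \<bullet>c w b)
        = (\<Sum>b<dB. \<Sum>e<dE. \<Sum>e'<dE. \<rho> $$ (b * dE + e, b * dE + e') * v $ e' * cnj (v $ e))"
      by simp
    also have "\<dots> = (\<Sum>e<dE. \<Sum>b<dB. \<Sum>e'<dE. \<rho> $$ (b * dE + e, b * dE + e') * v $ e' * cnj (v $ e))"
      by (rule sum.swap)
    also have "\<dots> = (\<Sum>e<dE. \<Sum>e'<dE. \<Sum>b<dB. \<rho> $$ (b * dE + e, b * dE + e') * v $ e' * cnj (v $ e))"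
      by (intro sum.cong refl sum.swap)
    also have "\<dots> = (trace_out_B dB dE \<rho> *\<^sub>v v) \<bullet>c v"
      using v by (subst quadratic_form[of _ dE]) (auto simp: trace_out_B_def sum_distrib_right)
    finally have "(trace_out_B dB dE \<rho> *\<^sub>v v) \<bullet>c v = (\<Sum>b<dB. (\<rho> *\<^sub>v w b) \<bullet>c w b)" by simp
    also have "0 \<le> \<dots>" using assms w by (intro sum_nonneg) (auto simp: density_op_def psd_def)
    finally show ?thesis .
  qed
  moreover have "mat_trace (trace_out_B dB dE \<rho>) = mat_trace \<rho>"
    using \<rho> sum_div_mod[of "\<lambda>b e. \<rho> $$ (b * dE + e, b * dE + e)" dE dB]
    by (simp add: mat_trace_def trace_out_B_def) (subst sum.swap, simp)
  ultimately show ?thesis using assms by (simp add: density_op_def psd_def trace_out_B_def)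
qed

section \<open>Sequential decoding\<close>

lemma trace_psd_gram:
  assumes "psd d A" "R \<in> carrier_mat d k"
  shows "0 \<le> Re (mat_trace (A * (R * mat_adjoint R)))"
proof -
  have A: "A \<in> carrier_mat d d" using assms(1) by (simp add: psd_def)
  have RR: "R * mat_adjoint R \<in> carrier_mat d d" using assms(2) by simp
  have "mat_trace (A * (R * mat_adjoint R))
      = (\<Sum>i<d. \<Sum>j<d. \<Sum>l<k. A $$ (i, j) * R $$ (j, l) * cnj (R $$ (i, l)))"
    unfolding trace_mult[OF A RR] using assms(2)
    by (intro sum.cong refl) (simp add: mult_mat_entry[of _ d k _ d] sum_distrib_left mult.assoc del: index_mult_mat)
  also have "\<dots> = (\<Sum>i<d. \<Sum>l<k. \<Sum>j<d. A $$ (i, j) * R $$ (j, l) * cnj (R $$ (i, l)))"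
    by (intro sum.cong refl sum.swap)
  also have "\<dots> = (\<Sum>l<k. \<Sum>i<d. \<Sum>j<d. A $$ (i, j) * R $$ (j, l) * cnj (R $$ (i, l)))"
    by (rule sum.swap)
  also have "\<dots> = (\<Sum>l<k. (A *\<^sub>v col R l) \<bullet>c col R l)"
  proof (intro sum.cong refl)
    fix l assume "l \<in> {..<k}"
    then have l: "l < k" by simp
    have c: "col R l \<in> carrier_vec d" using assms(2) by auto
    show "(\<Sum>i<d. \<Sum>j<d. A $$ (i, j) * R $$ (j, l) * cnj (R $$ (i, l))) = (A *\<^sub>v col R l) \<bullet>c col R l"
      unfolding quadratic_form[OF A c] using assms(2) l by (intro sum.cong refl) simp
  qed
  also have "0 \<le> \<dots>"
    using assms by (intro sum_nonneg) (auto simp: psd_def)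
  finally show ?thesis by (simp add: less_eq_complex_def)
qed

text \<open>The Born rule in Frobenius form: an outcome with Kraus operator \<open>K\<close> on the
  state \<open>R * mat_adjoint R\<close> has a squared norm as its probability.\<close>

lemma trace_gram_gram:
  assumes K: "K \<in> carrier_mat d d" and R: "R \<in> carrier_mat d k"
  shows "mat_trace (mat_adjoint K * K * (R * mat_adjoint R)) = complex_of_real ((frob (K * R))\<^sup>2)"
proof -
  have KR: "K * R \<in> carrier_mat d k" using assms by simp
  have RR: "R * mat_adjoint R \<in> carrier_mat d d" and Ka: "mat_adjoint K \<in> carrier_mat d d" using K R by auto
  have a: "mat_adjoint (K * R) = mat_adjoint R * mat_adjoint K" using K R by (rule adjoint_mult)
  have "complex_of_real ((frob (K * R))\<^sup>2) = mat_trace (K * R * mat_adjoint (K * R))"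
    by (rule trace_adjoint_self[OF KR, symmetric])
  also have "K * R * mat_adjoint (K * R) = K * (R * mat_adjoint R * mat_adjoint K)"
    unfolding a using K R
    by (simp add: assoc_mult_mat[of K d d R k "mat_adjoint R * mat_adjoint K" d]
        assoc_mult_mat[of R d k "mat_adjoint R" d "mat_adjoint K" d])
  also have "mat_trace \<dots> = mat_trace (R * mat_adjoint R * mat_adjoint K * K)"
    by (rule trace_comm[OF K mult_carrier_mat[OF RR Ka]])
  also have "R * mat_adjoint R * mat_adjoint K * K = R * mat_adjoint R * (mat_adjoint K * K)"
    by (rule assoc_mult_mat[OF RR Ka K])
  also have "mat_trace \<dots> = mat_trace (mat_adjoint K * K * (R * mat_adjoint R))"
    by (rule trace_comm[OF RR mult_carrier_mat[OF Ka K]])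
  finally show ?thesis by simp
qed

text \<open>The head of the list is the test performed first, hence the rightmost factor.\<close>

fun seq_prod :: "nat \<Rightarrow> complex mat list \<Rightarrow> complex mat" where
  "seq_prod d [] = 1\<^sub>m d"
| "seq_prod d (P # Ps) = seq_prod d Ps * P"

lemma seq_prod_carrier:
  "(\<And>P. P \<in> set Ps \<Longrightarrow> P \<in> carrier_mat d d) \<Longrightarrow> seq_prod d Ps \<in> carrier_mat d d"
  by (induction Ps) (auto intro: mult_carrier_mat)

text \<open>Cauchy-Schwarz for the vectors (a, sqrt A) and (b, sqrt B); it merges one more test into
  the bound of \<open>seq_prod_telescope\<close>.\<close>

lemma sqrt_cauchy:
  assumes "0 \<le> a" "0 \<le> b" "0 \<le> A" "0 \<le> B"
  shows "a * b + sqrt A * sqrt B \<le> sqrt (a\<^sup>2 + A) * sqrt (b\<^sup>2 + B)"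
proof -
  have "2 * (a * b) * (sqrt A * sqrt B) \<le> a\<^sup>2 * (sqrt B)\<^sup>2 + b\<^sup>2 * (sqrt A)\<^sup>2"
    using sum_squares_bound[of "a * sqrt B" "b * sqrt A"] by (simp add: power_mult_distrib ac_simps)
  then have "(a * b + sqrt A * sqrt B)\<^sup>2 \<le> (a\<^sup>2 + A) * (b\<^sup>2 + B)"
    using assms by (simp add: power2_sum power_mult_distrib algebra_simps)
  then show ?thesis by (simp add: real_le_rsqrt flip: real_sqrt_mult)
qed

text \<open>Passing the test \<open>P\<close> changes the inner product with \<phi> by that of the
  parts of \<psi> and \<phi> rejected by \<open>P\<close>. By Pythagoras the squared rejected parts
  of \<psi> add up to the squared norm lost along the way, so Cauchy-Schwarz over the tests leaves
  one square root for each family. \<phi> stays fixed while \<psi> moves through the tests, hence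
  two matrices in the induction.\<close>

lemma seq_prod_telescope:
  assumes P: "\<And>P. P \<in> set Ps \<Longrightarrow> projector d P"
    and \<phi>: "\<phi> \<in> carrier_mat d m" and \<psi>: "\<psi> \<in> carrier_mat d m"
  shows "frob (seq_prod d Ps * \<psi>) \<le> frob \<psi> \<and>
    cmod (frob_inner (\<psi> - seq_prod d Ps * \<psi>) \<phi>)
     \<le> sqrt (\<Sum>P\<leftarrow>Ps. (frob ((1\<^sub>m d - P) * \<phi>))\<^sup>2) * sqrt ((frob \<psi>)\<^sup>2 - (frob (seq_prod d Ps * \<psi>))\<^sup>2)"
  using P \<psi>
proof (induction Ps arbitrary: \<psi>)
  case Nil
  have "\<psi> - \<psi> = 0\<^sub>m d m" using Nil by auto
  then have "frob_inner (\<psi> - \<psi>) \<phi> = 0" using \<phi> by (simp add: frob_inner_eq[of _ d m])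
  then show ?case using Nil by simp
next
  case (Cons P Ps \<psi>)
  let ?S = "seq_prod d Ps"
  have PP: "projector d P" and PPs: "\<And>P. P \<in> set Ps \<Longrightarrow> projector d P" using Cons.prems by auto
  note \<psi> = Cons.prems(2)
  note Pc = projectorD(1)[OF PP]
  have S: "?S \<in> carrier_mat d d" using PPs projectorD(1) by (intro seq_prod_carrier) auto
  have P\<psi>: "P * \<psi> \<in> carrier_mat d m" using Pc \<psi> by simp
  have SP: "seq_prod d (P # Ps) * \<psi> = ?S * (P * \<psi>)"
    using S Pc \<psi> by (simp add: assoc_mult_mat[of _ d d _ d _ m])
  have S\<psi>: "?S * (P * \<psi>) \<in> carrier_mat d m" using S P\<psi> by simp
  let ?A = "\<Sum>P\<leftarrow>Ps. (frob ((1\<^sub>m d - P) * \<phi>))\<^sup>2"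
  have A: "0 \<le> ?A" by (intro sum_list_nonneg) auto
  from Cons.IH[OF PPs P\<psi>] have IH: "frob (?S * (P * \<psi>)) \<le> frob (P * \<psi>)"
    "cmod (frob_inner (P * \<psi> - ?S * (P * \<psi>)) \<phi>) \<le> sqrt ?A * sqrt ((frob (P * \<psi>))\<^sup>2 - (frob (?S * (P * \<psi>)))\<^sup>2)"
    by auto
  let ?B = "(frob (P * \<psi>))\<^sup>2 - (frob (?S * (P * \<psi>)))\<^sup>2"
  have B: "0 \<le> ?B" using IH(1) by (simp add: power_mono)
  let ?a = "frob ((1\<^sub>m d - P) * \<phi>)" and ?b = "frob ((1\<^sub>m d - P) * \<psi>)"
  have C: "projector d (1\<^sub>m d - P)" using PP by (rule projector_complement)
  have C\<phi>: "(1\<^sub>m d - P) * \<phi> \<in> carrier_mat d m" and C\<psi>: "(1\<^sub>m d - P) * \<psi> \<in> carrier_mat d m"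
    using projectorD(1)[OF C] \<phi> \<psi> by auto
  have "frob_inner (\<psi> - P * \<psi>) \<phi> = frob_inner ((1\<^sub>m d - P) * \<psi>) ((1\<^sub>m d - P) * \<phi>)"
  proof -
    have "frob_inner ((1\<^sub>m d - P) * \<psi>) \<phi> = frob_inner \<psi> (mat_adjoint (1\<^sub>m d - P) * \<phi>)"
      using projectorD(1)[OF C] \<phi> \<psi> by (intro frob_inner_mult_left)
    also have "\<dots> = frob_inner ((1\<^sub>m d - P) * \<psi>) ((1\<^sub>m d - P) * \<phi>)"
      unfolding projectorD(2)[OF C] by (rule projector_frob_inner[OF C \<psi> \<phi>])
    finally show ?thesis by (simp only: complement_mult[OF Pc \<psi>])
  qed
  then have first: "cmod (frob_inner (\<psi> - P * \<psi>) \<phi>) \<le> ?a * ?b"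
    using frob_cauchy[OF C\<psi> C\<phi>] by (simp add: mult.commute)
  have bsq: "?b\<^sup>2 + ?B = (frob \<psi>)\<^sup>2 - (frob (?S * (P * \<psi>)))\<^sup>2"
    using frob_pythagoras[OF PP \<psi>] by simp
  have "frob_inner (\<psi> - ?S * (P * \<psi>)) \<phi> = frob_inner (\<psi> - P * \<psi>) \<phi> + frob_inner (P * \<psi> - ?S * (P * \<psi>)) \<phi>"
    using \<phi> \<psi> P\<psi> S\<psi> by (simp add: frob_inner_diff_left)
  then have "cmod (frob_inner (\<psi> - ?S * (P * \<psi>)) \<phi>) \<le> ?a * ?b + sqrt ?A * sqrt ?B"
    using first IH(2) norm_triangle_ineq[of "frob_inner (\<psi> - P * \<psi>) \<phi>"] by (smt (verit))
  also have "\<dots> \<le> sqrt (?a\<^sup>2 + ?A) * sqrt (?b\<^sup>2 + ?B)"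
    using A B by (intro sqrt_cauchy) auto
  finally have "cmod (frob_inner (\<psi> - ?S * (P * \<psi>)) \<phi>)
      \<le> sqrt (?a\<^sup>2 + ?A) * sqrt ((frob \<psi>)\<^sup>2 - (frob (?S * (P * \<psi>)))\<^sup>2)"
    by (simp only: bsq)
  moreover have "frob (?S * (P * \<psi>)) \<le> frob \<psi>"
    using IH(1) frob_projector_le[OF PP \<psi>] by linarith
  ultimately show ?case unfolding SP by simp
qed

text \<open>With \<psi> = \<phi> the telescoped bound gives
  \<open>frob \<phi> - sqrt \<epsilon>\<close> as a lower bound for the norm after all tests, and
  squaring yields the claim. \<phi> may be subnormalised, since Bob's state is cut before it is
  tested.\<close>

lemma seq_prod_union_bound:
  assumes P: "\<And>P. P \<in> set Ps \<Longrightarrow> projector d P" and \<phi>: "\<phi> \<in> carrier_mat d m"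
    and "frob \<phi> \<le> 1" and \<epsilon>: "(\<Sum>P\<leftarrow>Ps. (frob ((1\<^sub>m d - P) * \<phi>))\<^sup>2) \<le> \<epsilon>"
  shows "(frob \<phi>)\<^sup>2 - 2 * sqrt \<epsilon> \<le> (frob (seq_prod d Ps * \<phi>))\<^sup>2"
proof -
  let ?S = "seq_prod d Ps * \<phi>"
  have S: "?S \<in> carrier_mat d m"
    using P projectorD(1) \<phi> by (intro mult_carrier_mat[of _ d d] seq_prod_carrier) auto
  note T = seq_prod_telescope[of Ps d \<phi> m \<phi>, OF P \<phi> \<phi>]
  let ?x = "frob \<phi>" and ?y = "frob ?S"
  have e0: "0 \<le> (\<Sum>P\<leftarrow>Ps. (frob ((1\<^sub>m d - P) * \<phi>))\<^sup>2)" by (intro sum_list_nonneg) auto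
  have "sqrt (?x\<^sup>2 - ?y\<^sup>2) \<le> sqrt (?x\<^sup>2)" by (intro real_sqrt_le_mono) simp
  then have sx: "sqrt (?x\<^sup>2 - ?y\<^sup>2) \<le> ?x" by simp
  have "complex_of_real (?x\<^sup>2) = frob_inner (\<phi> - ?S) \<phi> + frob_inner ?S \<phi>"
    using frob_inner_diff_left[OF \<phi> S \<phi>] frob_inner_self[OF \<phi>] by simp
  then have "?x\<^sup>2 \<le> cmod (frob_inner (\<phi> - ?S) \<phi>) + cmod (frob_inner ?S \<phi>)"
    by (metis norm_triangle_ineq norm_of_real abs_of_nonneg zero_le_power2)
  also have "\<dots> \<le> sqrt \<epsilon> * ?x + ?y * ?x"
  proof (rule add_mono)
    have "cmod (frob_inner (\<phi> - ?S) \<phi>)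
        \<le> sqrt (\<Sum>P\<leftarrow>Ps. (frob ((1\<^sub>m d - P) * \<phi>))\<^sup>2) * sqrt (?x\<^sup>2 - ?y\<^sup>2)"
      using T by simp
    also have "\<dots> \<le> sqrt \<epsilon> * ?x"
      using \<epsilon> e0 sx T by (intro mult_mono) (auto simp: power_mono)
    finally show "cmod (frob_inner (\<phi> - ?S) \<phi>) \<le> sqrt \<epsilon> * ?x" .
    show "cmod (frob_inner ?S \<phi>) \<le> ?y * ?x" by (rule frob_cauchy[OF S \<phi>])
  qed
  finally have "?x * ?x \<le> (sqrt \<epsilon> + ?y) * ?x" by (simp add: power2_eq_square algebra_simps)
  then have xy: "?x - sqrt \<epsilon> \<le> ?y"
    by (cases "?x = 0") (use frob_nonneg[of \<phi>] frob_nonneg[of ?S] \<epsilon> e0 in \<open>auto simp: mult_le_cancel_right intro: order_trans[of _ 0]\<close>)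
  have e: "0 \<le> sqrt \<epsilon>" using \<epsilon> e0 by simp
  have "2 * sqrt \<epsilon> * ?x \<le> 2 * sqrt \<epsilon>" using e assms(3) by (simp add: mult_left_le)
  moreover have "?x\<^sup>2 - 2 * sqrt \<epsilon> * ?x \<le> ?y\<^sup>2"
  \<comment> \<open>Squaring a lower bound needs it to be nonnegative; otherwise the left side is
    already nonpositive.\<close>
  proof (cases "sqrt \<epsilon> \<le> ?x")
    case True
    then have "(?x - sqrt \<epsilon>)\<^sup>2 \<le> ?y\<^sup>2" using xy by (intro power_mono) auto
    moreover have "(?x - sqrt \<epsilon>)\<^sup>2 = ?x\<^sup>2 - 2 * sqrt \<epsilon> * ?x + (sqrt \<epsilon>)\<^sup>2"
      by (simp add: power2_diff)
    ultimately show ?thesis by (smt (verit) zero_le_power2)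
  next
    case False
    then have "?x * ?x \<le> sqrt \<epsilon> * ?x" by (intro mult_right_mono) auto
    then have "?x\<^sup>2 - 2 * sqrt \<epsilon> * ?x \<le> - (sqrt \<epsilon> * ?x)" by (simp add: power2_eq_square mult.commute)
    also have "\<dots> \<le> 0" using e by simp
    also have "0 \<le> ?y\<^sup>2" by simp
    finally show ?thesis .
  qed
  ultimately show ?thesis by linarith
qed

text \<open>Bob tests the candidates in list order; \<open>y\<close> is accepted once all its predecessors are rejected.\<close>

fun accept_path :: "nat \<Rightarrow> ('a \<Rightarrow> complex mat) \<Rightarrow> 'a list \<Rightarrow> 'a \<Rightarrow> complex mat list" where
  "accept_path d Q [] y = []"
| "accept_path d Q (z # zs) y = (if y = z then [Q z] else (1\<^sub>m d - Q z) # accept_path d Q zs y)"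

lemma accept_path_projector:
  assumes "\<And>z. z \<in> set ys \<Longrightarrow> projector d (Q z)" "P \<in> set (accept_path d Q ys y)"
  shows "projector d P"
  using assms by (induction ys) (auto split: if_splits intro: projector_complement)

lemma complement_complement:
  fixes Q :: "complex mat"
  assumes "Q \<in> carrier_mat d d"
  shows "1\<^sub>m d - (1\<^sub>m d - Q) = Q"
  by (rule eq_matI) (use assms in auto)

text \<open>For a predecessor \<open>z\<close> of \<open>y\<close> the wanted outcome is rejection,
  so its failure amplitude is \<open>Q z * \<phi>\<close>; the path stops at \<open>y\<close>.
  Summing over all other candidates removes the dependence on the order of the list.\<close>

lemma accept_path_error:
  assumes "\<And>z. z \<in> set ys \<Longrightarrow> projector d (Q z)" "distinct ys" "y \<in> set ys"
  shows "(\<Sum>P\<leftarrow>accept_path d Q ys y. (frob ((1\<^sub>m d - P) * \<phi>))\<^sup>2)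
     \<le> (frob ((1\<^sub>m d - Q y) * \<phi>))\<^sup>2 + (\<Sum>z\<in>set ys - {y}. (frob (Q z * \<phi>))\<^sup>2)"
  using assms
proof (induction ys)
  case (Cons z zs)
  show ?case
  proof (cases "y = z")
    case True
    then show ?thesis by (simp add: sum_nonneg)
  next
    case False
    have "set (z # zs) - {y} = insert z (set zs - {y})" "z \<notin> set zs - {y}"
      using False Cons.prems by auto
    then have "(\<Sum>x\<in>set (z # zs) - {y}. (frob (Q x * \<phi>))\<^sup>2)
        = (frob (Q z * \<phi>))\<^sup>2 + (\<Sum>x\<in>set zs - {y}. (frob (Q x * \<phi>))\<^sup>2)"
      by simp
    moreover have "(\<Sum>P\<leftarrow>accept_path d Q zs y. (frob ((1\<^sub>m d - P) * \<phi>))\<^sup>2)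
     \<le> (frob ((1\<^sub>m d - Q y) * \<phi>))\<^sup>2 + (\<Sum>z\<in>set zs - {y}. (frob (Q z * \<phi>))\<^sup>2)"
      using Cons False by auto
    moreover have "1\<^sub>m d - (1\<^sub>m d - Q z) = Q z"
      using Cons.prems(1)[of z] by (intro complement_complement projectorD(1)) auto
    ultimately show ?thesis using False by simp
  qed
qed simp

section \<open>The sequential test as a complete measurement\<close>

lemma mat_sum_insert:
  assumes "finite S" "x \<notin> S" "F x \<in> carrier_mat d d"
  shows "mat_sum d F (insert x S) = F x + mat_sum d F S"
  by (rule eq_matI) (use assms in auto)

lemma mat_sum_cong: "(\<And>s. s \<in> S \<Longrightarrow> F s = G s) \<Longrightarrow> mat_sum d F S = mat_sum d G S"
  by (simp add: mat_sum_def)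

lemma mult_mat_sum:
  assumes "A \<in> carrier_mat d d" "B \<in> carrier_mat d d" "\<And>s. s \<in> S \<Longrightarrow> F s \<in> carrier_mat d d" "finite S"
  shows "A * mat_sum d F S * B = mat_sum d (\<lambda>s. A * F s * B) S"
  using assms(4,3)
proof (induction S rule: finite_induct)
  case empty
  have "mat_sum d F {} = 0\<^sub>m d d" "mat_sum d (\<lambda>s. A * F s * B) {} = 0\<^sub>m d d"
    by (auto intro!: eq_matI)
  then show ?case using assms(1,2) by (simp add: left_mult_zero_mat[of _ d d] right_mult_zero_mat[of _ d d])
next
  case (insert x S)
  have c: "F x \<in> carrier_mat d d" "A * F x * B \<in> carrier_mat d d" "A * F x \<in> carrier_mat d d"
    using assms insert.prems by (auto intro!: mult_carrier_mat[of _ d d _ d])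
  have "A * mat_sum d F (insert x S) * B = (A * F x + A * mat_sum d F S) * B"
    using insert c assms by (simp add: mat_sum_insert[where F = F] mult_add_distrib_mat[of _ d d _ d])
  also have "\<dots> = A * F x * B + A * mat_sum d F S * B"
    using assms c by (intro add_mult_distrib_mat[of _ d d _ _ d] mult_carrier_mat[of _ d d _ d]) auto
  also have "A * mat_sum d F S * B = mat_sum d (\<lambda>s. A * F s * B) S"
    using insert by auto
  also have "A * F x * B + mat_sum d (\<lambda>s. A * F s * B) S = mat_sum d (\<lambda>s. A * F s * B) (insert x S)"
    using insert c by (simp add: mat_sum_insert[where F = "\<lambda>s. A * F s * B"])
  finally show ?case .
qed

lemma gram_sandwich:
  fixes K P :: "complex mat"
  assumes "K \<in> carrier_mat d d" "P \<in> carrier_mat d d" "mat_adjoint P = P"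
  shows "mat_adjoint (K * P) * (K * P) = P * (mat_adjoint K * K) * P"
  using assms by (simp add: adjoint_mult[of _ d d _ d] assoc_mult_mat[of _ d d _ d _ d] mult_carrier_mat[of _ d d _ d])

text \<open>Peel off the first test, with P = 1 - Q z: all later outcomes, including rejection of
  every candidate, are sandwiched by P and by induction sum to P, and Q z + P = 1.\<close>

lemma accept_path_complete:
  assumes "\<And>z. z \<in> set ys \<Longrightarrow> projector d (Q z)" "distinct ys"
  defines "K \<equiv> \<lambda>ys y. seq_prod d (accept_path d Q ys y)"
    and "F \<equiv> \<lambda>ys. seq_prod d (map (\<lambda>z. 1\<^sub>m d - Q z) ys)"
  shows "mat_sum d (\<lambda>y. mat_adjoint (K ys y) * K ys y) (set ys) + mat_adjoint (F ys) * F ys = 1\<^sub>m d"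
  using assms(1,2)
proof (induction ys)
  case Nil
  have "mat_sum d (\<lambda>y. mat_adjoint (K [] y) * K [] y) {} = 0\<^sub>m d d" by (rule eq_matI) auto
  then show ?case by (simp add: F_def)
next
  case (Cons z zs)
  have pz: "projector d (Q z)" and pzs: "\<And>y. y \<in> set zs \<Longrightarrow> projector d (Q y)" using Cons.prems by auto
  let ?P = "1\<^sub>m d - Q z"
  note P = projectorD[OF projector_complement[OF pz]]
  note Qz = projectorD[OF pz]
  have Kc: "K zs y \<in> carrier_mat d d" for y
    unfolding K_def using accept_path_projector[of zs d Q] pzs projectorD(1)
    by (intro seq_prod_carrier) blast
  have Fc: "F zs \<in> carrier_mat d d"
    unfolding F_def using pzs projectorD(1) projector_complement by (intro seq_prod_carrier) auto
  let ?G = "mat_sum d (\<lambda>y. mat_adjoint (K zs y) * K zs y) (set zs)"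
  have KK: "mat_adjoint (K zs y) * K zs y \<in> carrier_mat d d" for y
    using Kc by (intro mult_carrier_mat[of _ d d _ d]) auto
  have FF: "mat_adjoint (F zs) * F zs \<in> carrier_mat d d"
    using Fc by (intro mult_carrier_mat[of _ d d _ d]) auto
  have "K (z # zs) z = Q z" using Qz by (simp add: K_def)
  then have Kz: "mat_adjoint (K (z # zs) z) * K (z # zs) z = Q z" by (simp add: Qz)
  have Ky: "mat_adjoint (K (z # zs) y) * K (z # zs) y = ?P * (mat_adjoint (K zs y) * K zs y) * ?P"
    if "y \<in> set zs" for y
  proof -
    have "K (z # zs) y = K zs y * ?P" using that Cons.prems by (auto simp: K_def)
    then show ?thesis using gram_sandwich[OF Kc P(1,2)] by simp
  qed
  have FP: "mat_adjoint (F (z # zs)) * F (z # zs) = ?P * (mat_adjoint (F zs) * F zs) * ?P"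
    using gram_sandwich[OF Fc P(1,2)] by (simp add: F_def)
  have Gc: "?P * ?G \<in> carrier_mat d d" "?P * (mat_adjoint (F zs) * F zs) \<in> carrier_mat d d"
    using P FF by (auto intro: mult_carrier_mat)
  have Gc': "?P * ?G * ?P \<in> carrier_mat d d" "?P * (mat_adjoint (F zs) * F zs) * ?P \<in> carrier_mat d d"
    by (rule mult_carrier_mat[OF Gc(1) P(1)], rule mult_carrier_mat[OF Gc(2) P(1)])
  have "mat_sum d (\<lambda>y. mat_adjoint (K (z # zs) y) * K (z # zs) y) (set (z # zs))
      = Q z + mat_sum d (\<lambda>y. mat_adjoint (K (z # zs) y) * K (z # zs) y) (set zs)"
    using Cons.prems Kz Qz by (simp add: mat_sum_insert[where F = "\<lambda>y. mat_adjoint (K (z # zs) y) * K (z # zs) y"])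
  also have "mat_sum d (\<lambda>y. mat_adjoint (K (z # zs) y) * K (z # zs) y) (set zs)
      = mat_sum d (\<lambda>y. ?P * (mat_adjoint (K zs y) * K zs y) * ?P) (set zs)"
    by (rule mat_sum_cong) (rule Ky)
  also have "\<dots> = ?P * ?G * ?P"
    by (rule mult_mat_sum[symmetric]) (use P KK in auto)
  finally have sum_eq: "mat_sum d (\<lambda>y. mat_adjoint (K (z # zs) y) * K (z # zs) y) (set (z # zs)) = Q z + ?P * ?G * ?P" .
  have "?P * ?G * ?P + ?P * (mat_adjoint (F zs) * F zs) * ?P
      = (?P * ?G + ?P * (mat_adjoint (F zs) * F zs)) * ?P"
    using P Gc by (intro add_mult_distrib_mat[symmetric, of _ d d _ _ d]) auto
  also have "?P * ?G + ?P * (mat_adjoint (F zs) * F zs) = ?P * (?G + mat_adjoint (F zs) * F zs)"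
    using P FF by (intro mult_add_distrib_mat[symmetric, of _ d d _ d]) auto
  also have "?G + mat_adjoint (F zs) * F zs = 1\<^sub>m d"
    using Cons.IH[OF pzs] Cons.prems by simp
  also have "?P * 1\<^sub>m d * ?P = ?P" by (simp only: right_mult_one_mat[OF P(1)] P(3))
  finally have rest: "?P * ?G * ?P + ?P * (mat_adjoint (F zs) * F zs) * ?P = ?P" .
  have "Q z + ?P * ?G * ?P + ?P * (mat_adjoint (F zs) * F zs) * ?P
      = Q z + (?P * ?G * ?P + ?P * (mat_adjoint (F zs) * F zs) * ?P)"
    using Qz Gc' by (intro assoc_add_mat[of _ d d]) auto
  also have "\<dots> = 1\<^sub>m d" unfolding rest by (rule eq_matI) (use Qz(1) in auto)
  finally show ?case unfolding sum_eq FP .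
qed

lemma add_psd:
  assumes "psd d A" "psd d B"
  shows "psd d (A + B)"
proof -
  have AB: "A \<in> carrier_mat d d" "B \<in> carrier_mat d d" using assms by (auto simp: psd_def)
  have "A + B = mat_sum d (\<lambda>b. if b then A else B) UNIV"
    by (rule eq_matI) (use AB in \<open>auto simp: UNIV_bool\<close>)
  then show ?thesis using psd_mat_sum[of UNIV d "\<lambda>b. if b then A else B"] assms by auto
qed

lemma psd_gram': "K \<in> carrier_mat d d \<Longrightarrow> psd d (mat_adjoint K * K)"
  using psd_gram[of "mat_adjoint K" d d] by simp

text \<open>The outcomes of the sequential test after the cut by \<Theta> are grouped by their key.
  The error is the loss in the cut, turned into a norm by Pythagoras, plus the union bound along the
  path to \<open>y\<close>.\<close>

lemma sequential_decoder:
  assumes \<Theta>: "projector d \<Theta>" and Q: "\<And>z. z \<in> Y \<Longrightarrow> projector d (Q z)"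
    and Y: "finite Y" and \<kappa>: "\<And>y. y \<in> Y \<Longrightarrow> \<kappa> y < M" and M: "0 < M"
  shows "\<exists>D. povm d M D \<and> (\<forall>y\<in>Y. \<forall>R\<in>carrier_mat d d. frob R = 1 \<longrightarrow>
     1 - (frob ((1\<^sub>m d - \<Theta>) * R))\<^sup>2
       - 2 * sqrt ((frob ((1\<^sub>m d - Q y) * (\<Theta> * R)))\<^sup>2 + (\<Sum>z\<in>Y - {y}. (frob (Q z * (\<Theta> * R)))\<^sup>2))
     \<le> Re (mat_trace (D (\<kappa> y) * (R * mat_adjoint R))))"
proof -
  obtain ys where ys: "set ys = Y" "distinct ys" using finite_distinct_list[OF Y] by blast
  define K where "K y = seq_prod d (accept_path d Q ys y)" for y
  define F where "F = seq_prod d (map (\<lambda>z. 1\<^sub>m d - Q z) ys)"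
  have path: "projector d P" if "P \<in> set (accept_path d Q ys y)" for P y
    using accept_path_projector[OF _ that] Q ys by auto
  have Kc: "K y \<in> carrier_mat d d" for y
    unfolding K_def using path projectorD(1) by (intro seq_prod_carrier) blast
  have Fc: "F \<in> carrier_mat d d"
    unfolding F_def using Q ys projectorD(1) projector_complement by (intro seq_prod_carrier) auto
  note P = projectorD[OF \<Theta>]
  have complete: "mat_sum d (\<lambda>y. mat_adjoint (K y) * K y) Y + mat_adjoint F * F = 1\<^sub>m d"
    using accept_path_complete[of ys d Q] Q ys unfolding K_def F_def by auto
  define E where "E y = mat_adjoint (K y * \<Theta>) * (K y * \<Theta>)" for y
  have KP: "K y * \<Theta> \<in> carrier_mat d d" for y using Kc P by (auto intro: mult_carrier_mat)
  have Ec: "E y \<in> carrier_mat d d" for y unfolding E_def by (rule mult_carrier_mat[OF _ KP]) (use KP[of y] in simp)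
  have Epsd: "psd d (E y)" for y unfolding E_def by (rule psd_gram'[OF KP])
  \<comment> \<open>What is missing to a complete measurement: all candidates rejected, or the state
    found outside \<Theta>. It is counted as key \<open>0\<close>.\<close>
  define G where "G = mat_adjoint (F * \<Theta>) * (F * \<Theta>) + mat_adjoint (1\<^sub>m d - \<Theta>) * (1\<^sub>m d - \<Theta>)"
  have FP: "F * \<Theta> \<in> carrier_mat d d" using Fc P by (auto intro: mult_carrier_mat)
  have Cc: "1\<^sub>m d - \<Theta> \<in> carrier_mat d d" using P(1) by (rule minus_carrier_mat)
  have Gpsd: "psd d G" unfolding G_def by (intro add_psd psd_gram' FP Cc)
  have Gc: "G \<in> carrier_mat d d" using Gpsd by (simp add: psd_def)
  have EG: "mat_sum d E Y + G = 1\<^sub>m d"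
  proof -
    let ?KK = "\<lambda>y. mat_adjoint (K y) * K y" and ?FF = "mat_adjoint F * F"
    have KK: "?KK y \<in> carrier_mat d d" for y using Kc by (intro mult_carrier_mat[of _ d d _ d]) auto
    have FF: "?FF \<in> carrier_mat d d" using Fc by (intro mult_carrier_mat[of _ d d _ d]) auto
    have c: "\<Theta> * mat_sum d ?KK Y \<in> carrier_mat d d" "\<Theta> * ?FF \<in> carrier_mat d d"
      using P FF by (auto intro: mult_carrier_mat)
    have c': "\<Theta> * mat_sum d ?KK Y * \<Theta> \<in> carrier_mat d d" "\<Theta> * ?FF * \<Theta> \<in> carrier_mat d d"
      by (rule mult_carrier_mat[OF c(1) P(1)], rule mult_carrier_mat[OF c(2) P(1)])
    have "mat_sum d E Y = mat_sum d (\<lambda>y. \<Theta> * ?KK y * \<Theta>) Y"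
      unfolding E_def by (rule mat_sum_cong) (rule gram_sandwich[OF Kc P(1,2)])
    also have "\<dots> = \<Theta> * mat_sum d ?KK Y * \<Theta>"
      by (rule mult_mat_sum[symmetric]) (use P KK Y in auto)
    finally have E: "mat_sum d E Y = \<Theta> * mat_sum d ?KK Y * \<Theta>" .
    have F: "mat_adjoint (F * \<Theta>) * (F * \<Theta>) = \<Theta> * ?FF * \<Theta>" by (rule gram_sandwich[OF Fc P(1,2)])
    have "\<Theta> * mat_sum d ?KK Y * \<Theta> + \<Theta> * ?FF * \<Theta> = (\<Theta> * mat_sum d ?KK Y + \<Theta> * ?FF) * \<Theta>"
      using P c by (intro add_mult_distrib_mat[symmetric, of _ d d _ _ d]) auto
    also have "\<Theta> * mat_sum d ?KK Y + \<Theta> * ?FF = \<Theta> * (mat_sum d ?KK Y + ?FF)"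
      using P FF by (intro mult_add_distrib_mat[symmetric, of _ d d _ d]) auto
    also have "\<Theta> * (mat_sum d ?KK Y + ?FF) * \<Theta> = \<Theta>" unfolding complete using P by simp
    finally have "\<Theta> * mat_sum d ?KK Y * \<Theta> + \<Theta> * ?FF * \<Theta> = \<Theta>" .
    moreover have "mat_sum d E Y + G = \<Theta> * mat_sum d ?KK Y * \<Theta> + \<Theta> * ?FF * \<Theta> + (1\<^sub>m d - \<Theta>)"
      unfolding G_def E F using c' Cc projectorD(2,3)[OF projector_complement[OF \<Theta>]]
      by (simp add: assoc_add_mat[of _ d d])
    ultimately show ?thesis by (intro eq_matI) (use P(1) in auto)
  qed
  define D where "D m = mat_sum d E {y \<in> Y. \<kappa> y = m} + (if m = 0 then G else 0\<^sub>m d d)" for m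
  have zero_psd: "psd d (0\<^sub>m d d)" by (auto simp: psd_def quadratic_form[of _ d])
  have Dpsd: "psd d (D m)" for m
    unfolding D_def using Gpsd zero_psd by (intro add_psd psd_mat_sum Epsd) auto
  have "mat_sum d D {..<M} = 1\<^sub>m d"
  proof (rule eq_matI)
    fix i j assume "i < dim_row (1\<^sub>m d)" "j < dim_col (1\<^sub>m d)"
    then have ij: "i < d" "j < d" by auto
    have Gij: "(if m = 0 then G else 0\<^sub>m d d) $$ (i, j) = (if m = 0 then G $$ (i, j) else 0)" for m :: nat
      using ij by simp
    have "mat_sum d D {..<M} $$ (i, j)
        = (\<Sum>m<M. (\<Sum>y | y \<in> Y \<and> \<kappa> y = m. E y $$ (i, j)) + (if m = 0 then G $$ (i, j) else 0))"
      using ij Gc by (auto simp: D_def Gij intro!: sum.cong)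
    also have "\<dots> = (\<Sum>m<M. \<Sum>y | y \<in> Y \<and> \<kappa> y = m. E y $$ (i, j)) + G $$ (i, j)"
      using M by (simp add: sum.distrib)
    also have "(\<Sum>m<M. \<Sum>y | y \<in> Y \<and> \<kappa> y = m. E y $$ (i, j)) = (\<Sum>y\<in>Y. E y $$ (i, j))"
      using Y \<kappa> by (intro sum.group) auto
    also have "(\<Sum>y\<in>Y. E y $$ (i, j)) + G $$ (i, j) = (mat_sum d E Y + G) $$ (i, j)"
      using ij Gc by simp
    finally show "mat_sum d D {..<M} $$ (i, j) = 1\<^sub>m d $$ (i, j)" by (simp only: EG)
  qed auto
  then have "povm d M D" using Dpsd by (simp add: povm_def)
  moreover have "1 - (frob ((1\<^sub>m d - \<Theta>) * R))\<^sup>2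
       - 2 * sqrt ((frob ((1\<^sub>m d - Q y) * (\<Theta> * R)))\<^sup>2 + (\<Sum>z\<in>Y - {y}. (frob (Q z * (\<Theta> * R)))\<^sup>2))
     \<le> Re (mat_trace (D (\<kappa> y) * (R * mat_adjoint R)))"
    if y: "y \<in> Y" and R: "R \<in> carrier_mat d d" and R1: "frob R = 1" for y R
  proof -
    let ?\<phi> = "\<Theta> * R"
    have \<phi>: "?\<phi> \<in> carrier_mat d d" using P R by (auto intro: mult_carrier_mat)
    have RR: "R * mat_adjoint R \<in> carrier_mat d d" using R by (auto intro: mult_carrier_mat)
    have "(frob ?\<phi>)\<^sup>2 - 2 * sqrt ((frob ((1\<^sub>m d - Q y) * ?\<phi>))\<^sup>2 + (\<Sum>z\<in>Y - {y}. (frob (Q z * ?\<phi>))\<^sup>2))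
        \<le> (frob (K y * ?\<phi>))\<^sup>2"
      unfolding K_def
    proof (rule seq_prod_union_bound[OF path \<phi>])
      show "frob ?\<phi> \<le> 1" using frob_projector_le[OF \<Theta> R] R1 by simp
      show "(\<Sum>P\<leftarrow>accept_path d Q ys y. (frob ((1\<^sub>m d - P) * ?\<phi>))\<^sup>2)
         \<le> (frob ((1\<^sub>m d - Q y) * ?\<phi>))\<^sup>2 + (\<Sum>z\<in>Y - {y}. (frob (Q z * ?\<phi>))\<^sup>2)"
        using accept_path_error[of ys d Q y ?\<phi>] ys Q y by auto
    qed
    also have "K y * ?\<phi> = K y * \<Theta> * R"
      using Kc P R by (intro assoc_mult_mat[symmetric, of _ d d _ d _ d]) auto
    also have "(frob (K y * \<Theta> * R))\<^sup>2 = Re (mat_trace (E y * (R * mat_adjoint R)))"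
      unfolding E_def trace_gram_gram[OF KP R] by (rule Re_complex_of_real[symmetric])
    also have "\<dots> \<le> Re (mat_trace (D (\<kappa> y) * (R * mat_adjoint R)))"
    proof -
      \<comment> \<open>\<open>D (\<kappa> y)\<close> exceeds \<open>E y\<close> by a positive
        matrix, so the right key is at least as likely as acceptance of \<open>y\<close>
        itself.\<close>
      let ?E' = "mat_sum d E ({y' \<in> Y. \<kappa> y' = \<kappa> y} - {y}) + (if \<kappa> y = 0 then G else 0\<^sub>m d d)"
      have E': "psd d ?E'" using Gpsd zero_psd by (intro add_psd psd_mat_sum Epsd) auto
      have E'c: "?E' \<in> carrier_mat d d" using E' by (simp add: psd_def)
      have "mat_sum d E {y' \<in> Y. \<kappa> y' = \<kappa> y} = E y + mat_sum d E ({y' \<in> Y. \<kappa> y' = \<kappa> y} - {y})"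
        using mat_sum_insert[of "{y' \<in> Y. \<kappa> y' = \<kappa> y} - {y}" y E d] y Y Ec
        by (simp add: insert_absorb)
      then have "D (\<kappa> y) = E y + ?E'"
        unfolding D_def using Ec Gc by (simp add: assoc_add_mat[of _ d d])
      then have "mat_trace (D (\<kappa> y) * (R * mat_adjoint R))
          = mat_trace (E y * (R * mat_adjoint R) + ?E' * (R * mat_adjoint R))"
        using Ec E'c RR by (simp only: add_mult_distrib_mat[of _ d d _ _ d])
      also have "\<dots> = mat_trace (E y * (R * mat_adjoint R)) + mat_trace (?E' * (R * mat_adjoint R))"
        by (rule trace_add[OF mult_carrier_mat[OF Ec RR] mult_carrier_mat[OF E'c RR]])
      finally show ?thesis using trace_psd_gram[OF E' R] by simp
    qed
    finally have "(frob ?\<phi>)\<^sup>2 - 2 * sqrt ((frob ((1\<^sub>m d - Q y) * ?\<phi>))\<^sup>2 + (\<Sum>z\<in>Y - {y}. (frob (Q z * ?\<phi>))\<^sup>2))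
      \<le> Re (mat_trace (D (\<kappa> y) * (R * mat_adjoint R)))" .
    then show ?thesis using frob_pythagoras[OF \<Theta> R] R1 by simp
  qed
  ultimately show ?thesis by blast
qed

section \<open>Random hash functions\<close>

text \<open>Expectation under a uniformly random function; extensionality makes the function space
  finite, of size \<open>N ^ card S\<close> for finite \<open>S\<close>.\<close>

definition hash_mean :: "'a set \<Rightarrow> nat \<Rightarrow> (('a \<Rightarrow> nat) \<Rightarrow> real) \<Rightarrow> real" where
  "hash_mean S N f = (\<Sum>h\<in>S \<rightarrow>\<^sub>E {..<N}. f h) / real N ^ card S"

text \<open>Independence of the values of a random function.\<close>

lemma hash_mean_prod:
  assumes "finite S"
  shows "hash_mean S N (\<lambda>h. \<Prod>x\<in>S. f x (h x)) = (\<Prod>x\<in>S. (\<Sum>j<N. f x j) / real N)"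
  using prod_sum_PiE[of S "\<lambda>_. {..<N}" f] assms
  by (simp add: hash_mean_def prod_dividef)

lemma hash_mean_const:
  assumes "finite S" "0 < N"
  shows "hash_mean S N (\<lambda>_. c) = c"
  using assms by (simp add: hash_mean_def card_PiE)

lemma hash_mean_single:
  assumes S: "finite S" "x \<in> S" and N: "0 < N"
  shows "hash_mean S N (\<lambda>h. g (h x)) = (\<Sum>j<N. g j) / real N"
proof -
  have "(\<Prod>z\<in>S. if z = x then g (h z) else 1) = g (h x)" for h
    using S by simp
  then have "hash_mean S N (\<lambda>h. g (h x)) = (\<Prod>z\<in>S. (\<Sum>j<N. if z = x then g j else 1) / real N)"
    using hash_mean_prod[OF S(1), of N "\<lambda>z j. if z = x then g j else 1"] by simp
  also have "\<dots> = (\<Prod>z\<in>S. if z = x then (\<Sum>j<N. g j) / real N else 1)"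
    using N by (intro prod.cong refl) auto
  finally show ?thesis using S by simp
qed

lemma hash_mean_pair:
  assumes S: "finite S" "x \<in> S" "y \<in> S" "x \<noteq> y" and N: "0 < N"
  shows "hash_mean S N (\<lambda>h. g (h x) * k (h y)) = (\<Sum>j<N. g j) / real N * ((\<Sum>j<N. k j) / real N)"
proof -
  let ?f = "\<lambda>z j. (if z = x then g j else 1) * (if z = y then k j else 1)"
  have "(\<Prod>z\<in>S. ?f z (h z)) = g (h x) * k (h y)" for h
    using S by (simp add: prod.distrib)
  then have "hash_mean S N (\<lambda>h. g (h x) * k (h y)) = (\<Prod>z\<in>S. (\<Sum>j<N. ?f z j) / real N)"
    using hash_mean_prod[OF S(1), of N ?f] by simp
  also have "\<dots> = (\<Prod>z\<in>S. (if z = x then (\<Sum>j<N. g j) / real N else 1) * (if z = y then (\<Sum>j<N. k j) / real N else 1))"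
    using N S by (intro prod.cong refl) auto
  finally show ?thesis using S by (simp add: prod.distrib)
qed

lemma hash_mean_add: "hash_mean S N (\<lambda>h. f h + g h) = hash_mean S N f + hash_mean S N g"
  by (simp add: hash_mean_def sum.distrib add_divide_distrib)

lemma hash_mean_sum: "hash_mean S N (\<lambda>h. \<Sum>i\<in>I. f i h) = (\<Sum>i\<in>I. hash_mean S N (f i))"
  unfolding hash_mean_def by (subst sum.swap) (simp add: sum_divide_distrib)

lemma hash_mean_cmult: "hash_mean S N (\<lambda>h. c * f h) = c * hash_mean S N f"
  by (simp add: hash_mean_def sum_distrib_left)

lemma hash_mean_witness:
  assumes "finite S" "0 < N"
  shows "\<exists>h \<in> S \<rightarrow>\<^sub>E {..<N}. f h \<le> hash_mean S N f"
proof (rule ccontr)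
  assume "\<not> ?thesis"
  then have gt: "\<And>h. h \<in> S \<rightarrow>\<^sub>E {..<N} \<Longrightarrow> hash_mean S N f < f h" by force
  have ne: "S \<rightarrow>\<^sub>E {..<N} \<noteq> {}" using assms by (auto simp: PiE_eq_empty_iff)
  define c where "c = hash_mean S N f"
  have "(\<Sum>h\<in>S \<rightarrow>\<^sub>E {..<N}. c) < (\<Sum>h\<in>S \<rightarrow>\<^sub>E {..<N}. f h)"
    using gt ne assms unfolding c_def[symmetric] by (intro sum_strict_mono finite_PiE) auto
  then have "hash_mean S N (\<lambda>_. c) < hash_mean S N f"
    unfolding hash_mean_def using assms by (intro divide_strict_right_mono) auto
  then have "c < c" using assms by (simp only: hash_mean_const) (simp add: c_def)
  then show False by simp
qed

text \<open>Jensen's inequality for the square root, as Cauchy-Schwarz for sqrt w and sqrt (w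
  a).\<close>

lemma weighted_sqrt_le:
  assumes "finite I" "\<And>i. i \<in> I \<Longrightarrow> 0 \<le> w i" "(\<Sum>i\<in>I. w i) = 1" "\<And>i. i \<in> I \<Longrightarrow> 0 \<le> a i"
  shows "(\<Sum>i\<in>I. w i * sqrt (a i)) \<le> sqrt (\<Sum>i\<in>I. w i * a i)"
proof -
  have "(\<Sum>i\<in>I. w i * sqrt (a i)) = (\<Sum>i\<in>I. \<bar>sqrt (w i)\<bar> * \<bar>sqrt (w i * a i)\<bar>)"
    using assms by (intro sum.cong refl) (auto simp: real_sqrt_mult)
  also have "\<dots> \<le> L2_set (\<lambda>i. sqrt (w i)) I * L2_set (\<lambda>i. sqrt (w i * a i)) I"
    by (rule L2_set_mult_ineq)
  also have "\<dots> = sqrt (\<Sum>i\<in>I. w i) * sqrt (\<Sum>i\<in>I. w i * a i)"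
    using assms by (simp add: L2_set_def)
  finally show ?thesis using assms by simp
qed

lemma hash_mean_sqrt_le:
  assumes "finite S" "0 < N" "\<And>h. 0 \<le> f h"
  shows "hash_mean S N (\<lambda>h. sqrt (f h)) \<le> sqrt (hash_mean S N f)"
  using weighted_sqrt_le[of "S \<rightarrow>\<^sub>E {..<N}" "\<lambda>_. 1 / real N ^ card S" f] assms
  by (simp add: hash_mean_def finite_PiE card_PiE sum_divide_distrib)

text \<open>The coefficients \<open>of_bool (h x = j) - 1 / N\<close> have mean zero and are
  independent for distinct \<open>x\<close>, so the cross terms vanish on average, and a single
  coefficient has variance at most \<open>1 / N\<close>.\<close>

lemma hash_mean_variance:
  fixes z :: "'a \<Rightarrow> complex"
  assumes S: "finite S" and j: "j < N"
  shows "hash_mean S N (\<lambda>h. (cmod (\<Sum>x\<in>S. complex_of_real (of_bool (h x = j) - 1 / N) * z x))\<^sup>2)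
    \<le> (\<Sum>x\<in>S. (cmod (z x))\<^sup>2) / N"
proof -
  have N: "0 < N" using j by simp
  let ?c = "\<lambda>k. of_bool (k = j) - 1 / real N"
  have c0: "(\<Sum>k<N. ?c k) = 0" using j by (simp add: sum_subtractf of_bool_def)
  have c1: "(\<Sum>k<N. (?c k)\<^sup>2) \<le> 1"
  proof -
    have "(\<Sum>k<N. (?c k)\<^sup>2) = (\<Sum>k<N. of_bool (k = j) * (1 - 2 / N) + 1 / (real N)\<^sup>2)"
      by (intro sum.cong refl) (auto simp: power2_eq_square field_simps)
    also have "\<dots> = (1 - 2 / N) + 1 / N"
      using j by (simp add: sum.distrib of_bool_def if_distrib[of "\<lambda>x. x * _"] power2_eq_square cong: if_cong)
    finally show ?thesis by simp
  qed
  have sq: "(cmod (\<Sum>x\<in>S. complex_of_real (?c (h x)) * z x))\<^sup>2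
     = (\<Sum>x\<in>S. \<Sum>y\<in>S. Re (z x * cnj (z y)) * (?c (h x) * ?c (h y)))" for h
  proof -
    have "complex_of_real ((cmod (\<Sum>x\<in>S. complex_of_real (?c (h x)) * z x))\<^sup>2)
      = (\<Sum>x\<in>S. \<Sum>y\<in>S. complex_of_real (?c (h x)) * z x * cnj (complex_of_real (?c (h y)) * z y))"
      by (simp only: complex_norm_square cnj_sum sum_product)
    also have "\<dots> = (\<Sum>x\<in>S. \<Sum>y\<in>S. complex_of_real (?c (h x) * ?c (h y)) * (z x * cnj (z y)))"
      by (intro sum.cong refl) (simp add: mult_ac)
    finally have "Re (complex_of_real ((cmod (\<Sum>x\<in>S. complex_of_real (?c (h x)) * z x))\<^sup>2))
      = Re (\<Sum>x\<in>S. \<Sum>y\<in>S. complex_of_real (?c (h x) * ?c (h y)) * (z x * cnj (z y)))" by (rule arg_cong)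
    moreover have "Re (complex_of_real r * w) = Re w * r" for r w by simp
    ultimately show ?thesis by (simp only: Re_complex_of_real Re_sum)
  qed
  have mean: "hash_mean S N (\<lambda>h. ?c (h x) * ?c (h y)) = (if x = y then (\<Sum>k<N. (?c k)\<^sup>2) / N else 0)"
    if "x \<in> S" "y \<in> S" for x y
  proof (cases "x = y")
    case True
    then show ?thesis using hash_mean_single[OF S that(1) N, of "\<lambda>k. (?c k)\<^sup>2"] by (simp add: power2_eq_square)
  next
    case False
    then show ?thesis using hash_mean_pair[OF S that(1,2) False N, of ?c ?c] by (simp only: c0) simp
  qed
  have "hash_mean S N (\<lambda>h. (cmod (\<Sum>x\<in>S. complex_of_real (?c (h x)) * z x))\<^sup>2)
    = (\<Sum>x\<in>S. \<Sum>y\<in>S. Re (z x * cnj (z y)) * hash_mean S N (\<lambda>h. ?c (h x) * ?c (h y)))"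
    unfolding sq by (simp only: hash_mean_sum hash_mean_cmult)
  also have "\<dots> = (\<Sum>x\<in>S. \<Sum>y\<in>S. if x = y then Re (z x * cnj (z y)) * ((\<Sum>k<N. (?c k)\<^sup>2) / N) else 0)"
    by (intro sum.cong refl) (simp only: mean if_distrib[of "\<lambda>x. _ * x"] mult_zero_right)
  also have "\<dots> = (\<Sum>x\<in>S. (cmod (z x))\<^sup>2 * ((\<Sum>k<N. (?c k)\<^sup>2) / N))"
    using S by (intro sum.cong refl) (simp add: cmod_power2 flip: power2_eq_square)
  also have "\<dots> \<le> (\<Sum>x\<in>S. (cmod (z x))\<^sup>2 * (1 / N))"
    using c1 by (intro sum_mono mult_left_mono divide_right_mono) auto
  finally show ?thesis by (simp add: sum_divide_distrib)
qed

text \<open>The bin \<open>h x div M\<close> is uniform, since each bin contains \<open>M\<close>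
  hash values; the probability (1 / B)^2 is summed over the \<open>B\<close> possible common
  bins.\<close>

lemma hash_mean_collision:
  assumes S: "finite S" "x \<in> S" "y \<in> S" "x \<noteq> y" and BM: "0 < B" "0 < M"
  shows "hash_mean S (B * M) (\<lambda>h. of_bool (h y div M = h x div M)) = 1 / B"
proof -
  have N: "0 < B * M" using BM by simp
  have cnt: "(\<Sum>j<B * M. of_bool (j div M = b)) = real M" if "b < B" for b
  proof -
    have "(\<Sum>j<B * M. of_bool (j div M = b)) = (\<Sum>i<B. \<Sum>j<M. of_bool (i = b) :: real)"
      by (rule sum_div_mod)
    also have "\<dots> = (\<Sum>i<B. if i = b then real M else 0)"
      by (intro sum.cong refl) auto
    finally show ?thesis using that by simp
  qed
  have "hash_mean S (B * M) (\<lambda>h. of_bool (h y div M = h x div M))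
     = hash_mean S (B * M) (\<lambda>h. \<Sum>b<B. of_bool (h x div M = b) * of_bool (h y div M = b))"
  proof -
    have "of_bool (h y div M = h x div M) = (\<Sum>b<B. of_bool (h x div M = b) * of_bool (h y div M = b) :: real)"
      if "h \<in> S \<rightarrow>\<^sub>E {..<B * M}" for h
    proof -
      have "h x < B * M" using that S by auto
      then have "h x div M < B" by (rule div_mod_bounds)
      moreover have "(\<Sum>b<B. of_bool (h x div M = b) * of_bool (h y div M = b) :: real)
        = (\<Sum>b<B. if h x div M = b then of_bool (h y div M = b) else 0)"
        by (intro sum.cong refl) simp
      ultimately show ?thesis by simp
    qed
    then show ?thesis unfolding hash_mean_def by (intro arg_cong2[of _ _ _ _ "(/)"] sum.cong refl)
  qed
  also have "\<dots> = (\<Sum>b<B. hash_mean S (B * M) (\<lambda>h. of_bool (h x div M = b) * of_bool (h y div M = b)))"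
    by (rule hash_mean_sum)
  also have "\<dots> = (\<Sum>b<B. (1 / B) * (1 / B))"
  proof (rule sum.cong[OF refl])
    fix b assume "b \<in> {..<B}"
    then have b: "b < B" by simp
    show "hash_mean S (B * M) (\<lambda>h. of_bool (h x div M = b) * of_bool (h y div M = b)) = (1 / B) * (1 / B)"
      unfolding hash_mean_pair[OF S N, of "\<lambda>j. of_bool (j div M = b)" "\<lambda>j. of_bool (j div M = b)"] cnt[OF b]
      using BM by simp
  qed
  also have "\<dots> = 1 / B" using BM by simp
  finally show ?thesis .
qed

section \<open>One-shot bounds\<close>

definition spectral_proj :: "nat \<Rightarrow> complex mat \<Rightarrow> nat set \<Rightarrow> complex mat" where
  "spectral_proj d U K = U * mat_diag d (\<lambda>k. if k \<in> K then 1 else 0) * mat_adjoint U"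

lemma frob_unitary_diag:
  assumes "U \<in> carrier_mat d d" "mat_adjoint U * U = 1\<^sub>m d"
  shows "(frob (U * mat_diag d g))\<^sup>2 = (\<Sum>k<d. (cmod (g k))\<^sup>2)"
proof -
  have "(frob (U * mat_diag d g))\<^sup>2 = (frob (mat_diag d g))\<^sup>2"
    using frob_isometry[OF assms mat_diag_dim] by simp
  also have "\<dots> = (\<Sum>i<d. \<Sum>j<d. if i = j then (cmod (g j))\<^sup>2 else 0)"
    unfolding frob_sq[OF mat_diag_dim] by (intro sum.cong refl) (auto simp: mat_diag_def)
  finally show ?thesis by simp
qed

context
  fixes d :: nat and U :: "complex mat"
  assumes U: "U \<in> carrier_mat d d" "mat_adjoint U * U = 1\<^sub>m d"
begin

lemma spectral_proj_carrier: "spectral_proj d U K \<in> carrier_mat d d"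
  using U(1) by (simp add: spectral_proj_def mult_carrier_mat[of _ d d _ d])

lemma spectral_proj_mult: "spectral_proj d U K * (U * mat_diag d g) = U * mat_diag d (\<lambda>k. if k \<in> K then g k else 0)"
proof -
  let ?I = "mat_diag d (\<lambda>k. if k \<in> K then 1 else 0 :: complex)" and ?G = "mat_diag d g"
  note [simp] = assoc_mult_mat[of _ d d _ d _ d] mult_carrier_mat[of _ d d _ d]
  have "mat_adjoint U * (U * ?G) = mat_adjoint U * U * ?G"
    by (rule assoc_mult_mat[symmetric, of _ d d _ d _ d]) (use U(1) in auto)
  then have c: "mat_adjoint U * (U * ?G) = ?G" by (simp only: U(2) left_mult_one_mat[OF mat_diag_dim])
  have "spectral_proj d U K * (U * ?G) = U * (?I * (mat_adjoint U * (U * ?G)))"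
    unfolding spectral_proj_def using U(1) by simp
  also have "\<dots> = U * mat_diag d (\<lambda>k. (if k \<in> K then 1 else 0) * g k)" by (simp only: c mat_diag_diag)
  also have "(\<lambda>k. (if k \<in> K then 1 else 0) * g k) = (\<lambda>k. if k \<in> K then g k else 0)" by auto
  finally show ?thesis .
qed

lemma spectral_proj_projector: "projector d (spectral_proj d U K)"
proof -
  let ?I = "mat_diag d (\<lambda>k. if k \<in> K then 1 else 0 :: complex)"
  have "spectral_proj d U K * spectral_proj d U K = spectral_proj d U K * (U * ?I) * mat_adjoint U"
    unfolding spectral_proj_def[of d U K, THEN arg_cong[of _ _ "\<lambda>X. spectral_proj d U K * X"]]
    by (rule assoc_mult_mat[symmetric, of _ d d _ d _ d])
      (use U(1) spectral_proj_carrier in \<open>auto intro: mult_carrier_mat[of _ d d _ d]\<close>)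
  also have "\<dots> = spectral_proj d U K"
    unfolding spectral_proj_mult by (simp add: spectral_proj_def cong: if_cong)
  finally have "spectral_proj d U K * spectral_proj d U K = spectral_proj d U K" .
  moreover have "mat_adjoint (spectral_proj d U K) = spectral_proj d U K"
    using U(1) by (simp add: spectral_proj_def adjoint_mult[of _ d d _ d] adjoint_diag
        assoc_mult_mat[of _ d d _ d _ d] mult_carrier_mat[of _ d d _ d] if_distrib[of cnj] cong: if_cong)
  ultimately show ?thesis using spectral_proj_carrier by (simp add: projector_def)
qed

lemma spectral_proj_complement: "1\<^sub>m d - spectral_proj d U K = spectral_proj d U (- K)"
proof -
  let ?I = "\<lambda>K. mat_diag d (\<lambda>k. if k \<in> K then 1 else 0 :: complex)"
  have c: "U * ?I K \<in> carrier_mat d d" for K using U(1) by (auto intro: mult_carrier_mat)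
  have "spectral_proj d U K + spectral_proj d U (- K) = (U * ?I K + U * ?I (- K)) * mat_adjoint U"
    unfolding spectral_proj_def by (rule add_mult_distrib_mat[symmetric, OF c c]) (use U(1) in simp)
  also have "U * ?I K + U * ?I (- K) = U * (?I K + ?I (- K))"
    by (rule mult_add_distrib_mat[symmetric, OF U(1) mat_diag_dim mat_diag_dim])
  also have "?I K + ?I (- K) = 1\<^sub>m d" by (rule eq_matI) (auto simp: mat_diag_def)
  also have "U * 1\<^sub>m d * mat_adjoint U = 1\<^sub>m d"
    using unitary_right[OF U] U(1) by simp
  finally have sum: "spectral_proj d U K + spectral_proj d U (- K) = 1\<^sub>m d" .
  show ?thesis unfolding sum[symmetric]
    by (rule eq_matI) (use spectral_proj_carrier[of K] spectral_proj_carrier[of "- K"] in auto)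
qed

lemma frob_spectral_proj: "(frob (spectral_proj d U K))\<^sup>2 = real (card {k. k < d \<and> k \<in> K})"
proof -
  have c: "U * mat_diag d (\<lambda>k. if k \<in> K then 1 else 0 :: complex) \<in> carrier_mat d d"
    using U(1) by (auto intro: mult_carrier_mat)
  have "frob (spectral_proj d U K) = frob (U * mat_diag d (\<lambda>k. if k \<in> K then 1 else 0 :: complex))"
    unfolding spectral_proj_def
    by (rule frob_isometry_right[OF _ _ c]) (use U in auto)
  then have "(frob (spectral_proj d U K))\<^sup>2 = (\<Sum>k<d. if k \<in> K then 1 else 0)"
    unfolding frob_unitary_diag[OF U, of "\<lambda>k. if k \<in> K then 1 else 0", symmetric]
    by (simp add: frob_unitary_diag[OF U] if_distrib[of cmod] if_distrib[of "\<lambda>x. x\<^sup>2"] cong: if_cong)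
  also have "\<dots> = real (card ({..<d} \<inter> K))" by (simp add: sum.If_cases)
  also have "{..<d} \<inter> K = {k. k < d \<and> k \<in> K}" by auto
  finally show ?thesis .
qed

lemma spectral_proj_sqrt_factor:
  "spectral_proj d U K * sqrt_factor d U e = U * mat_diag d (\<lambda>k. if k \<in> K then complex_of_real (sqrt (e k)) else 0)"
  unfolding sqrt_factor_def by (rule spectral_proj_mult)

lemma frob_spectral_proj_sqrt_factor:
  assumes "\<And>k. 0 \<le> e k"
  shows "(frob (spectral_proj d U K * sqrt_factor d U e))\<^sup>2 = (\<Sum>k | k < d \<and> k \<in> K. e k)"
proof -
  have "(frob (spectral_proj d U K * sqrt_factor d U e))\<^sup>2 = (\<Sum>k<d. if k \<in> K then e k else 0)"
    unfolding spectral_proj_sqrt_factor frob_unitary_diag[OF U]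
    using assms by (intro sum.cong refl) auto
  also have "\<dots> = (\<Sum>k\<in>{..<d} \<inter> K. e k)" by (simp add: sum.If_cases)
  also have "{..<d} \<inter> K = {k. k < d \<and> k \<in> K}" by auto
  finally show ?thesis .
qed

end

text \<open>Right multiplication by \<open>U\<close> preserves the norm, and the diagonal factor
  scales each column by at most sqrt \<tau>. For a projector \<open>X\<close> the right side is
  \<tau> times its rank.\<close>

lemma frob_mult_unitary_diag_le:
  assumes X: "X \<in> carrier_mat d d" and U: "U \<in> carrier_mat d d" "mat_adjoint U * U = 1\<^sub>m d"
    and g: "\<And>k. k < d \<Longrightarrow> (cmod (g k))\<^sup>2 \<le> \<tau>"
  shows "(frob (X * (U * mat_diag d g)))\<^sup>2 \<le> \<tau> * (frob X)\<^sup>2"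
proof -
  have XU: "X * U \<in> carrier_mat d d" using X U by (auto intro: mult_carrier_mat)
  have XUD: "X * U * mat_diag d g \<in> carrier_mat d d" using XU by (rule mult_carrier_mat) simp
  have "X * (U * mat_diag d g) = X * U * mat_diag d g"
    by (rule assoc_mult_mat[symmetric, OF X U(1) mat_diag_dim])
  then have "(frob (X * (U * mat_diag d g)))\<^sup>2 = (\<Sum>i<d. \<Sum>k<d. (cmod ((X * U * mat_diag d g) $$ (i, k)))\<^sup>2)"
    by (simp only: frob_sq[OF XUD])
  also have "\<dots> = (\<Sum>i<d. \<Sum>k<d. (cmod ((X * U) $$ (i, k)))\<^sup>2 * (cmod (g k))\<^sup>2)"
    by (intro sum.cong refl) (simp add: mat_diag_mult_right[OF XU] norm_mult power_mult_distrib)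
  also have "\<dots> \<le> (\<Sum>i<d. \<Sum>k<d. (cmod ((X * U) $$ (i, k)))\<^sup>2 * \<tau>)"
    using g by (intro sum_mono mult_left_mono) auto
  also have "\<dots> = \<tau> * (frob (X * U))\<^sup>2"
    by (simp add: frob_sq[OF XU] sum_distrib_left mult.commute)
  also have "frob (X * U) = frob X"
    by (rule frob_isometry_right[OF U(1) unitary_right[OF U] X])
  finally show ?thesis .
qed

lemma frob_sqrt_factor:
  assumes "density_decomp d \<omega> U e"
  shows "frob (sqrt_factor d U e) = 1"
proof -
  note D = density_decompD[OF assms]
  have "(frob (sqrt_factor d U e))\<^sup>2 = (\<Sum>k<d. e k)"
    unfolding sqrt_factor_def frob_unitary_diag[OF D(5,7)] using D(3) by simp
  then show ?thesis using D(4) by (simp add: power2_eq_1_iff) (metis frob_nonneg neg_0_le_iff_le not_one_le_zero)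
qed

text \<open>Unnormalised state of the hash cell \<open>j\<close> minus its uniform share of the
  average. If it vanished for all \<open>j\<close>, the hash value would be uniform and independent
  of the quantum system.\<close>

definition hash_state :: "nat \<Rightarrow> 'a set \<Rightarrow> nat \<Rightarrow> ('a \<Rightarrow> real) \<Rightarrow> ('a \<Rightarrow> complex mat) \<Rightarrow> ('a \<Rightarrow> nat) \<Rightarrow> nat \<Rightarrow> complex mat" where
  "hash_state d S N p \<omega> h j = average d (\<lambda>x. p x * (of_bool (h x = j) - 1 / N)) \<omega> S"

lemma trace_contraction_le:
  assumes "contraction d V" "X \<in> carrier_mat d d" "Y \<in> carrier_mat d d"
  shows "cmod (mat_trace (V * (X * mat_adjoint Y))) \<le> frob X * frob Y"
proof -
  have V: "V \<in> carrier_mat d d" and c: "frob (V * X) \<le> frob X" using assms by (auto simp: contraction_def)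
  have VX: "V * X \<in> carrier_mat d d" using V assms(2) by (rule mult_carrier_mat)
  have "V * (X * mat_adjoint Y) = V * X * mat_adjoint Y"
    by (rule assoc_mult_mat[symmetric, OF V assms(2)]) (use assms(3) in simp)
  then have "mat_trace (V * (X * mat_adjoint Y)) = frob_inner (V * X) Y"
    by (simp add: frob_inner_def)
  also have "cmod \<dots> \<le> frob (V * X) * frob Y" by (rule frob_cauchy[OF VX assms(3)])
  also have "\<dots> \<le> frob X * frob Y" using c by (intro mult_right_mono) auto
  finally show ?thesis .
qed

text \<open>Bounds \<open>\<parallel>R R\<^sup>* - T T\<^sup>*\<parallel>\<^sub>1\<close>, tested against a contraction.\<close>

lemma gentle_contraction:
  assumes V: "contraction d V" and R: "R \<in> carrier_mat d d" and T: "T \<in> carrier_mat d d"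
    and "frob R \<le> 1" "frob T \<le> 1"
  shows "\<bar>Re (mat_trace (V * (R * mat_adjoint R))) - Re (mat_trace (V * (T * mat_adjoint T)))\<bar> \<le> 2 * frob (R - T)"
proof -
  have Vc: "V \<in> carrier_mat d d" using V by (simp add: contraction_def)
  have RT: "R - T \<in> carrier_mat d d" using T by (rule minus_carrier_mat)
  have a: "mat_adjoint R \<in> carrier_mat d d" "mat_adjoint T \<in> carrier_mat d d" "mat_adjoint (R - T) \<in> carrier_mat d d"
    using R T RT by simp_all
  have c: "(R - T) * mat_adjoint R \<in> carrier_mat d d" "T * mat_adjoint (R - T) \<in> carrier_mat d d"
    "R * mat_adjoint R \<in> carrier_mat d d" "T * mat_adjoint T \<in> carrier_mat d d" "T * mat_adjoint R \<in> carrier_mat d d"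
    using mult_carrier_mat[OF RT a(1)] mult_carrier_mat[OF T a(3)] mult_carrier_mat[OF R a(1)]
      mult_carrier_mat[OF T a(2)] mult_carrier_mat[OF T a(1)] by simp_all
  have e1: "(R - T) * mat_adjoint R = R * mat_adjoint R - T * mat_adjoint R"
    by (rule minus_mult_distrib_mat[OF R T a(1)])
  have e2: "T * mat_adjoint (R - T) = T * mat_adjoint R - T * mat_adjoint T"
    unfolding adjoint_minus[OF R T] by (rule mult_minus_distrib_mat[OF T a(1,2)])
  have t1: "mat_trace (V * ((R - T) * mat_adjoint R)) = mat_trace (V * (R * mat_adjoint R)) - mat_trace (V * (T * mat_adjoint R))"
    unfolding e1 mult_minus_distrib_mat[OF Vc c(3,5)]
    by (rule trace_minus[OF mult_carrier_mat[OF Vc c(3)] mult_carrier_mat[OF Vc c(5)]])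
  have t2: "mat_trace (V * (T * mat_adjoint (R - T))) = mat_trace (V * (T * mat_adjoint R)) - mat_trace (V * (T * mat_adjoint T))"
    unfolding e2 mult_minus_distrib_mat[OF Vc c(5,4)]
    by (rule trace_minus[OF mult_carrier_mat[OF Vc c(5)] mult_carrier_mat[OF Vc c(4)]])
  have "\<bar>Re (mat_trace (V * (R * mat_adjoint R))) - Re (mat_trace (V * (T * mat_adjoint T)))\<bar>
     = \<bar>Re (mat_trace (V * ((R - T) * mat_adjoint R)) + mat_trace (V * (T * mat_adjoint (R - T))))\<bar>"
    by (simp only: t1 t2) simp
  also have "\<dots> \<le> cmod (mat_trace (V * ((R - T) * mat_adjoint R)) + mat_trace (V * (T * mat_adjoint (R - T))))"
    by (rule abs_Re_le_cmod)
  also have "\<dots> \<le> frob (R - T) * frob R + frob T * frob (R - T)"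
    by (rule order_trans[OF norm_triangle_ineq add_mono])
      (rule trace_contraction_le[OF V RT R], rule trace_contraction_le[OF V T RT])
  also have "\<dots> \<le> frob (R - T) * 1 + 1 * frob (R - T)"
    using assms by (intro add_mono mult_left_mono mult_right_mono) auto
  finally show ?thesis by simp
qed

text \<open>The view of one receiver, instantiated for Bob and for Eve with sequences of length
  \<open>n\<close>. The numbers \<open>p x * e x k\<close> are the eigenvalues of the
  classical-quantum state, and \<open>f k\<close> those of its reduction to the quantum
  part.\<close>

locale cq_ensemble =
  fixes S :: "'a set" and p :: "'a \<Rightarrow> real" and d :: nat and \<omega> :: "'a \<Rightarrow> complex mat"
    and U :: "'a \<Rightarrow> complex mat" and e :: "'a \<Rightarrow> nat \<Rightarrow> real" and V :: "complex mat" and f :: "nat \<Rightarrow> real"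
  assumes finite_S: "finite S" and p_nonneg: "\<And>x. 0 \<le> p x" and p_sum: "(\<Sum>x\<in>S. p x) = 1"
    and dec: "\<And>x. x \<in> S \<Longrightarrow> density_decomp d (\<omega> x) (U x) (e x)"
    and dec_avg: "density_decomp d (average d p \<omega> S) V f"
begin

lemmas D = density_decompD[OF dec]
lemmas DA = density_decompD[OF dec_avg]

definition R :: "'a \<Rightarrow> complex mat" where "R x = sqrt_factor d (U x) (e x)"

lemma R_carrier: "x \<in> S \<Longrightarrow> R x \<in> carrier_mat d d"
  unfolding R_def by (rule sqrt_factor_carrier[OF D(5)])

lemma R_gram: "x \<in> S \<Longrightarrow> R x * mat_adjoint (R x) = \<omega> x"
  unfolding R_def by (rule sqrt_factor_gram[OF dec])

lemma R_frob: "x \<in> S \<Longrightarrow> frob (R x) = 1"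
  unfolding R_def by (rule frob_sqrt_factor[OF dec])

lemma trace_average:
  assumes X: "X \<in> carrier_mat d d"
  shows "mat_trace (X * average d q \<omega> S) = (\<Sum>x\<in>S. complex_of_real (q x) * mat_trace (X * \<omega> x))"
proof -
  have "mat_trace (X * average d q \<omega> S) = (\<Sum>x\<in>S. mat_trace (X * (complex_of_real (q x) \<cdot>\<^sub>m \<omega> x)))"
    unfolding average_def by (rule trace_mult_mat_sum[OF X]) (use D(1) in auto)
  also have "\<dots> = (\<Sum>x\<in>S. complex_of_real (q x) * mat_trace (X * \<omega> x))"
    using X D(1) by (intro sum.cong refl)
      (simp add: mult_smult_distrib[of _ d d _ d] trace_smult[OF mult_carrier_mat[OF X]])
  finally show ?thesis .
qed

text \<open>The squared norm of \<open>X * R x\<close> is linear in the state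
  \<open>\<omega> x\<close>, so averaging it yields the same expression for the averaged
  state.\<close>

lemma frob_average:
  assumes X: "X \<in> carrier_mat d d"
  shows "(\<Sum>x\<in>S. p x * (frob (X * R x))\<^sup>2) = (frob (X * sqrt_factor d V f))\<^sup>2"
proof -
  have XX: "mat_adjoint X * X \<in> carrier_mat d d" by (rule mult_carrier_mat[OF _ X]) (use X in simp)
  have "complex_of_real ((frob (X * sqrt_factor d V f))\<^sup>2) = mat_trace (mat_adjoint X * X * average d p \<omega> S)"
    using trace_gram_gram[OF X sqrt_factor_carrier[OF DA(5), of f]] by (simp only: sqrt_factor_gram[OF dec_avg])
  also have "\<dots> = (\<Sum>x\<in>S. complex_of_real (p x) * mat_trace (mat_adjoint X * X * \<omega> x))"
    by (rule trace_average[OF XX])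
  also have "\<dots> = (\<Sum>x\<in>S. complex_of_real (p x * (frob (X * R x))\<^sup>2))"
  proof (rule sum.cong[OF refl])
    fix x assume x: "x \<in> S"
    show "complex_of_real (p x) * mat_trace (mat_adjoint X * X * \<omega> x) = complex_of_real (p x * (frob (X * R x))\<^sup>2)"
      using trace_gram_gram[OF X R_carrier[OF x]] by (simp only: R_gram[OF x] of_real_mult)
  qed
  also have "\<dots> = complex_of_real (\<Sum>x\<in>S. p x * (frob (X * R x))\<^sup>2)" by simp
  finally have "(frob (X * sqrt_factor d V f))\<^sup>2 = (\<Sum>x\<in>S. p x * (frob (X * R x))\<^sup>2)" by (simp only: of_real_eq_iff)
  then show ?thesis by (rule sym)
qed

definition avg_proj :: "nat set \<Rightarrow> complex mat" where "avg_proj K = spectral_proj d V K"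
definition cond_proj :: "'a \<Rightarrow> nat set \<Rightarrow> complex mat" where "cond_proj x K = spectral_proj d (U x) K"

lemma avg_proj: "projector d (avg_proj K)"
  unfolding avg_proj_def by (rule spectral_proj_projector[OF DA(5,7)])

lemma cond_proj: "x \<in> S \<Longrightarrow> projector d (cond_proj x K)"
  unfolding cond_proj_def by (rule spectral_proj_projector[OF D(5,7)])

lemma avg_proj_loss:
  "(\<Sum>x\<in>S. p x * (frob ((1\<^sub>m d - avg_proj K) * R x))\<^sup>2) = (\<Sum>k | k < d \<and> k \<notin> K. f k)"
proof -
  have c: "1\<^sub>m d - avg_proj K \<in> carrier_mat d d"
    by (rule minus_carrier_mat[OF projectorD(1)[OF avg_proj]])
  show ?thesis
    unfolding frob_average[OF c]
    unfolding avg_proj_def spectral_proj_complement[OF DA(5,7)]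
      frob_spectral_proj_sqrt_factor[OF DA(5,7) DA(3)] by simp
qed

lemma cond_proj_loss:
  assumes "x \<in> S"
  shows "(frob ((1\<^sub>m d - cond_proj x K) * R x))\<^sup>2 = (\<Sum>k | k < d \<and> k \<notin> K. e x k)"
  unfolding cond_proj_def R_def spectral_proj_complement[OF D(5,7)[OF assms]]
    frob_spectral_proj_sqrt_factor[OF D(5,7)[OF assms] D(3)[OF assms]] by simp

text \<open>Thresholds act on the joint eigenvalue: typicality of the sequence and of the
  conditional spectrum become a single event.\<close>

definition joint_tail :: "(real \<Rightarrow> bool) \<Rightarrow> real" where
  "joint_tail Z = (\<Sum>x\<in>S. \<Sum>k | k < d \<and> Z (p x * e x k). p x * e x k)"

definition avg_tail :: "(real \<Rightarrow> bool) \<Rightarrow> real" where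
  "avg_tail Z = (\<Sum>k | k < d \<and> Z (f k). f k)"

lemma joint_sum: "(\<Sum>x\<in>S. \<Sum>k<d. p x * e x k) = 1"
proof -
  have "(\<Sum>x\<in>S. \<Sum>k<d. p x * e x k) = (\<Sum>x\<in>S. p x)"
    by (intro sum.cong refl) (simp add: D(4) flip: sum_distrib_left)
  then show ?thesis by (simp add: p_sum)
qed

subsection \<open>Bob\<close>

context
  fixes \<tau> \<theta> :: real
  assumes \<tau>: "0 < \<tau>" and \<theta>: "0 < \<theta>"
begin

text \<open>Bob cuts the averaged spectrum from above, which bounds the averaged state by \<tau>,
  and the joint spectrum from below, which bounds the ranks of the conditional projectors.\<close>

definition bob_avg :: "complex mat" where "bob_avg = avg_proj {k. f k \<le> \<tau>}"
definition bob_cond :: "'a \<Rightarrow> complex mat" where "bob_cond x = cond_proj x {k. \<theta> \<le> p x * e x k}"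

lemma bob_avg: "projector d bob_avg" unfolding bob_avg_def by (rule avg_proj)
lemma bob_cond: "x \<in> S \<Longrightarrow> projector d (bob_cond x)" unfolding bob_cond_def by (rule cond_proj)

lemma bob_avg_R: "x \<in> S \<Longrightarrow> bob_avg * R x \<in> carrier_mat d d"
  by (rule mult_carrier_mat[OF projectorD(1)[OF bob_avg] R_carrier])

text \<open>In probabilities: loss in the cut; loss in the right test, without and after the cut;
  acceptance of the cut state of \<open>x\<close> by the test for \<open>z\<close>.\<close>

abbreviation (input) "avg_loss x \<equiv> (frob ((1\<^sub>m d - bob_avg) * R x))\<^sup>2"
abbreviation (input) "cond_loss x \<equiv> (frob ((1\<^sub>m d - bob_cond x) * R x))\<^sup>2"
abbreviation (input) "cut_loss x \<equiv> (frob ((1\<^sub>m d - bob_cond x) * (bob_avg * R x)))\<^sup>2"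
abbreviation (input) "hit z x \<equiv> (frob (bob_cond z * (bob_avg * R x)))\<^sup>2"

text \<open>For fixed \<open>z\<close> the average over \<open>x\<close> replaces the states by
  their average, which is at most \<tau> after the cut, so \<open>z\<close> contributes at most
  \<tau> times the rank of its projector. The indices counted by that rank satisfy
  \<open>\<theta> \<le> p z * e z k\<close>, and the joint eigenvalues sum to one, so the ranks
  total at most 1 / \<theta>.\<close>

lemma bob_overlap:
  "(\<Sum>x\<in>S. p x * (\<Sum>z\<in>S. hit z x)) \<le> \<tau> / \<theta>"
proof -
  have overlap: "(\<Sum>x\<in>S. p x * hit z x)
      \<le> \<tau> * real (card {k. k < d \<and> \<theta> \<le> p z * e z k})" if z: "z \<in> S" for z
  proof -
    note Q = projectorD(1)[OF bob_cond[OF z]] and P = projectorD(1)[OF bob_avg]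
    have QP: "bob_cond z * bob_avg \<in> carrier_mat d d" by (rule mult_carrier_mat[OF Q P])
    have "(\<Sum>x\<in>S. p x * hit z x)
        = (\<Sum>x\<in>S. p x * (frob (bob_cond z * bob_avg * R x))\<^sup>2)"
      by (intro sum.cong refl) (simp add: assoc_mult_mat[OF Q P R_carrier])
    also have "\<dots> = (frob (bob_cond z * bob_avg * sqrt_factor d V f))\<^sup>2"
      by (rule frob_average[OF QP])
    also have "bob_cond z * bob_avg * sqrt_factor d V f = bob_cond z * (bob_avg * sqrt_factor d V f)"
      by (rule assoc_mult_mat[OF Q P sqrt_factor_carrier[OF DA(5)]])
    also have "bob_avg * sqrt_factor d V f
        = V * mat_diag d (\<lambda>k. if k \<in> {k. f k \<le> \<tau>} then complex_of_real (sqrt (f k)) else 0)"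
      unfolding bob_avg_def avg_proj_def by (rule spectral_proj_sqrt_factor[OF DA(5,7)])
    also have "(frob (bob_cond z * \<dots>))\<^sup>2 \<le> \<tau> * (frob (bob_cond z))\<^sup>2"
      by (rule frob_mult_unitary_diag_le[OF Q DA(5,7)]) (use DA(3) \<tau> in \<open>auto simp: less_imp_le\<close>)
    also have "(frob (bob_cond z))\<^sup>2 = real (card {k. k < d \<and> \<theta> \<le> p z * e z k})"
      unfolding bob_cond_def cond_proj_def frob_spectral_proj[OF D(5,7)[OF z]] by simp
    finally show ?thesis .
  qed
  have rank: "real (card {k. k < d \<and> \<theta> \<le> p z * e z k}) \<le> (\<Sum>k<d. p z * e z k) / \<theta>" if z: "z \<in> S" for z
  proof -
    have "real (card {k. k < d \<and> \<theta> \<le> p z * e z k}) * \<theta> = (\<Sum>k | k < d \<and> \<theta> \<le> p z * e z k. \<theta>)" by simp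
    also have "\<dots> \<le> (\<Sum>k | k < d \<and> \<theta> \<le> p z * e z k. p z * e z k)" by (intro sum_mono) auto
    also have "\<dots> \<le> (\<Sum>k<d. p z * e z k)" using p_nonneg D(3)[OF z] by (intro sum_mono2) auto
    finally show ?thesis using \<theta> by (simp add: pos_le_divide_eq)
  qed
  have "(\<Sum>x\<in>S. p x * (\<Sum>z\<in>S. hit z x))
      = (\<Sum>z\<in>S. \<Sum>x\<in>S. p x * hit z x)"
    unfolding sum_distrib_left by (rule sum.swap)
  also have "\<dots> \<le> (\<Sum>z\<in>S. \<tau> * ((\<Sum>k<d. p z * e z k) / \<theta>))"
    using \<tau> by (intro sum_mono order_trans[OF overlap] mult_left_mono rank) auto
  also have "\<dots> = \<tau> / \<theta>"
    using joint_sum by (simp add: sum_divide_distrib[symmetric] sum_distrib_left[symmetric])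
  finally show ?thesis .
qed

lemma bob_loss:
  "(\<Sum>x\<in>S. p x * avg_loss x) = avg_tail (\<lambda>t. \<tau> < t)"
  unfolding bob_avg_def avg_proj_loss avg_tail_def by (intro sum.cong) auto

lemma bob_cond_loss:
  "(\<Sum>x\<in>S. p x * cond_loss x) = joint_tail (\<lambda>t. t < \<theta>)"
proof -
  have "p x * cond_loss x = (\<Sum>k | k < d \<and> p x * e x k < \<theta>. p x * e x k)"
    if "x \<in> S" for x
  proof -
    have "{k. k < d \<and> k \<notin> {k. \<theta> \<le> p x * e x k}} = {k. k < d \<and> p x * e x k < \<theta>}" by auto
    then show ?thesis unfolding bob_cond_def cond_proj_loss[OF that] by (simp add: sum_distrib_left)
  qed
  then show ?thesis by (simp add: joint_tail_def)
qed

text \<open>The test follows the cut, so the cut state is written as the original minus the part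
  lost in the cut. The factors two come from (a + b)^2 \<le> 2 a^2 + 2 b^2.\<close>

lemma bob_cond_avg_loss:
  "(\<Sum>x\<in>S. p x * cut_loss x)
    \<le> 2 * joint_tail (\<lambda>t. t < \<theta>) + 2 * avg_tail (\<lambda>t. \<tau> < t)"
proof -
  have "p x * cut_loss x
     \<le> p x * (2 * cond_loss x + 2 * avg_loss x)" if x: "x \<in> S" for x
  proof -
    let ?C = "1\<^sub>m d - bob_cond x" and ?P = "1\<^sub>m d - bob_avg"
    note C = projector_complement[OF bob_cond[OF x]] and P = projector_complement[OF bob_avg]
    note Cc = projectorD(1)[OF C] and Pc = projectorD(1)[OF bob_avg] and Rc = R_carrier[OF x]
    have PR: "?P * R x \<in> carrier_mat d d" by (rule mult_carrier_mat[OF projectorD(1)[OF P] Rc])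
    have "bob_avg * R x = R x - ?P * R x"
      unfolding complement_mult[OF Pc Rc] by (rule eq_matI) (use Rc bob_avg_R[OF x] in auto)
    then have "?C * (bob_avg * R x) = ?C * R x - ?C * (?P * R x)"
      by (simp only: mult_minus_distrib_mat[OF Cc Rc PR])
    then have "frob (?C * (bob_avg * R x)) \<le> frob (?C * R x) + frob (?C * (?P * R x))"
      using frob_minus_le[OF mult_carrier_mat[OF Cc Rc] mult_carrier_mat[OF Cc PR]] by simp
    also have "frob (?C * (?P * R x)) \<le> frob (?P * R x)" by (rule frob_projector_le[OF C PR])
    finally have "(frob (?C * (bob_avg * R x)))\<^sup>2 \<le> (frob (?C * R x) + frob (?P * R x))\<^sup>2"
      by (intro power_mono) auto
    also have "\<dots> \<le> 2 * (frob (?C * R x))\<^sup>2 + 2 * (frob (?P * R x))\<^sup>2"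
      using sum_squares_bound[of "frob (?C * R x)" "frob (?P * R x)"] by (simp add: power2_sum)
    finally show ?thesis by (rule mult_left_mono[OF _ p_nonneg])
  qed
  then have "(\<Sum>x\<in>S. p x * cut_loss x)
    \<le> (\<Sum>x\<in>S. p x * (2 * cond_loss x + 2 * avg_loss x))"
    by (rule sum_mono)
  also have "\<dots> = 2 * joint_tail (\<lambda>t. t < \<theta>) + 2 * avg_tail (\<lambda>t. \<tau> < t)"
    by (simp add: distrib_left sum.distrib mult.left_commute[of _ 2] flip: sum_distrib_left bob_loss bob_cond_loss)
  finally show ?thesis .
qed

text \<open>The entropy of the average does not exceed the joint entropy; this is that fact in one-shot form.\<close>

lemma bob_dimension_bound:
  "1 - 2 * joint_tail (\<lambda>t. t < \<theta>) - 3 * avg_tail (\<lambda>t. \<tau> < t) \<le> \<tau> / \<theta>"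
proof -
  \<comment> \<open>Unit mass splits into loss in the cut, loss in the right test, and acceptance.
    The tail of the averaged spectrum thus enters three times: once here, twice through
    \<open>bob_cond_avg_loss\<close>.\<close>
  have "p x = p x * avg_loss x + p x * cut_loss x
     + p x * hit x x" if x: "x \<in> S" for x
    using frob_pythagoras[OF bob_avg R_carrier[OF x]] frob_pythagoras[OF bob_cond[OF x] bob_avg_R[OF x]] R_frob[OF x]
    by (simp flip: distrib_left)
  then have "(\<Sum>x\<in>S. p x) = (\<Sum>x\<in>S. p x * avg_loss x
     + p x * cut_loss x + p x * hit x x)"
    by (rule sum.cong[OF refl])
  also have "\<dots> = avg_tail (\<lambda>t. \<tau> < t) + (\<Sum>x\<in>S. p x * cut_loss x)
      + (\<Sum>x\<in>S. p x * hit x x)"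
    by (simp add: sum.distrib bob_loss)
  also have "(\<Sum>x\<in>S. p x * hit x x)
     \<le> (\<Sum>x\<in>S. p x * (\<Sum>z\<in>S. hit z x))"
  proof (intro sum_mono mult_left_mono p_nonneg)
    fix x assume x: "x \<in> S"
    show "hit x x \<le> (\<Sum>z\<in>S. hit z x)"
      by (rule member_le_sum[OF x]) (use finite_S in auto)
  qed
  finally show ?thesis using p_sum bob_overlap bob_cond_avg_loss by linarith
qed

text \<open>The error estimate of \<open>sequential_decoder\<close> for the hash \<open>h\<close>.
  The indicator restricts the competitors to the announced bin and so makes the dependence on
  \<open>h\<close> explicit for averaging.\<close>

definition bob_bound :: "nat \<Rightarrow> ('a \<Rightarrow> nat) \<Rightarrow> real" where
  "bob_bound M h = (\<Sum>x\<in>S. p x * (avg_loss x +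
     2 * sqrt (cut_loss x +
       (\<Sum>z\<in>S - {x}. of_bool (h z div M = h x div M) * hit z x))))"

lemma bob_bound_nonneg: "0 \<le> bob_bound M h"
  unfolding bob_bound_def by (intro sum_nonneg mult_nonneg_nonneg p_nonneg add_nonneg_nonneg) (auto intro!: sum_nonneg add_nonneg_nonneg)

text \<open>One sequential decoder per bin, with the sequences of that bin as candidates and
  \<open>h x mod M\<close> as their key.\<close>

lemma bob_decoder:
  assumes M: "0 < M"
  shows "\<exists>D. (\<forall>b. povm d M (D b)) \<and>
    (\<Sum>x\<in>S. p x * (1 - Re (mat_trace (D (h x div M) (h x mod M) * \<omega> x)))) \<le> bob_bound M h"
proof -
  let ?good = "\<lambda>Y D y T. 1 - (frob ((1\<^sub>m d - bob_avg) * T))\<^sup>2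
       - 2 * sqrt ((frob ((1\<^sub>m d - bob_cond y) * (bob_avg * T)))\<^sup>2 + (\<Sum>z\<in>Y - {y}. (frob (bob_cond z * (bob_avg * T)))\<^sup>2))
     \<le> Re (mat_trace (D (h y mod M) * (T * mat_adjoint T)))"
  have "\<exists>D. povm d M D \<and> (\<forall>y\<in>{x \<in> S. h x div M = b}. \<forall>T\<in>carrier_mat d d. frob T = 1 \<longrightarrow> ?good {x \<in> S. h x div M = b} D y T)" for b
    using finite_S M bob_cond by (intro sequential_decoder[OF bob_avg]) auto
  then have "\<forall>b. \<exists>D. povm d M D \<and> (\<forall>y\<in>{x \<in> S. h x div M = b}. \<forall>T\<in>carrier_mat d d. frob T = 1 \<longrightarrow> ?good {x \<in> S. h x div M = b} D y T)"
    by (rule allI)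
  from choice[OF this] obtain D where
    *: "\<forall>b. povm d M (D b) \<and> (\<forall>y\<in>{x \<in> S. h x div M = b}. \<forall>T\<in>carrier_mat d d. frob T = 1 \<longrightarrow> ?good {x \<in> S. h x div M = b} (D b) y T)"
    by (rule exE)
  have povm: "povm d M (D b)" for b using *[rule_format, of b] by (rule conjunct1)
  have good: "?good {x \<in> S. h x div M = b} (D b) y T"
    if "y \<in> {x \<in> S. h x div M = b}" "T \<in> carrier_mat d d" "frob T = 1" for b y T
    using *[THEN spec, of b, THEN conjunct2, rule_format, OF that] .
  have step: "p x * (1 - Re (mat_trace (D (h x div M) (h x mod M) * \<omega> x)))
     \<le> p x * (avg_loss x +
     2 * sqrt (cut_loss x +
       (\<Sum>z\<in>S - {x}. of_bool (h z div M = h x div M) * hit z x)))"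
    if x: "x \<in> S" for x
  proof (rule mult_left_mono[OF _ p_nonneg])
    let ?Y = "{z \<in> S. h z div M = h x div M}"
    have "(\<Sum>z\<in>S - {x}. of_bool (h z div M = h x div M) * hit z x)
        = (\<Sum>z\<in>?Y - {x}. hit z x)"
      using finite_S by (intro sum.mono_neutral_cong_right) auto
    moreover have "?good ?Y (D (h x div M)) x (R x)"
      by (rule good) (use x R_carrier R_frob in auto)
    ultimately show "1 - Re (mat_trace (D (h x div M) (h x mod M) * \<omega> x)) \<le> avg_loss x +
     2 * sqrt (cut_loss x +
       (\<Sum>z\<in>S - {x}. of_bool (h z div M = h x div M) * hit z x))"
      by (simp only: R_gram[OF x])
  qed
  show ?thesis unfolding bob_bound_def
    by (rule exI[of _ D], rule conjI, rule allI, rule povm, rule sum_mono, erule step)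
qed

text \<open>Concavity of the square root is applied twice, over the hash function and over
  \<open>x\<close>, to bring both averages inside. A competitor falls into the same bin with
  probability \<open>1 / B\<close>, which divides the total overlap \<tau> / \<theta> by
  \<open>B\<close>.\<close>

lemma bob_bound_mean:
  assumes BM: "0 < B" "0 < M"
  shows "hash_mean S (B * M) (bob_bound M) \<le> avg_tail (\<lambda>t. \<tau> < t) +
    2 * sqrt (2 * joint_tail (\<lambda>t. t < \<theta>) + 2 * avg_tail (\<lambda>t. \<tau> < t) + \<tau> / \<theta> / B)"
proof -
  have N: "0 < B * M" using BM by simp
  let ?a = "\<lambda>x. avg_loss x"
  let ?b = "\<lambda>x. cut_loss x"
  let ?c = "\<lambda>z x. hit z x"
  let ?s = "\<lambda>x h. ?b x + (\<Sum>z\<in>S - {x}. of_bool (h z div M = h x div M) * ?c z x)"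
  have s0: "0 \<le> ?s x h" for x h by (intro add_nonneg_nonneg sum_nonneg) auto
  have smean: "hash_mean S (B * M) (?s x) \<le> ?b x + (\<Sum>z\<in>S. ?c z x) / B" if x: "x \<in> S" for x
  proof -
    have "hash_mean S (B * M) (?s x) = ?b x + (\<Sum>z\<in>S - {x}. ?c z x * hash_mean S (B * M) (\<lambda>h. of_bool (h z div M = h x div M)))"
      unfolding hash_mean_add hash_mean_const[OF finite_S N] hash_mean_sum
      by (simp only: mult.commute[of "of_bool _"] hash_mean_cmult)
    also have "\<dots> = ?b x + (\<Sum>z\<in>S - {x}. ?c z x * (1 / B))"
      using hash_mean_collision[OF finite_S x _ _ BM] by (intro arg_cong2[of _ _ _ _ "(+)"] sum.cong refl) auto
    also have "\<dots> \<le> ?b x + (\<Sum>z\<in>S. ?c z x * (1 / B))"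
      using finite_S by (intro add_left_mono sum_mono2) auto
    finally show ?thesis by (simp add: sum_divide_distrib)
  qed
  have "hash_mean S (B * M) (bob_bound M)
     = (\<Sum>x\<in>S. p x * (?a x + 2 * hash_mean S (B * M) (\<lambda>h. sqrt (?s x h))))"
    unfolding bob_bound_def hash_mean_sum hash_mean_cmult hash_mean_add hash_mean_const[OF finite_S N] ..
  also have "\<dots> \<le> (\<Sum>x\<in>S. p x * (?a x + 2 * sqrt (?b x + (\<Sum>z\<in>S. ?c z x) / B)))"
  proof (intro sum_mono mult_left_mono p_nonneg add_left_mono)
    fix x assume x: "x \<in> S"
    have "hash_mean S (B * M) (\<lambda>h. sqrt (?s x h)) \<le> sqrt (hash_mean S (B * M) (?s x))"
      by (rule hash_mean_sqrt_le[OF finite_S N s0])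
    also have "\<dots> \<le> sqrt (?b x + (\<Sum>z\<in>S. ?c z x) / B)" using smean[OF x] by simp
    finally show "hash_mean S (B * M) (\<lambda>h. sqrt (?s x h)) \<le> sqrt (?b x + (\<Sum>z\<in>S. ?c z x) / B)" .
  qed simp
  also have "\<dots> = (\<Sum>x\<in>S. p x * ?a x) + 2 * (\<Sum>x\<in>S. p x * sqrt (?b x + (\<Sum>z\<in>S. ?c z x) / B))"
    by (simp add: distrib_left sum.distrib sum_distrib_left mult.left_commute[of _ 2])
  also have "(\<Sum>x\<in>S. p x * sqrt (?b x + (\<Sum>z\<in>S. ?c z x) / B)) \<le> sqrt (\<Sum>x\<in>S. p x * (?b x + (\<Sum>z\<in>S. ?c z x) / B))"
    using finite_S p_nonneg p_sum by (intro weighted_sqrt_le) (auto intro!: add_nonneg_nonneg divide_nonneg_nonneg sum_nonneg)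
  also have "(\<Sum>x\<in>S. p x * (?b x + (\<Sum>z\<in>S. ?c z x) / B)) = (\<Sum>x\<in>S. p x * ?b x) + (\<Sum>x\<in>S. p x * (\<Sum>z\<in>S. ?c z x)) / B"
    by (simp add: distrib_left sum.distrib sum_divide_distrib[symmetric])
  also have "sqrt \<dots> \<le> sqrt (2 * joint_tail (\<lambda>t. t < \<theta>) + 2 * avg_tail (\<lambda>t. \<tau> < t) + \<tau> / \<theta> / B)"
    using bob_cond_avg_loss bob_overlap by (intro real_sqrt_le_mono add_mono divide_right_mono) auto
  finally show ?thesis by (simp add: bob_loss)
qed

end

subsection \<open>Eve\<close>

context
  fixes \<tau> \<theta> :: real
  assumes \<tau>: "0 < \<tau>" and \<theta>: "0 < \<theta>"
begin

text \<open>The cuts are opposite to Bob's: the averaged spectrum from below, which bounds the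
  dimension by 1 / \<tau>, and the joint spectrum from above, which bounds the purity by
  \<theta>.\<close>

definition eve_avg :: "complex mat" where "eve_avg = avg_proj {k. \<tau> \<le> f k}"
definition eve_cond :: "'a \<Rightarrow> complex mat" where "eve_cond x = cond_proj x {k. p x * e x k \<le> \<theta>}"
text \<open>The averaged projector comes last, so that all truncated states live on its
  range.\<close>

definition eve_trunc :: "'a \<Rightarrow> complex mat" where "eve_trunc x = eve_avg * (eve_cond x * R x)"

lemma eve_avg: "projector d eve_avg" unfolding eve_avg_def by (rule avg_proj)
lemma eve_cond: "x \<in> S \<Longrightarrow> projector d (eve_cond x)" unfolding eve_cond_def by (rule cond_proj)

lemma eve_cond_R: "x \<in> S \<Longrightarrow> eve_cond x * R x \<in> carrier_mat d d"
  by (rule mult_carrier_mat[OF projectorD(1)[OF eve_cond] R_carrier])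

lemma eve_trunc_carrier: "x \<in> S \<Longrightarrow> eve_trunc x \<in> carrier_mat d d"
  unfolding eve_trunc_def by (rule mult_carrier_mat[OF projectorD(1)[OF eve_avg] eve_cond_R])

lemma eve_trunc_frob: "x \<in> S \<Longrightarrow> frob (eve_trunc x) \<le> 1"
  unfolding eve_trunc_def
  using frob_projector_le[OF eve_avg eve_cond_R] frob_projector_le[OF eve_cond R_carrier] R_frob by fastforce

lemma eve_trunc_gram_carrier: "x \<in> S \<Longrightarrow> eve_trunc x * mat_adjoint (eve_trunc x) \<in> carrier_mat d d"
  using mult_carrier_mat[OF eve_trunc_carrier, of x "mat_adjoint (eve_trunc x)" d] eve_trunc_carrier[of x] by simp

text \<open>Triangle inequality through \<open>eve_avg * R x\<close>: the second difference is a
  projector applied to the conditional loss.\<close>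

lemma eve_trunc_diff:
  assumes x: "x \<in> S"
  shows "frob (R x - eve_trunc x) \<le> frob ((1\<^sub>m d - eve_avg) * R x) + frob ((1\<^sub>m d - eve_cond x) * R x)"
proof -
  note A = projectorD(1)[OF eve_avg] and Q = projectorD(1)[OF eve_cond[OF x]] and Rc = R_carrier[OF x]
  have AR: "eve_avg * R x \<in> carrier_mat d d" by (rule mult_carrier_mat[OF A Rc])
  have CR: "R x - eve_cond x * R x \<in> carrier_mat d d" by (rule minus_carrier_mat[OF eve_cond_R[OF x]])
  have "R x - eve_trunc x = (R x - eve_avg * R x) + (eve_avg * R x - eve_trunc x)"
    by (rule eq_matI) (use Rc AR eve_trunc_carrier[OF x] in auto)
  also have "eve_avg * R x - eve_trunc x = eve_avg * (R x - eve_cond x * R x)"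
    unfolding eve_trunc_def by (rule mult_minus_distrib_mat[symmetric, OF A Rc eve_cond_R[OF x]])
  finally have "frob (R x - eve_trunc x) \<le> frob (R x - eve_avg * R x) + frob (eve_avg * (R x - eve_cond x * R x))"
    using frob_add_le[OF minus_carrier_mat[OF AR, of "R x"] mult_carrier_mat[OF A CR]] by simp
  also have "frob (eve_avg * (R x - eve_cond x * R x)) \<le> frob (R x - eve_cond x * R x)"
    by (rule frob_projector_le[OF eve_avg CR])
  finally show ?thesis by (simp add: complement_mult[OF A Rc] complement_mult[OF Q Rc])
qed

lemma eve_loss: "(\<Sum>x\<in>S. p x * (frob ((1\<^sub>m d - eve_avg) * R x))\<^sup>2) = avg_tail (\<lambda>t. t < \<tau>)"
  unfolding eve_avg_def avg_proj_loss avg_tail_def by (intro sum.cong) auto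

lemma eve_cond_loss: "(\<Sum>x\<in>S. p x * (frob ((1\<^sub>m d - eve_cond x) * R x))\<^sup>2) = joint_tail (\<lambda>t. \<theta> < t)"
proof -
  have "p x * (frob ((1\<^sub>m d - eve_cond x) * R x))\<^sup>2 = (\<Sum>k | k < d \<and> \<theta> < p x * e x k. p x * e x k)"
    if "x \<in> S" for x
  proof -
    have "{k. k < d \<and> k \<notin> {k. p x * e x k \<le> \<theta>}} = {k. k < d \<and> \<theta> < p x * e x k}" by auto
    then show ?thesis unfolding eve_cond_def cond_proj_loss[OF that] by (simp add: sum_distrib_left)
  qed
  then show ?thesis by (simp add: joint_tail_def)
qed

lemma weighted_frob_le:
  assumes "\<And>x. 0 \<le> g x"
  shows "(\<Sum>x\<in>S. p x * g x) \<le> sqrt (\<Sum>x\<in>S. p x * (g x)\<^sup>2)"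
  using weighted_sqrt_le[OF finite_S p_nonneg p_sum, of "\<lambda>x. (g x)\<^sup>2"] assms by simp

lemma eve_trunc_mean:
  "(\<Sum>x\<in>S. p x * frob (R x - eve_trunc x)) \<le> sqrt (avg_tail (\<lambda>t. t < \<tau>)) + sqrt (joint_tail (\<lambda>t. \<theta> < t))"
proof -
  have "(\<Sum>x\<in>S. p x * frob (R x - eve_trunc x))
     \<le> (\<Sum>x\<in>S. p x * (frob ((1\<^sub>m d - eve_avg) * R x) + frob ((1\<^sub>m d - eve_cond x) * R x)))"
    by (intro sum_mono mult_left_mono eve_trunc_diff p_nonneg)
  also have "\<dots> = (\<Sum>x\<in>S. p x * frob ((1\<^sub>m d - eve_avg) * R x)) + (\<Sum>x\<in>S. p x * frob ((1\<^sub>m d - eve_cond x) * R x))"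
    by (simp add: distrib_left sum.distrib)
  also have "\<dots> \<le> sqrt (avg_tail (\<lambda>t. t < \<tau>)) + sqrt (joint_tail (\<lambda>t. \<theta> < t))"
    unfolding eve_loss[symmetric] eve_cond_loss[symmetric] by (intro add_mono weighted_frob_le) auto
  finally show ?thesis .
qed

lemma eve_trunc_purity:
  "(\<Sum>x\<in>S. (p x)\<^sup>2 * (frob (eve_trunc x * mat_adjoint (eve_trunc x)))\<^sup>2) \<le> \<theta>"
proof -
  have "(p x)\<^sup>2 * (frob (eve_trunc x * mat_adjoint (eve_trunc x)))\<^sup>2 \<le> \<theta> * (\<Sum>k<d. p x * e x k)" if x: "x \<in> S" for x
  proof -
    let ?Z = "eve_cond x * R x" and ?K = "{k. p x * e x k \<le> \<theta>}"
    note A = projectorD[OF eve_avg] and Ux = D(5,7)[OF x] and Zc = eve_cond_R[OF x]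
    have Zc': "mat_adjoint ?Z \<in> carrier_mat d d" using Zc by simp
    have ZZ: "?Z * mat_adjoint ?Z \<in> carrier_mat d d" by (rule mult_carrier_mat[OF Zc Zc'])
    have ZA: "mat_adjoint ?Z * eve_avg \<in> carrier_mat d d" by (rule mult_carrier_mat[OF Zc' A(1)])
    have ZZA: "?Z * mat_adjoint ?Z * eve_avg \<in> carrier_mat d d" by (rule mult_carrier_mat[OF ZZ A(1)])
    have "eve_trunc x * mat_adjoint (eve_trunc x) = eve_avg * ?Z * (mat_adjoint ?Z * eve_avg)"
      unfolding eve_trunc_def adjoint_mult[OF A(1) Zc] A(2) ..
    also have "\<dots> = eve_avg * (?Z * (mat_adjoint ?Z * eve_avg))"
      by (rule assoc_mult_mat[OF A(1) Zc ZA])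
    also have "?Z * (mat_adjoint ?Z * eve_avg) = ?Z * mat_adjoint ?Z * eve_avg"
      by (rule assoc_mult_mat[symmetric, OF Zc Zc' A(1)])
    finally have "frob (eve_trunc x * mat_adjoint (eve_trunc x)) \<le> frob (?Z * mat_adjoint ?Z * eve_avg)"
      using frob_projector_le[OF eve_avg ZZA] by simp
    \<comment> \<open>The projector on the right is brought to the left by taking adjoints.\<close>
    also have "\<dots> = frob (eve_avg * (?Z * mat_adjoint ?Z))"
      by (subst frob_adjoint[symmetric]) (simp only: adjoint_mult[OF ZZ A(1)] adjoint_mult[OF Zc Zc'] A(2) adjoint_adjoint)
    also have "\<dots> \<le> frob (?Z * mat_adjoint ?Z)" by (rule frob_projector_le[OF eve_avg ZZ])
    finally have le: "frob (eve_trunc x * mat_adjoint (eve_trunc x)) \<le> frob (?Z * mat_adjoint ?Z)" .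
    let ?g = "\<lambda>k. if k \<in> ?K then complex_of_real (sqrt (e x k)) else 0"
    have Z: "?Z = U x * mat_diag d ?g"
      unfolding eve_cond_def cond_proj_def R_def by (rule spectral_proj_sqrt_factor[OF Ux])
    have Ua: "mat_adjoint (U x) \<in> carrier_mat d d" using Ux(1) by simp
    have UD: "U x * mat_diag d g \<in> carrier_mat d d" for g :: "nat \<Rightarrow> complex"
      by (rule mult_carrier_mat[OF Ux(1) mat_diag_dim])
    have gg: "cnj (?g k) = ?g k" for k by simp
    have "?Z * mat_adjoint ?Z = U x * mat_diag d ?g * (mat_diag d ?g * mat_adjoint (U x))"
      unfolding Z adjoint_mult[OF Ux(1) mat_diag_dim] adjoint_diag gg ..
    also have "\<dots> = U x * mat_diag d ?g * mat_diag d ?g * mat_adjoint (U x)"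
      by (rule assoc_mult_mat[symmetric, OF UD mat_diag_dim Ua])
    also have "U x * mat_diag d ?g * mat_diag d ?g = U x * (mat_diag d ?g * mat_diag d ?g)"
      by (rule assoc_mult_mat[OF Ux(1) mat_diag_dim mat_diag_dim])
    finally have ZZ': "?Z * mat_adjoint ?Z = U x * mat_diag d (\<lambda>k. ?g k * ?g k) * mat_adjoint (U x)"
      by (simp only: mat_diag_diag)
    have "frob (?Z * mat_adjoint ?Z) = frob (U x * mat_diag d (\<lambda>k. ?g k * ?g k))"
      unfolding ZZ' by (rule frob_isometry_right[OF Ua _ UD]) (simp add: Ux(2))
    then have "(frob (?Z * mat_adjoint ?Z))\<^sup>2 = (\<Sum>k<d. (cmod (?g k * ?g k))\<^sup>2)"
      by (simp only: frob_unitary_diag[OF Ux])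
    also have "\<dots> = (\<Sum>k<d. if k \<in> ?K then (e x k)\<^sup>2 else 0)"
      using D(3)[OF x] by (intro sum.cong refl) (auto simp: norm_mult)
    finally have Zsq: "(frob (?Z * mat_adjoint ?Z))\<^sup>2 = (\<Sum>k<d. if k \<in> ?K then (e x k)\<^sup>2 else 0)" .
    have "(p x)\<^sup>2 * (frob (eve_trunc x * mat_adjoint (eve_trunc x)))\<^sup>2 \<le> (p x)\<^sup>2 * (frob (?Z * mat_adjoint ?Z))\<^sup>2"
      using le by (intro mult_left_mono power_mono) auto
    also have "\<dots> = (\<Sum>k<d. if p x * e x k \<le> \<theta> then (p x * e x k) * (p x * e x k) else 0)"
      unfolding Zsq sum_distrib_left by (intro sum.cong refl) (auto simp: power2_eq_square)
    also have "\<dots> \<le> (\<Sum>k<d. \<theta> * (p x * e x k))"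
      using p_nonneg D(3)[OF x] \<theta> by (intro sum_mono) (auto intro!: mult_right_mono mult_nonneg_nonneg)
    finally show ?thesis by (simp add: sum_distrib_left)
  qed
  then have "(\<Sum>x\<in>S. (p x)\<^sup>2 * (frob (eve_trunc x * mat_adjoint (eve_trunc x)))\<^sup>2) \<le> (\<Sum>x\<in>S. \<theta> * (\<Sum>k<d. p x * e x k))"
    by (rule sum_mono)
  also have "\<dots> = \<theta> * (\<Sum>x\<in>S. \<Sum>k<d. p x * e x k)" by (rule sum_distrib_left[symmetric])
  also have "\<dots> = \<theta>" by (simp only: joint_sum mult_1_right)
  finally show ?thesis .
qed

definition eve_dev :: "nat \<Rightarrow> ('a \<Rightarrow> nat) \<Rightarrow> nat \<Rightarrow> complex mat" where
  "eve_dev N = hash_state d S N p (\<lambda>x. eve_trunc x * mat_adjoint (eve_trunc x))"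

text \<open>Truncating the state of \<open>x\<close> costs twice the norm of the change, and
  \<open>x\<close> enters with total weight at most two over all cells, hence the factor four. The
  factor 1 / sqrt \<tau> bounds the norm of \<open>eve_avg\<close>, the price for passing from the
  trace norm to the Frobenius norm.\<close>

definition eve_bound :: "nat \<Rightarrow> ('a \<Rightarrow> nat) \<Rightarrow> real" where
  "eve_bound N h = 4 * (\<Sum>x\<in>S. p x * frob (R x - eve_trunc x)) + (\<Sum>j<N. frob (eve_dev N h j)) / sqrt \<tau>"

lemma eve_bound_nonneg: "0 \<le> eve_bound N h"
  unfolding eve_bound_def using p_nonneg \<tau> by (intro add_nonneg_nonneg mult_nonneg_nonneg divide_nonneg_nonneg sum_nonneg) auto

text \<open>The squared norm is the rank, and at most 1 / \<tau> eigenvalues of size at least \<tau>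
  fit into a total of one.\<close>

lemma eve_avg_frob: "frob eve_avg \<le> 1 / sqrt \<tau>"
proof -
  have "(frob eve_avg)\<^sup>2 * \<tau> = (\<Sum>k | k < d \<and> \<tau> \<le> f k. \<tau>)"
    unfolding eve_avg_def avg_proj_def frob_spectral_proj[OF DA(5,7)] by simp
  also have "\<dots> \<le> (\<Sum>k | k < d \<and> \<tau> \<le> f k. f k)" by (intro sum_mono) auto
  also have "\<dots> \<le> (\<Sum>k<d. f k)" using DA(3) by (intro sum_mono2) auto
  finally have "(frob eve_avg)\<^sup>2 \<le> 1 / \<tau>" using DA(4) \<tau> by (simp add: pos_le_divide_eq)
  then have "frob eve_avg \<le> sqrt (1 / \<tau>)" by (rule real_le_rsqrt)
  then show ?thesis by (simp add: real_sqrt_divide)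
qed

text \<open>Each cell is compared with its truncated counterpart \<open>eve_dev\<close>, and the
  pairing of the latter with a contraction is bounded by Cauchy-Schwarz against
  \<open>eve_avg\<close>.\<close>

lemma eve_secrecy:
  assumes V: "\<And>j. j < N \<Longrightarrow> contraction d (W j)" and hN: "\<And>x. x \<in> S \<Longrightarrow> h x < N" and N: "0 < N"
  shows "(\<Sum>j<N. Re (mat_trace (W j * hash_state d S N p \<omega> h j))) \<le> eve_bound N h"
proof -
  let ?T = "\<lambda>x. eve_trunc x * mat_adjoint (eve_trunc x)"
  let ?q = "\<lambda>j x. p x * (of_bool (h x = j) - 1 / real N)"
  let ?\<delta> = "\<lambda>x. frob (R x - eve_trunc x)"
  have dev: "Re (mat_trace (W j * eve_dev N h j)) \<le> frob (eve_dev N h j) / sqrt \<tau>" if j: "j < N" for j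
  proof -
    have Wc: "W j \<in> carrier_mat d d" using V[OF j] by (simp add: contraction_def)
    note A = projectorD[OF eve_avg]
    have E: "eve_dev N h j \<in> carrier_mat d d" by (simp add: eve_dev_def hash_state_def)
    have Ea: "mat_adjoint (eve_dev N h j) \<in> carrier_mat d d" using E by simp
    \<comment> \<open>The projector is absorbed by each truncated state. The trailing identity fits
      the two-sided form of \<open>mult_mat_sum\<close> below.\<close>
    have "eve_avg * ?T x * 1\<^sub>m d = ?T x" if x: "x \<in> S" for x
    proof -
      have "eve_avg * eve_trunc x = eve_avg * eve_avg * (eve_cond x * R x)"
        unfolding eve_trunc_def by (rule assoc_mult_mat[symmetric, OF A(1) A(1) eve_cond_R[OF x]])
      then have "eve_avg * eve_trunc x = eve_trunc x" by (simp only: A(3) eve_trunc_def)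
      moreover have "eve_avg * ?T x = eve_avg * eve_trunc x * mat_adjoint (eve_trunc x)"
        by (rule assoc_mult_mat[symmetric, OF A(1) eve_trunc_carrier[OF x]]) (use eve_trunc_carrier[OF x] in simp)
      ultimately show ?thesis using right_mult_one_mat[OF eve_trunc_gram_carrier[OF x]] by simp
    qed
    then have AT: "eve_avg * ?T x = ?T x" if x: "x \<in> S" for x
      using right_mult_one_mat[OF mult_carrier_mat[OF A(1) eve_trunc_gram_carrier[OF x]]] x by simp
    have one: "1\<^sub>m d \<in> carrier_mat d d" by simp
    have "eve_avg * eve_dev N h j * 1\<^sub>m d = mat_sum d (\<lambda>x. eve_avg * (complex_of_real (?q j x) \<cdot>\<^sub>m ?T x) * 1\<^sub>m d) S"
      unfolding eve_dev_def hash_state_def average_def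
      by (rule mult_mat_sum[OF A(1) one _ finite_S]) (use eve_trunc_gram_carrier in auto)
    also have "\<dots> = eve_dev N h j"
      unfolding eve_dev_def hash_state_def average_def
    proof (rule mat_sum_cong)
      fix x assume x: "x \<in> S"
      have "eve_avg * (complex_of_real (?q j x) \<cdot>\<^sub>m ?T x) = complex_of_real (?q j x) \<cdot>\<^sub>m (eve_avg * ?T x)"
        by (rule mult_smult_distrib[OF A(1) eve_trunc_gram_carrier[OF x]])
      then have "eve_avg * (complex_of_real (?q j x) \<cdot>\<^sub>m ?T x) = complex_of_real (?q j x) \<cdot>\<^sub>m ?T x"
        by (simp only: AT[OF x])
      then show "eve_avg * (complex_of_real (?q j x) \<cdot>\<^sub>m ?T x) * 1\<^sub>m d = complex_of_real (?q j x) \<cdot>\<^sub>m ?T x"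
        using right_mult_one_mat[OF smult_carrier_mat[OF eve_trunc_gram_carrier[OF x]]] by simp
    qed
    finally have "eve_avg * eve_dev N h j = eve_dev N h j"
      using right_mult_one_mat[OF mult_carrier_mat[OF A(1) E]] by simp
    then have "mat_trace (W j * eve_dev N h j) = mat_trace (W j * (eve_avg * mat_adjoint (mat_adjoint (eve_dev N h j))))"
      by simp
    then have "Re (mat_trace (W j * eve_dev N h j)) \<le> frob eve_avg * frob (mat_adjoint (eve_dev N h j))"
      using order_trans[OF complex_Re_le_cmod trace_contraction_le[OF V[OF j] A(1) Ea]] by (simp only:)
    also have "\<dots> \<le> (1 / sqrt \<tau>) * frob (eve_dev N h j)"
      unfolding frob_adjoint by (rule mult_right_mono[OF eve_avg_frob frob_nonneg])
    finally show ?thesis by simp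
  qed
  have diff: "Re (mat_trace (W j * hash_state d S N p \<omega> h j)) - Re (mat_trace (W j * eve_dev N h j))
     \<le> (\<Sum>x\<in>S. p x * (of_bool (h x = j) + 1 / real N) * (2 * ?\<delta> x))" if j: "j < N" for j
  proof -
    have Wc: "W j \<in> carrier_mat d d" using V[OF j] by (simp add: contraction_def)
    have 1: "mat_trace (W j * hash_state d S N p \<omega> h j) = (\<Sum>x\<in>S. complex_of_real (?q j x) * mat_trace (W j * \<omega> x))"
      unfolding hash_state_def by (rule trace_average[OF Wc])
    have 2: "mat_trace (W j * eve_dev N h j) = (\<Sum>x\<in>S. complex_of_real (?q j x) * mat_trace (W j * ?T x))"
    proof -
      have "mat_trace (W j * eve_dev N h j) = (\<Sum>x\<in>S. mat_trace (W j * (complex_of_real (?q j x) \<cdot>\<^sub>m ?T x)))"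
        unfolding eve_dev_def hash_state_def average_def
        by (rule trace_mult_mat_sum[OF Wc]) (use eve_trunc_gram_carrier in auto)
      also have "\<dots> = (\<Sum>x\<in>S. complex_of_real (?q j x) * mat_trace (W j * ?T x))"
      proof (rule sum.cong[OF refl])
        fix x assume "x \<in> S"
        note T = eve_trunc_gram_carrier[OF this]
        show "mat_trace (W j * (complex_of_real (?q j x) \<cdot>\<^sub>m ?T x)) = complex_of_real (?q j x) * mat_trace (W j * ?T x)"
          by (simp only: mult_smult_distrib[OF Wc T] trace_smult[OF mult_carrier_mat[OF Wc T]])
      qed
      finally show ?thesis .
    qed
    have "Re (mat_trace (W j * hash_state d S N p \<omega> h j)) - Re (mat_trace (W j * eve_dev N h j))
       = (\<Sum>x\<in>S. ?q j x * (Re (mat_trace (W j * \<omega> x)) - Re (mat_trace (W j * ?T x))))"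
      unfolding 1 2 Re_sum by (simp add: sum_subtractf[symmetric] right_diff_distrib del: times_complex.sel(1)) 
        (simp add: right_diff_distrib sum_subtractf)
    also have "\<dots> \<le> (\<Sum>x\<in>S. p x * (of_bool (h x = j) + 1 / real N) * (2 * ?\<delta> x))"
    proof (rule sum_mono)
      fix x assume x: "x \<in> S"
      have g: "\<bar>Re (mat_trace (W j * \<omega> x)) - Re (mat_trace (W j * ?T x))\<bar> \<le> 2 * ?\<delta> x"
        using gentle_contraction[OF V[OF j] R_carrier[OF x] eve_trunc_carrier[OF x] _ eve_trunc_frob[OF x]]
          R_frob[OF x] by (simp add: R_gram[OF x])
      have "?q j x * (Re (mat_trace (W j * \<omega> x)) - Re (mat_trace (W j * ?T x)))
        \<le> \<bar>?q j x\<bar> * \<bar>Re (mat_trace (W j * \<omega> x)) - Re (mat_trace (W j * ?T x))\<bar>"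
        by (simp add: abs_le_iff flip: abs_mult)
      also have "\<dots> \<le> (p x * (of_bool (h x = j) + 1 / real N)) * (2 * ?\<delta> x)"
      proof (rule mult_mono[OF _ g])
        show "\<bar>?q j x\<bar> \<le> p x * (of_bool (h x = j) + 1 / real N)"
          unfolding abs_mult abs_of_nonneg[OF p_nonneg] by (rule mult_left_mono[OF _ p_nonneg]) (rule order_trans[OF abs_triangle_ineq4], simp)
      qed (auto intro!: mult_nonneg_nonneg divide_nonneg_nonneg p_nonneg)
      finally show "?q j x * (Re (mat_trace (W j * \<omega> x)) - Re (mat_trace (W j * ?T x)))
        \<le> p x * (of_bool (h x = j) + 1 / real N) * (2 * ?\<delta> x)" .
    qed
    finally show ?thesis .
  qed
  have "(\<Sum>j<N. Re (mat_trace (W j * hash_state d S N p \<omega> h j)))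
     \<le> (\<Sum>j<N. (\<Sum>x\<in>S. p x * (of_bool (h x = j) + 1 / real N) * (2 * ?\<delta> x)) + frob (eve_dev N h j) / sqrt \<tau>)"
  proof (rule sum_mono)
    fix j assume "j \<in> {..<N}"
    then have "j < N" by simp
    from dev[OF this] diff[OF this]
    show "Re (mat_trace (W j * hash_state d S N p \<omega> h j))
       \<le> (\<Sum>x\<in>S. p x * (of_bool (h x = j) + 1 / real N) * (2 * ?\<delta> x)) + frob (eve_dev N h j) / sqrt \<tau>" by linarith
  qed
  also have "\<dots> = (\<Sum>x\<in>S. \<Sum>j<N. p x * (of_bool (h x = j) + 1 / real N) * (2 * ?\<delta> x)) + (\<Sum>j<N. frob (eve_dev N h j)) / sqrt \<tau>"
    unfolding sum.distrib sum_divide_distrib by (subst sum.swap) simp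
  also have "(\<Sum>x\<in>S. \<Sum>j<N. p x * (of_bool (h x = j) + 1 / real N) * (2 * ?\<delta> x)) = (\<Sum>x\<in>S. 4 * (p x * ?\<delta> x))"
  proof (rule sum.cong[OF refl])
    fix x assume x: "x \<in> S"
    \<comment> \<open>The indicators sum to one over the cells, and so do the uniform
      shares.\<close>
    have "(\<Sum>j<N. of_bool (h x = j) + 1 / real N) = (\<Sum>j<N. if h x = j then 1 else 0) + (\<Sum>j<N. 1 / real N)"
      unfolding sum.distrib by (intro arg_cong2[of _ _ _ _ "(+)"] sum.cong refl) auto
    also have "\<dots> = 2" using hN[OF x] N by (simp only: sum.delta' finite_lessThan) simp
    finally have two: "(\<Sum>j<N. of_bool (h x = j) + 1 / real N) = 2" .
    have "(\<Sum>j<N. p x * (of_bool (h x = j) + 1 / real N) * (2 * ?\<delta> x))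
        = p x * (\<Sum>j<N. of_bool (h x = j) + 1 / real N) * (2 * ?\<delta> x)"
      by (simp only: sum_distrib_left sum_distrib_right)
    then show "(\<Sum>j<N. p x * (of_bool (h x = j) + 1 / real N) * (2 * ?\<delta> x)) = 4 * (p x * ?\<delta> x)"
      by (simp only: two)
  qed
  finally show ?thesis by (simp add: eve_bound_def sum_distrib_left)
qed

text \<open>Every entry of \<open>eve_dev\<close> is a centred random sum, so
  \<open>hash_mean_variance\<close> bounds the mean squared norm of a cell by
  \<open>\<theta> / N\<close>. Jensen turns this into \<open>sqrt (\<theta> / N)\<close> per cell,
  and \<open>N\<close> cells together give \<open>sqrt (N * \<theta>)\<close>.\<close>

lemma eve_bound_mean:
  assumes N: "0 < N"
  shows "hash_mean S N (eve_bound N)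
    \<le> 4 * (sqrt (avg_tail (\<lambda>t. t < \<tau>)) + sqrt (joint_tail (\<lambda>t. \<theta> < t))) + sqrt (N * \<theta> / \<tau>)"
proof -
  let ?T = "\<lambda>x. eve_trunc x * mat_adjoint (eve_trunc x)"
  have Ec: "eve_dev N h j \<in> carrier_mat d d" for h j by (simp add: eve_dev_def hash_state_def)
  have var: "hash_mean S N (\<lambda>h. (frob (eve_dev N h j))\<^sup>2) \<le> \<theta> / N" if j: "j < N" for j
  proof -
    have "hash_mean S N (\<lambda>h. (frob (eve_dev N h j))\<^sup>2)
       = (\<Sum>a<d. \<Sum>b<d. hash_mean S N (\<lambda>h. (cmod (eve_dev N h j $$ (a, b)))\<^sup>2))"
      unfolding frob_sq[OF Ec] by (simp only: hash_mean_sum)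
    also have "\<dots> \<le> (\<Sum>a<d. \<Sum>b<d. (\<Sum>x\<in>S. (cmod (complex_of_real (p x) * ?T x $$ (a, b)))\<^sup>2) / N)"
    proof (intro sum_mono)
      fix a b assume ab: "a \<in> {..<d}" "b \<in> {..<d}"
      have "eve_dev N h j $$ (a, b) = (\<Sum>x\<in>S. complex_of_real (of_bool (h x = j) - 1 / N) * (complex_of_real (p x) * ?T x $$ (a, b)))" for h
        unfolding eve_dev_def hash_state_def using ab eve_trunc_gram_carrier
        by (subst average_entry) (auto intro!: sum.cong simp del: index_mult_mat)
      then show "hash_mean S N (\<lambda>h. (cmod (eve_dev N h j $$ (a, b)))\<^sup>2)
        \<le> (\<Sum>x\<in>S. (cmod (complex_of_real (p x) * ?T x $$ (a, b)))\<^sup>2) / N"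
        by (simp only: hash_mean_variance[OF finite_S j])
    qed
    also have "\<dots> = (\<Sum>a<d. \<Sum>b<d. \<Sum>x\<in>S. (p x)\<^sup>2 * (cmod (?T x $$ (a, b)))\<^sup>2) / N"
      by (simp add: sum_divide_distrib norm_mult power_mult_distrib del: index_mult_mat)
    also have "(\<Sum>a<d. \<Sum>b<d. \<Sum>x\<in>S. (p x)\<^sup>2 * (cmod (?T x $$ (a, b)))\<^sup>2)
       = (\<Sum>a<d. \<Sum>x\<in>S. \<Sum>b<d. (p x)\<^sup>2 * (cmod (?T x $$ (a, b)))\<^sup>2)"
      by (intro sum.cong refl sum.swap)
    also have "\<dots> = (\<Sum>x\<in>S. \<Sum>a<d. \<Sum>b<d. (p x)\<^sup>2 * (cmod (?T x $$ (a, b)))\<^sup>2)"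
      by (rule sum.swap)
    also have "\<dots> = (\<Sum>x\<in>S. (p x)\<^sup>2 * (frob (?T x))\<^sup>2)"
      by (intro sum.cong refl) (simp only: frob_sq[OF eve_trunc_gram_carrier] sum_distrib_left)
    also have "\<dots> / N \<le> \<theta> / N" using eve_trunc_purity by (rule divide_right_mono) simp
    finally show ?thesis .
  qed
  have "hash_mean S N (\<lambda>h. \<Sum>j<N. frob (eve_dev N h j)) = (\<Sum>j<N. hash_mean S N (\<lambda>h. frob (eve_dev N h j)))"
    by (rule hash_mean_sum)
  also have "\<dots> \<le> (\<Sum>j<N. sqrt (\<theta> / N))"
  proof (rule sum_mono)
    fix j assume "j \<in> {..<N}"
    then have j: "j < N" by simp
    have "hash_mean S N (\<lambda>h. frob (eve_dev N h j)) = hash_mean S N (\<lambda>h. sqrt ((frob (eve_dev N h j))\<^sup>2))" by simp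
    also have "\<dots> \<le> sqrt (hash_mean S N (\<lambda>h. (frob (eve_dev N h j))\<^sup>2))"
      by (rule hash_mean_sqrt_le[OF finite_S N]) simp
    also have "\<dots> \<le> sqrt (\<theta> / N)" using var[OF j] by simp
    finally show "hash_mean S N (\<lambda>h. frob (eve_dev N h j)) \<le> sqrt (\<theta> / N)" .
  qed
  also have "\<dots> = sqrt (real N * real N) * sqrt (\<theta> / N)" by simp
  also have "\<dots> = sqrt (real N * \<theta>)" using N by (simp only: real_sqrt_mult[symmetric]) simp
  finally have "hash_mean S N (\<lambda>h. \<Sum>j<N. frob (eve_dev N h j)) \<le> sqrt (real N * \<theta>)" .
  then have "hash_mean S N (\<lambda>h. \<Sum>j<N. frob (eve_dev N h j)) / sqrt \<tau> \<le> sqrt (real N * \<theta>) / sqrt \<tau>"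
    using \<tau> by (intro divide_right_mono) auto
  also have "\<dots> = sqrt (N * \<theta> / \<tau>)" by (rule real_sqrt_divide[symmetric])
  finally have dev: "hash_mean S N (\<lambda>h. \<Sum>j<N. frob (eve_dev N h j)) / sqrt \<tau> \<le> sqrt (N * \<theta> / \<tau>)" .
  have "hash_mean S N (eve_bound N)
     = 4 * (\<Sum>x\<in>S. p x * frob (R x - eve_trunc x)) + hash_mean S N (\<lambda>h. \<Sum>j<N. frob (eve_dev N h j)) / sqrt \<tau>"
    using hash_mean_cmult[of S N "1 / sqrt \<tau>" "\<lambda>h. \<Sum>j<N. frob (eve_dev N h j)"]
    unfolding eve_bound_def hash_mean_add hash_mean_const[OF finite_S N] by simp
  moreover have "4 * (\<Sum>x\<in>S. p x * frob (R x - eve_trunc x))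
    \<le> 4 * (sqrt (avg_tail (\<lambda>t. t < \<tau>)) + sqrt (joint_tail (\<lambda>t. \<theta> < t)))"
    using eve_trunc_mean by simp
  ultimately show ?thesis using dev by (simp only: add_mono)
qed

end

end

section \<open>Asymptotic equipartition\<close>

definition joint_entropy :: "nat \<Rightarrow> ('x::finite \<Rightarrow> real) \<Rightarrow> ('x \<Rightarrow> nat \<Rightarrow> real) \<Rightarrow> real" where
  "joint_entropy d p e = - (\<Sum>x\<in>UNIV. \<Sum>k<d. p x * e x k * log 2 (p x * e x k))"

text \<open>Variance of the log-eigenvalue when eigenvalues are drawn with their own weight; the
  constant in Chebyshev's inequality below.\<close>

definition joint_varentropy :: "nat \<Rightarrow> ('x::finite \<Rightarrow> real) \<Rightarrow> ('x \<Rightarrow> nat \<Rightarrow> real) \<Rightarrow> real" where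
  "joint_varentropy d p e = (\<Sum>x\<in>UNIV. \<Sum>k<d. p x * e x k * (log 2 (p x * e x k) + joint_entropy d p e)\<^sup>2)"

definition seq_prob :: "('x \<Rightarrow> real) \<Rightarrow> 'x list \<Rightarrow> real" where
  "seq_prob p xs = prod_list (map p xs)"

lemma seq_prob_nonneg: "(\<And>x. 0 \<le> p x) \<Longrightarrow> 0 \<le> seq_prob p xs"
  by (induction xs) (auto simp: seq_prob_def)

lemma seq_prob_sum:
  fixes p :: "'x::finite \<Rightarrow> real"
  assumes p: "(\<Sum>x\<in>UNIV. p x) = 1"
  shows "(\<Sum>xs | length xs = n. seq_prob p xs) = 1"
proof (induction n)
  case 0
  have "{xs :: 'x list. length xs = 0} = {[]}" by auto
  then show ?case by (simp add: seq_prob_def)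
next
  case (Suc n)
  have "(\<Sum>xs | length xs = Suc n. seq_prob p xs) = (\<Sum>x\<in>UNIV. \<Sum>xs | length xs = n. p x * seq_prob p xs)"
    unfolding sum_lists_Suc by (simp add: seq_prob_def)
  then show ?case using Suc p by (simp flip: sum_distrib_left)
qed

lemma joint_varentropy_nonneg:
  assumes "\<And>x. 0 \<le> p x" "\<And>x k. 0 \<le> e x k"
  shows "0 \<le> joint_varentropy d p e"
  unfolding joint_varentropy_def using assms by (intro sum_nonneg) auto

context
  fixes d :: nat and p :: "'x::finite \<Rightarrow> real" and e :: "'x \<Rightarrow> nat \<Rightarrow> real"
  assumes p: "\<And>x. 0 \<le> p x" "(\<Sum>x\<in>UNIV. p x) = 1"
    and e: "\<And>x k. 0 \<le> e x k" "\<And>x. (\<Sum>k<d. e x k) = 1"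
begin

abbreviation (input) "w \<equiv> \<lambda>xs k. seq_prob p xs * product_weight d e xs k"
abbreviation (input) "H \<equiv> joint_entropy d p e"

text \<open>Expectation of a function of the log-eigenvalue of \<open>n\<close> copies, centred at
  its mean. The function \<phi> is arbitrary so that the recursion on \<open>n\<close> can absorb
  the first copy into it.\<close>

definition log_mean :: "nat \<Rightarrow> (real \<Rightarrow> real) \<Rightarrow> real" where
  "log_mean n \<phi> = (\<Sum>xs | length xs = n. \<Sum>k<d ^ n. w xs k * \<phi> (log 2 (w xs k) + n * H))"

lemma w_nonneg: "0 \<le> w xs k"
  by (intro mult_nonneg_nonneg seq_prob_nonneg product_weight_nonneg p e)

text \<open>The weight factorises over the copies and its logarithm splits into a sum;
  \<open>sum_div_mod\<close> separates the index of the first copy from the rest.\<close>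

lemma log_mean_Suc:
  "log_mean (Suc n) \<phi> = (\<Sum>x\<in>UNIV. \<Sum>k<d. p x * e x k *
     log_mean n (\<lambda>t. \<phi> (log 2 (p x * e x k) + H + t)))"
proof -
  have split: "w (x # xs) k * \<phi> (log 2 (w (x # xs) k) + Suc n * H)
      = p x * e x (k div d ^ n) * (w xs (k mod d ^ n) *
         \<phi> (log 2 (p x * e x (k div d ^ n)) + H + (log 2 (w xs (k mod d ^ n)) + n * H)))"
    if "length xs = n" for x xs k
  proof -
    let ?a = "p x * e x (k div d ^ n)" and ?b = "w xs (k mod d ^ n)"
    have w: "w (x # xs) k = ?a * ?b" using that by (simp add: seq_prob_def)
    show ?thesis
    proof (cases "?a = 0 \<or> ?b = 0")
      \<comment> \<open>With a vanishing factor the logarithm need not split, but both sides carry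
        the weight zero.\<close>
      case True
      then show ?thesis unfolding w by auto
    next
      case False
      moreover have "0 \<le> ?a" "0 \<le> ?b" using p e w_nonneg by auto
      ultimately have "0 < ?a" "0 < ?b" by linarith+
      then have "log 2 (?a * ?b) = log 2 ?a + log 2 ?b" by (intro log_mult_pos)
      then show ?thesis unfolding w by (simp add: algebra_simps)
    qed
  qed
  have "log_mean (Suc n) \<phi> = (\<Sum>x\<in>UNIV. \<Sum>xs | length xs = n. \<Sum>k<d * d ^ n.
      w (x # xs) k * \<phi> (log 2 (w (x # xs) k) + Suc n * H))"
    unfolding log_mean_def sum_lists_Suc power_Suc ..
  also have "\<dots> = (\<Sum>x\<in>UNIV. \<Sum>xs | length xs = n. \<Sum>k<d * d ^ n.
      p x * e x (k div d ^ n) * (w xs (k mod d ^ n) *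
         \<phi> (log 2 (p x * e x (k div d ^ n)) + H + (log 2 (w xs (k mod d ^ n)) + n * H))))"
    by (intro sum.cong refl split) simp
  also have "\<dots> = (\<Sum>x\<in>UNIV. \<Sum>xs | length xs = n. \<Sum>k<d. \<Sum>l<d ^ n.
      p x * e x k * (w xs l * \<phi> (log 2 (p x * e x k) + H + (log 2 (w xs l) + n * H))))"
    by (intro sum.cong refl sum_div_mod)
  also have "\<dots> = (\<Sum>x\<in>UNIV. \<Sum>k<d. \<Sum>xs | length xs = n. \<Sum>l<d ^ n.
      p x * e x k * (w xs l * \<phi> (log 2 (p x * e x k) + H + (log 2 (w xs l) + n * H))))"
    by (rule sum.cong[OF refl]) (rule sum.swap)
  also have "\<dots> = (\<Sum>x\<in>UNIV. \<Sum>k<d. p x * e x k *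
     log_mean n (\<lambda>t. \<phi> (log 2 (p x * e x k) + H + t)))"
    unfolding log_mean_def sum_distrib_left ..
  finally show ?thesis .
qed

lemma log_mean_add: "log_mean n (\<lambda>t. \<phi> t + \<psi> t) = log_mean n \<phi> + log_mean n \<psi>"
  by (simp add: log_mean_def distrib_left sum.distrib)

lemma log_mean_cmult: "log_mean n (\<lambda>t. c * \<phi> t) = c * log_mean n \<phi>"
  by (simp add: log_mean_def sum_distrib_left mult.left_commute)

lemma joint_one: "(\<Sum>x\<in>UNIV. \<Sum>k<d. p x * e x k) = 1"
  by (simp add: e(2) p(2) flip: sum_distrib_left)

lemma joint_mean: "(\<Sum>x\<in>UNIV. \<Sum>k<d. p x * e x k * (log 2 (p x * e x k) + H)) = 0"
proof -
  have "(\<Sum>x\<in>UNIV. \<Sum>k<d. p x * e x k * (log 2 (p x * e x k) + H))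
     = (\<Sum>x\<in>UNIV. \<Sum>k<d. p x * e x k * log 2 (p x * e x k)) + (\<Sum>x\<in>UNIV. \<Sum>k<d. p x * e x k) * H"
    by (simp only: distrib_left sum.distrib sum_distrib_right)
  then show ?thesis by (simp only: joint_one) (simp add: joint_entropy_def)
qed

lemma log_mean_one: "log_mean n (\<lambda>t. 1) = 1"
proof (induction n)
  case 0
  have "{xs :: 'x list. length xs = 0} = {[]}" by auto
  then show ?case by (simp add: log_mean_def seq_prob_def)
next
  case (Suc n)
  then show ?case by (simp add: log_mean_Suc joint_one)
qed

lemma log_mean_id: "log_mean n (\<lambda>t. t) = 0"
proof (induction n)
  case 0
  have "{xs :: 'x list. length xs = 0} = {[]}" by auto
  then show ?case by (simp add: log_mean_def seq_prob_def)
next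
  case (Suc n)
  have "log_mean n (\<lambda>t. a + t) = a" for a
    using log_mean_add[of n "\<lambda>t. a * 1" "\<lambda>t. t"] Suc log_mean_one log_mean_cmult[of n a "\<lambda>t. 1"] by simp
  then show ?case by (simp add: log_mean_Suc joint_mean)
qed

text \<open>Variances of independent copies add: the mixed term in the square vanishes because the
  centred mean is zero.\<close>

lemma log_mean_sq: "log_mean n (\<lambda>t. t\<^sup>2) = n * joint_varentropy d p e"
proof (induction n)
  case 0
  have "{xs :: 'x list. length xs = 0} = {[]}" by auto
  then show ?case by (simp add: log_mean_def seq_prob_def)
next
  case (Suc n)
  have "log_mean n (\<lambda>t. (a + t)\<^sup>2) = a\<^sup>2 + n * joint_varentropy d p e" for a
  proof -
    have "(\<lambda>t. (a + t)\<^sup>2) = (\<lambda>t. a\<^sup>2 * 1 + ((2 * a) * t + t\<^sup>2))"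
      by (auto simp: power2_sum)
    then show ?thesis by (simp only: log_mean_add log_mean_cmult log_mean_one log_mean_id Suc)
  qed
  then have "log_mean (Suc n) (\<lambda>t. t\<^sup>2) = (\<Sum>x\<in>UNIV. \<Sum>k<d. p x * e x k *
     ((log 2 (p x * e x k) + H)\<^sup>2 + n * joint_varentropy d p e))"
    by (simp add: log_mean_Suc)
  also have "\<dots> = joint_varentropy d p e + (\<Sum>x\<in>UNIV. \<Sum>k<d. p x * e x k) * (n * joint_varentropy d p e)"
    unfolding joint_varentropy_def[of d p e, THEN arg_cong[of _ _ "\<lambda>v. v + _"]]
    by (simp only: distrib_left sum.distrib sum_distrib_right)
  finally show ?case by (simp only: joint_one) (simp add: algebra_simps)
qed

text \<open>Chebyshev's inequality. The hypothesis on \<open>Z\<close> concerns positive weights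
  only, as a weight of zero contributes nothing to the tail.\<close>

lemma chebyshev_tail:
  assumes n: "0 < n" and \<delta>: "0 < \<delta>"
    and Z: "\<And>t. 0 < t \<Longrightarrow> Z t \<Longrightarrow> n * \<delta> \<le> \<bar>log 2 t + n * H\<bar>"
  shows "(\<Sum>xs | length xs = n. \<Sum>k | k < d ^ n \<and> Z (w xs k). w xs k) \<le> joint_varentropy d p e / \<delta>\<^sup>2 / n"
proof -
  have "(\<Sum>xs | length xs = n. \<Sum>k | k < d ^ n \<and> Z (w xs k). w xs k)
     \<le> (\<Sum>xs | length xs = n. \<Sum>k<d ^ n. w xs k * (log 2 (w xs k) + n * H)\<^sup>2 / (n * \<delta>)\<^sup>2)"
  proof (rule sum_mono)
    fix xs :: "'x list"
    have "(\<Sum>k | k < d ^ n \<and> Z (w xs k). w xs k)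
       \<le> (\<Sum>k | k < d ^ n \<and> Z (w xs k). w xs k * (log 2 (w xs k) + n * H)\<^sup>2 / (n * \<delta>)\<^sup>2)"
    proof (rule sum_mono)
      fix k assume k: "k \<in> {k. k < d ^ n \<and> Z (w xs k)}"
      show "w xs k \<le> w xs k * (log 2 (w xs k) + n * H)\<^sup>2 / (n * \<delta>)\<^sup>2"
      proof (cases "w xs k = 0")
        case False
        then have "0 < w xs k" using w_nonneg[of xs k] by linarith
        then have "(n * \<delta>) \<le> \<bar>log 2 (w xs k) + n * H\<bar>" using Z k by blast
        then have "(n * \<delta>)\<^sup>2 \<le> (log 2 (w xs k) + n * H)\<^sup>2"
          using n \<delta> by (simp add: abs_le_square_iff[symmetric])
        then have "w xs k * (n * \<delta>)\<^sup>2 \<le> w xs k * (log 2 (w xs k) + n * H)\<^sup>2"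
          by (rule mult_left_mono[OF _ w_nonneg])
        moreover have "0 < (n * \<delta>)\<^sup>2" using n \<delta> by simp
        ultimately show ?thesis by (simp only: pos_le_divide_eq)
      qed (simp only: mult_zero_left div_0 order_refl)
    qed
    also have "\<dots> \<le> (\<Sum>k<d ^ n. w xs k * (log 2 (w xs k) + n * H)\<^sup>2 / (n * \<delta>)\<^sup>2)"
      by (rule sum_mono2) (auto intro!: divide_nonneg_nonneg mult_nonneg_nonneg seq_prob_nonneg product_weight_nonneg p e)
    finally show "(\<Sum>k | k < d ^ n \<and> Z (w xs k). w xs k)
       \<le> (\<Sum>k<d ^ n. w xs k * (log 2 (w xs k) + n * H)\<^sup>2 / (n * \<delta>)\<^sup>2)" .
  qed
  also have "\<dots> = log_mean n (\<lambda>t. t\<^sup>2) / (n * \<delta>)\<^sup>2"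
    unfolding log_mean_def sum_divide_distrib ..
  also have "\<dots> = joint_varentropy d p e / \<delta>\<^sup>2 / n"
    unfolding log_mean_sq using n \<delta> by (simp add: power2_eq_square field_simps)
  finally show ?thesis .
qed

lemma aep_small:
  assumes n: "0 < n" and \<delta>: "0 < \<delta>"
  shows "(\<Sum>xs | length xs = n. \<Sum>k | k < d ^ n \<and> w xs k < 2 powr (- real n * (H + \<delta>)). w xs k)
     \<le> joint_varentropy d p e / \<delta>\<^sup>2 / n"
proof (rule chebyshev_tail[of n \<delta> "\<lambda>t. t < 2 powr (- real n * (H + \<delta>))", OF assms])
  fix t :: real assume t: "0 < t" "t < 2 powr (- real n * (H + \<delta>))"
  then have "log 2 t < log 2 (2 powr (- real n * (H + \<delta>)))" by (subst log_less_cancel_iff) auto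
  then have "log 2 t + n * H < - (n * \<delta>)" by (simp add: algebra_simps)
  then show "n * \<delta> \<le> \<bar>log 2 t + n * H\<bar>" by linarith
qed

lemma aep_large:
  assumes n: "0 < n" and \<delta>: "0 < \<delta>"
  shows "(\<Sum>xs | length xs = n. \<Sum>k | k < d ^ n \<and> 2 powr (- real n * (H - \<delta>)) < w xs k. w xs k)
     \<le> joint_varentropy d p e / \<delta>\<^sup>2 / n"
proof (rule chebyshev_tail[of n \<delta> "\<lambda>t. 2 powr (- real n * (H - \<delta>)) < t", OF assms])
  fix t :: real assume t: "0 < t" "2 powr (- real n * (H - \<delta>)) < t"
  then have "log 2 (2 powr (- real n * (H - \<delta>))) < log 2 t" by (subst log_less_cancel_iff) auto
  then have "n * \<delta> < log 2 t + n * H" by (simp add: algebra_simps)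
  then show "n * \<delta> \<le> \<bar>log 2 t + n * H\<bar>" by linarith
qed

end

lemma joint_entropy_eq:
  fixes p :: "'x::finite \<Rightarrow> real"
  assumes "\<And>x. 0 \<le> p x" "\<And>x k. 0 \<le> e x k" "\<And>x. (\<Sum>k<d. e x k) = 1"
  shows "joint_entropy d p e = - (\<Sum>x\<in>UNIV. p x * log 2 (p x)) - (\<Sum>x\<in>UNIV. p x * (\<Sum>k<d. e x k * log 2 (e x k)))"
proof -
  have split: "p x * e x k * log 2 (p x * e x k) = e x k * (p x * log 2 (p x)) + p x * (e x k * log 2 (e x k))" for x k
  proof (cases "p x = 0 \<or> e x k = 0")
    case False
    then have "0 < p x" "0 < e x k" using assms(1)[of x] assms(2)[of x k] by auto
    then show ?thesis by (simp add: log_mult algebra_simps)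
  qed auto
  have "(\<Sum>k<d. p x * e x k * log 2 (p x * e x k)) = p x * log 2 (p x) + p x * (\<Sum>k<d. e x k * log 2 (e x k))" for x
    unfolding split sum.distrib sum_distrib_left[symmetric] sum_distrib_right[symmetric] assms(3) by simp
  then show ?thesis by (simp add: joint_entropy_def sum.distrib)
qed

lemma pmf_replicate:
  fixes P :: "'x::finite pmf"
  shows "pmf (replicate_pmf (length xs) P) xs = seq_prob (pmf P) xs"
proof (induction xs)
  case Nil
  then show ?case by (simp add: seq_prob_def)
next
  case (Cons x xs)
  have "replicate_pmf (Suc n) P = map_pmf (\<lambda>(x, xs). x # xs) (pair_pmf P (replicate_pmf n P))" for n
    by (simp add: map_pmf_def pair_pmf_def bind_assoc_pmf bind_return_pmf)
  then have "pmf (replicate_pmf (Suc (length xs)) P) (x # xs)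
      = pmf (map_pmf (\<lambda>(x, xs). x # xs) (pair_pmf P (replicate_pmf (length xs) P))) ((\<lambda>(x, xs). x # xs) (x, xs))"
    by simp
  also have "\<dots> = pmf (pair_pmf P (replicate_pmf (length xs) P)) (x, xs)"
    by (rule pmf_map_inj') (auto simp: inj_def)
  finally show ?case using Cons by (simp add: pmf_pair seq_prob_def)
qed

section \<open>The protocol\<close>

lemma measure_bind_pmf_eq: "measure (measure_pmf (bind_pmf M f)) X = (\<integral>x. measure (measure_pmf (f x)) X \<partial>measure_pmf M)"
proof -
  have "ennreal (measure (measure_pmf (bind_pmf M f)) X) = (\<integral>\<^sup>+x. ennreal (measure (measure_pmf (f x)) X) \<partial>measure_pmf M)"
    using emeasure_bind_pmf[of M f X] by (simp only: measure_pmf.emeasure_eq_measure)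
  also have "\<dots> = ennreal (\<integral>x. measure (measure_pmf (f x)) X \<partial>measure_pmf M)"
    by (intro nn_integral_eq_integral measure_pmf.integrable_const_bound[of _ 1]) auto
  finally show ?thesis by (simp add: integral_nonneg_AE)
qed

text \<open>\<open>embed_pmf\<close> has the intended values only for a probability vector:
  nonnegativity holds since the state is a Gram matrix, and the total is the trace of the state
  since the POVM sums to the identity.\<close>

lemma pmf_measure_outcome:
  assumes D: "povm d M D" and dec: "density_decomp d \<sigma> U e"
  shows "pmf (measure_outcome M D \<sigma>) m = (if m < M then Re (mat_trace (D m * \<sigma>)) else 0)"
proof -
  let ?f = "\<lambda>m. if m < M then Re (mat_trace (D m * \<sigma>)) else 0"
  have psd: "psd d (D m)" if "m < M" for m using D that by (simp add: povm_def)
  have Dc: "D m \<in> carrier_mat d d" if "m \<in> {..<M}" for m using psd[of m] that by (simp add: psd_def)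
  have \<sigma>: "\<sigma> \<in> carrier_mat d d" by (rule density_decompD(1)[OF dec])
  note R = sqrt_factor_carrier[OF density_decompD(5)[OF dec], of e]
  have nonneg: "0 \<le> ?f m" for m
    using trace_psd_gram[OF psd R] by (simp add: sqrt_factor_gram[OF dec])
  have tr: "mat_trace \<sigma> = 1"
    using spectral_trace[OF \<sigma> density_decompD(2)[OF dec]] density_decompD(4)[OF dec] by simp
  have "(\<Sum>m<M. mat_trace (\<sigma> * D m)) = mat_trace (\<sigma> * mat_sum d D {..<M})"
    by (rule trace_mult_mat_sum[OF \<sigma> Dc, symmetric])
  also have "\<dots> = 1" using D tr right_mult_one_mat[OF \<sigma>] by (simp add: povm_def)
  finally have "(\<Sum>m<M. Re (mat_trace (\<sigma> * D m))) = 1"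
    by (metis Re_sum one_complex.sel(1))
  then have sum1: "(\<Sum>m<M. ?f m) = 1"
    using trace_comm[OF \<sigma> Dc] by simp
  have "(\<integral>\<^sup>+m. ennreal (?f m) \<partial>count_space UNIV) = (\<Sum>m<M. ennreal (?f m))"
    by (rule nn_integral_count_space') auto
  also have "\<dots> = ennreal (\<Sum>m<M. ?f m)" by (rule sum_ennreal) (rule nonneg)
  also have "\<dots> = 1" by (simp only: sum1 ennreal_1)
  finally show ?thesis
    unfolding measure_outcome_def by (intro pmf_embed_pmf nonneg)
qed

text \<open>Subtraction modulo \<open>M\<close>; adding \<open>M\<close> first avoids truncation on
  \<open>nat\<close>.\<close>

definition shift_back :: "nat \<Rightarrow> nat \<Rightarrow> nat \<Rightarrow> nat" where
  "shift_back M m s = (m + M - s) mod M"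

lemma shift_back_less: "0 < M \<Longrightarrow> shift_back M m s < M"
  by (simp add: shift_back_def)

lemma shift_back_add:
  assumes "k < M" "s < M"
  shows "shift_back M ((k + s) mod M) s = k"
proof (cases "k + s < M")
  case True
  then show ?thesis using assms by (simp add: shift_back_def)
next
  case False
  then have "(k + s) mod M = k + s - M" using assms by (simp add: mod_if)
  then show ?thesis using assms False by (simp add: shift_back_def)
qed

lemma add_shift_back:
  assumes "m < M" "s < M"
  shows "(shift_back M m s + s) mod M = m"
proof -
  have "(shift_back M m s + s) mod M = (m + M - s + s) mod M"
    unfolding shift_back_def by (rule mod_add_left_eq)
  then show ?thesis using assms by simp
qed

lemma shift_back_eq_iff:
  assumes "m < M" "s < M" "k < M"
  shows "(k + s) mod M = m \<longleftrightarrow> s = shift_back M m k"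
  using shift_back_add[of s M k] add_shift_back[of m M k] assms by (auto simp: add.commute)

lemma sum_shift:
  assumes "m < M" "k < M"
  shows "(\<Sum>s<M. of_bool ((k + s) mod M = m \<and> Q s)) = (of_bool (Q (shift_back M m k)) :: real)"
proof -
  have "(\<Sum>s<M. of_bool ((k + s) mod M = m \<and> Q s)) = (\<Sum>s<M. if s = shift_back M m k then of_bool (Q s) else 0 :: real)"
    using assms by (intro sum.cong refl) (auto simp: shift_back_eq_iff)
  then show ?thesis using assms by (simp add: shift_back_less)
qed

text \<open>The announced message consists of the bin \<open>h xs div M\<close> and a uniform shift \<open>s\<close>, which makes the
  key uniform and independent of \<open>xs\<close>.\<close>

definition hash_protocol :: "nat \<Rightarrow> ('a \<Rightarrow> nat) \<Rightarrow> 'a \<Rightarrow> (nat \<times> nat) pmf" where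
  "hash_protocol M h xs = map_pmf (\<lambda>s. (h xs div M * M + s, (h xs mod M + s) mod M)) (pmf_of_set {..<M})"

text \<open>Bob runs the decoder of the bin \<open>l div M\<close> and adds the announced shift
  \<open>l mod M\<close> to its outcome; the key \<open>m\<close> therefore belongs to the
  shifted-back outcome.\<close>

definition shifted_povm :: "nat \<Rightarrow> (nat \<Rightarrow> nat \<Rightarrow> complex mat) \<Rightarrow> nat \<Rightarrow> nat \<Rightarrow> complex mat" where
  "shifted_povm M D l m = D (l div M) (shift_back M m (l mod M))"

text \<open>The message announced if the hash value is \<open>j\<close> and the key is \<open>m\<close>.\<close>

definition message :: "nat \<Rightarrow> nat \<Rightarrow> nat \<Rightarrow> nat" where
  "message M m j = j div M * M + shift_back M m (j mod M)"

text \<open>Within a bin this is the reflection that takes a residue to \<open>m\<close> minus it.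
  Since it permutes all messages, one bound over all hash cells serves every key value
  \<open>m\<close>.\<close>

lemma message_involution:
  assumes "0 < M" "m < M"
  shows "message M m (message M m j) = j"
proof -
  have "shift_back M m (shift_back M m (j mod M)) = j mod M"
    using shift_back_eq_iff[of m M "j mod M" "shift_back M m (j mod M)"] add_shift_back[of m M "j mod M"]
      shift_back_less[of M m] assms by auto
  then show ?thesis using assms shift_back_less[of M m "j mod M"] by (simp add: message_def)
qed

lemma block_index_less:
  assumes "b < B" "s < (M :: nat)"
  shows "b * M + s < B * M"
proof -
  have "b * M + s < Suc b * M" using assms by simp
  also have "\<dots> \<le> B * M" using assms by (intro mult_right_mono) auto
  finally show ?thesis .
qed

lemma message_less:
  assumes "0 < M" "j < B * M"
  shows "message M m j < B * M"
  unfolding message_def using div_mod_bounds[OF assms(2)] shift_back_less[OF assms(1)]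
  by (intro block_index_less)

lemma shifted_povm:
  assumes D: "\<And>b. povm d M (D b)" and M: "0 < M"
  shows "povm d M (shifted_povm M D l)"
proof -
  let ?s = "l mod M" and ?D = "D (l div M)"
  have s: "?s < M" using M by simp
  have "mat_sum d (\<lambda>m. ?D (shift_back M m ?s)) {..<M} = mat_sum d ?D {..<M}"
  proof (rule eq_matI)
    fix i j assume "i < dim_row (mat_sum d ?D {..<M})" "j < dim_col (mat_sum d ?D {..<M})"
    moreover have "(\<Sum>m<M. ?D (shift_back M m ?s) $$ (i, j)) = (\<Sum>m<M. ?D m $$ (i, j))"
      by (rule sum.reindex_bij_witness[of _ "\<lambda>m. (m + ?s) mod M" "\<lambda>m. shift_back M m ?s"])
        (use s M in \<open>auto simp: shift_back_add add_shift_back shift_back_less\<close>)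
    ultimately show "mat_sum d (\<lambda>m. ?D (shift_back M m ?s)) {..<M} $$ (i, j) = mat_sum d ?D {..<M} $$ (i, j)"
      by simp
  qed auto
  moreover have "shifted_povm M D l = (\<lambda>m. ?D (shift_back M m ?s))"
    by (rule ext) (simp add: shifted_povm_def)
  ultimately show ?thesis
    using D[of "l div M"] M by (auto simp: povm_def shift_back_less)
qed

lemma one_way_hash_protocol:
  assumes "\<And>b. povm (dB ^ n) M (D b)" "0 < M" "\<And>xs. length xs = n \<Longrightarrow> h xs < B * M"
  shows "one_way_protocol dB n (B * M) M (hash_protocol M h) (shifted_povm M D)"
proof -
  have "set_pmf (hash_protocol M h xs) \<subseteq> {..<B * M} \<times> {..<M}" if "length xs = n" for xs
    unfolding hash_protocol_def set_map_pmf
    using assms(2) div_mod_bounds[OF assms(3)[OF that]] by (auto simp: set_pmf_of_set lessThan_empty_iff intro: block_index_less)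
  then show ?thesis using shifted_povm[OF assms(1,2)] by (auto simp: one_way_protocol_def)
qed

context
  fixes P :: "'x::finite pmf" and \<beta> :: "'x \<Rightarrow> complex mat" and n M :: nat
    and h :: "'x list \<Rightarrow> nat" and D :: "nat \<Rightarrow> nat \<Rightarrow> complex mat"
  assumes M: "0 < M"
begin

abbreviation (input) "J \<equiv> protocol_law P \<beta> n M (hash_protocol M h) (shifted_povm M D)"

abbreviation (input) "outcome xs s \<equiv> measure_outcome M (shifted_povm M D (h xs div M * M + s)) (product_state \<beta> xs)"

lemma protocol_law_prob:
  "measure (measure_pmf J) X = (\<Sum>xs | length xs = n. seq_prob (pmf P) xs *
     ((\<Sum>s<M. measure (measure_pmf (outcome xs s))
        {k'. (xs, h xs div M * M + s, (h xs mod M + s) mod M, k') \<in> X}) / real M))"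
proof -
  let ?g = "\<lambda>xs s. measure (measure_pmf (outcome xs s))
        {k'. (xs, h xs div M * M + s, (h xs mod M + s) mod M, k') \<in> X}"
  have inner: "measure (measure_pmf (hash_protocol M h xs \<bind> (\<lambda>(l, k). measure_outcome M (shifted_povm M D l) (product_state \<beta> xs)
      \<bind> (\<lambda>k'. return_pmf (xs, l, k, k'))))) X = (\<Sum>s<M. ?g xs s) / real M" for xs
    unfolding hash_protocol_def bind_map_pmf measure_bind_pmf_eq prod.case map_pmf_def[symmetric] measure_map_pmf
    using M by (subst integral_pmf_of_set) (auto simp: vimage_def lessThan_empty_iff)
  have "measure (measure_pmf J) X = (\<Sum>xs | length xs = n. (\<Sum>s<M. ?g xs s) / real M * pmf (replicate_pmf n P) xs)"
    unfolding protocol_law_def measure_bind_pmf_eq[of "replicate_pmf n P"] inner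
    by (rule integral_measure_pmf_real) (auto simp: set_replicate_pmf)
  also have "\<dots> = (\<Sum>xs | length xs = n. seq_prob (pmf P) xs * ((\<Sum>s<M. ?g xs s) / real M))"
    by (rule sum.cong[OF refl]) (auto simp: mult.commute simp flip: pmf_replicate)
  finally show ?thesis .
qed

lemma protocol_law_prob_Alice:
  "measure (measure_pmf J) {z. case z of (xs, l, k, k') \<Rightarrow> Q xs l k} = (\<Sum>xs | length xs = n. seq_prob (pmf P) xs *
     ((\<Sum>s<M. of_bool (Q xs (h xs div M * M + s) ((h xs mod M + s) mod M))) / real M))"
proof -
  have "measure (measure_pmf p) {k'. q} = of_bool q" for p :: "nat pmf" and q
    by (cases q) (auto simp: measure_pmf.prob_space)
  then show ?thesis unfolding protocol_law_prob by simp
qed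

lemma seq_prob_pmf_sum: "(\<Sum>xs | length xs = n. seq_prob (pmf P) xs) = 1"
  by (rule seq_prob_sum) (simp add: sum_pmf_eq_1)

lemma protocol_key_prob:
  assumes m: "m < M"
  shows "\<P>((xs, l, k, k') in measure_pmf J. k = m) = 1 / real M"
proof -
  have one: "(\<Sum>s<M. of_bool ((h xs mod M + s) mod M = m)) = (1 :: real)" for xs
    using sum_shift[OF m, of "h xs mod M" "\<lambda>_. True"] M by simp
  show ?thesis
    using protocol_law_prob_Alice[of "\<lambda>xs l k. k = m"]
    by (simp only: one space_measure_pmf UNIV_I simp_thms mult_1_right times_divide_eq_right
        sum_divide_distrib[symmetric] seq_prob_pmf_sum)
qed

text \<open>Exactly one shift leads from a given hash value to the key \<open>m\<close>.
  Conditioning on the key therefore leaves the law of the sequence unchanged and makes the message a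
  function of the sequence.\<close>

lemma protocol_message_prob:
  assumes m: "m < M" and xs: "length xs = n"
  shows "\<P>((ys, l', k, k') in measure_pmf J. ys = xs \<and> l' = l \<bar> k = m)
    = seq_prob (pmf P) xs * of_bool (message M m (h xs) = l)"
proof -
  have "measure (measure_pmf J) {z. case z of (ys, l', k, k') \<Rightarrow> k = m \<and> ys = xs \<and> l' = l}
     = (\<Sum>ys | length ys = n. if ys = xs then seq_prob (pmf P) xs * (of_bool (message M m (h xs) = l) / real M) else 0)"
    unfolding protocol_law_prob_Alice
  proof (rule sum.cong[OF refl])
    fix ys :: "'x list"
    have "(\<Sum>s<M. of_bool ((h ys mod M + s) mod M = m \<and> ys = xs \<and> h ys div M * M + s = l))
      = (of_bool (ys = xs \<and> message M m (h ys) = l) :: real)"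
      using sum_shift[OF m, of "h ys mod M" "\<lambda>s. ys = xs \<and> h ys div M * M + s = l"] M by (simp add: message_def)
    then show "seq_prob (pmf P) ys * ((\<Sum>s<M. of_bool ((h ys mod M + s) mod M = m \<and> ys = xs \<and> h ys div M * M + s = l)) / real M)
       = (if ys = xs then seq_prob (pmf P) xs * (of_bool (message M m (h xs) = l) / real M) else 0)" by simp
  qed
  also have "\<dots> = seq_prob (pmf P) xs * of_bool (message M m (h xs) = l) / real M"
    using xs by simp
  finally have num: "measure (measure_pmf J) {z. case z of (ys, l', k, k') \<Rightarrow> k = m \<and> ys = xs \<and> l' = l}
     = seq_prob (pmf P) xs * of_bool (message M m (h xs) = l) / real M" .
  have den: "measure (measure_pmf J) {z. case z of (ys, l', k, k') \<Rightarrow> k = m} = 1 / real M"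
    using protocol_key_prob[OF m] by simp
  have "\<P>((ys, l', k, k') in measure_pmf J. ys = xs \<and> l' = l \<bar> k = m)
    = measure (measure_pmf J) {z. case z of (ys, l', k, k') \<Rightarrow> k = m \<and> ys = xs \<and> l' = l}
      / measure (measure_pmf J) {z. case z of (ys, l', k, k') \<Rightarrow> k = m}"
    unfolding cond_prob_def by (intro arg_cong2[of _ _ _ _ "(/)"] arg_cong[of _ _ "measure (measure_pmf J)"]) auto
  then show ?thesis unfolding num den using M by simp
qed

text \<open>Alice and Bob apply the same shift, so every shift gives the error of the unshifted
  decoder.\<close>

lemma protocol_error_prob:
  assumes D: "\<And>b. povm (dB ^ n) M (D b)" and dec: "\<And>x. density_decomp dB (\<beta> x) (U x) (e x)"
  shows "\<P>((xs, l, k, k') in measure_pmf J. k \<noteq> k') = (\<Sum>xs | length xs = n. seq_prob (pmf P) xs *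
     (1 - Re (mat_trace (D (h xs div M) (h xs mod M) * product_state \<beta> xs))))"
proof -
  have "measure (measure_pmf J) {z. case z of (xs, l, k, k') \<Rightarrow> k \<noteq> k'} = (\<Sum>xs | length xs = n. seq_prob (pmf P) xs *
     (1 - Re (mat_trace (D (h xs div M) (h xs mod M) * product_state \<beta> xs))))"
    unfolding protocol_law_prob
  proof (rule sum.cong[OF refl])
    fix xs :: "'x list" assume "xs \<in> {xs. length xs = n}"
    then have xs: "length xs = n" by simp
    have dec': "density_decomp (dB ^ n) (product_state \<beta> xs) (product_state U xs) (product_weight dB e xs)"
      using product_state_decomp[OF dec, of xs] xs by simp
    have "measure (measure_pmf (outcome xs s))
        {k'. (xs, h xs div M * M + s, (h xs mod M + s) mod M, k') \<in> {z. case z of (xs, l, k, k') \<Rightarrow> k \<noteq> k'}}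
      = 1 - Re (mat_trace (D (h xs div M) (h xs mod M) * product_state \<beta> xs))" if s: "s < M" for s
    proof -
      let ?l = "h xs div M * M + s" and ?k = "(h xs mod M + s) mod M"
      let ?O = "measure_outcome M (shifted_povm M D ?l) (product_state \<beta> xs)"
      have "{k'. (xs, ?l, ?k, k') \<in> {z. case z of (xs, l, k, k') \<Rightarrow> k \<noteq> k'}} = space (measure_pmf ?O) - {?k}" by auto
      then have "measure (measure_pmf ?O) {k'. (xs, ?l, ?k, k') \<in> {z. case z of (xs, l, k, k') \<Rightarrow> k \<noteq> k'}} = 1 - pmf ?O ?k"
        using measure_pmf.prob_compl[of "{?k}" ?O] by (simp add: measure_pmf_single)
      also have "pmf ?O ?k = Re (mat_trace (shifted_povm M D ?l ?k * product_state \<beta> xs))"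
        using pmf_measure_outcome[OF shifted_povm[OF D M] dec'] M by simp
      also have "shifted_povm M D ?l ?k = D (h xs div M) (h xs mod M)"
        using s M by (simp add: shifted_povm_def shift_back_add)
      finally show ?thesis .
    qed
    then have "(\<Sum>s<M. measure (measure_pmf (outcome xs s))
        {k'. (xs, h xs div M * M + s, (h xs mod M + s) mod M, k') \<in> {z. case z of (xs, l, k, k') \<Rightarrow> k \<noteq> k'}}) / real M
      = (\<Sum>s<M. 1 - Re (mat_trace (D (h xs div M) (h xs mod M) * product_state \<beta> xs))) / real M"
      by (intro arg_cong2[of _ _ _ _ "(/)"] sum.cong refl) simp
    also have "\<dots> = 1 - Re (mat_trace (D (h xs div M) (h xs mod M) * product_state \<beta> xs))"
      using M by simp
    finally show "seq_prob (pmf P) xs * ((\<Sum>s<M. measure (measure_pmf (outcome xs s))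
        {k'. (xs, h xs div M * M + s, (h xs mod M + s) mod M, k') \<in> {z. case z of (xs, l, k, k') \<Rightarrow> k \<noteq> k'}}) / real M)
      = seq_prob (pmf P) xs * (1 - Re (mat_trace (D (h xs div M) (h xs mod M) * product_state \<beta> xs)))"
      by (rule arg_cong)
  qed
  then show ?thesis by simp
qed

end

section \<open>Block-diagonal operators and the secrecy condition\<close>

lemma ketbra_carrier: "ketbra L l \<in> carrier_mat L L"
  by (simp add: ketbra_def)

lemma kron_ketbra_entry:
  assumes C: "C \<in> carrier_mat d d" and ij: "i < L * d" "j < L * d"
  shows "kron (ketbra L l) C $$ (i, j) = (if i div d = l \<and> j div d = l then C $$ (i mod d, j mod d) else 0)"
  using div_mod_bounds[OF ij(1)] div_mod_bounds[OF ij(2)]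
  by (simp add: kron_entry[OF ketbra_carrier C ij]) (simp add: ketbra_def)

definition block :: "nat \<Rightarrow> complex mat \<Rightarrow> nat \<Rightarrow> complex mat" where
  "block d W l = mat d d (\<lambda>(a, b). W $$ (l * d + a, l * d + b))"

text \<open>Only the diagonal blocks of \<open>W\<close> meet a block-diagonal matrix.\<close>

lemma trace_block_diag:
  assumes W: "W \<in> carrier_mat (L * d) (L * d)" and C: "\<And>l. C l \<in> carrier_mat d d"
  shows "mat_trace (W * mat_sum (L * d) (\<lambda>l. kron (ketbra L l) (C l)) {..<L})
    = (\<Sum>l<L. mat_trace (block d W l * C l))"
proof -
  let ?F = "\<lambda>l. kron (ketbra L l) (C l)"
  have Fc: "?F l \<in> carrier_mat (L * d) (L * d)" for l
    by (rule kron_carrier[OF ketbra_carrier C])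
  have "mat_trace (W * ?F l) = mat_trace (block d W l * C l)" if l: "l < L" for l
  proof -
    have "mat_trace (W * ?F l) = (\<Sum>i<L * d. \<Sum>j<L * d. W $$ (i div d * d + i mod d, j div d * d + j mod d) *
       (if j div d = l \<and> i div d = l then C l $$ (j mod d, i mod d) else 0))"
      unfolding trace_mult[OF W Fc] by (intro sum.cong refl) (simp add: kron_ketbra_entry[OF C])
    also have "\<dots> = (\<Sum>a<L. \<Sum>b<d. \<Sum>j<L * d. W $$ (a * d + b, j div d * d + j mod d) *
       (if j div d = l \<and> a = l then C l $$ (j mod d, b) else 0))"
      by (rule sum_div_mod[of "\<lambda>a b. \<Sum>j<L * d. W $$ (a * d + b, j div d * d + j mod d) *
       (if j div d = l \<and> a = l then C l $$ (j mod d, b) else 0)"])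
    also have "\<dots> = (\<Sum>a<L. \<Sum>b<d. \<Sum>a'<L. \<Sum>b'<d. W $$ (a * d + b, a' * d + b') *
       (if a' = l \<and> a = l then C l $$ (b', b) else 0))"
      by (rule sum.cong[OF refl], rule sum.cong[OF refl], rule sum_div_mod)
    also have "\<dots> = (\<Sum>a<L. \<Sum>b<d. \<Sum>a'<L. \<Sum>b'<d. if a = l then if a' = l then W $$ (a * d + b, a' * d + b') * C l $$ (b', b) else 0 else 0)"
      by (intro sum.cong refl) auto
    also have "\<dots> = (\<Sum>a<L. if a = l then \<Sum>b<d. \<Sum>a'<L. if a' = l then \<Sum>b'<d. W $$ (a * d + b, a' * d + b') * C l $$ (b', b) else 0 else 0)"
      by (simp only: sum_if_const)
    also have "\<dots> = (\<Sum>b<d. \<Sum>b'<d. W $$ (l * d + b, l * d + b') * C l $$ (b', b))"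
      using l by simp
    also have "\<dots> = mat_trace (block d W l * C l)"
      using C[of l] by (subst trace_mult[of _ d d]) (auto simp: block_def)
    finally show ?thesis .
  qed
  then show ?thesis by (subst trace_mult_mat_sum[OF W Fc]) simp
qed

text \<open>Padding \<open>Y\<close> with zeros to a matrix supported on block row \<open>l\<close>
  keeps its norm, and the product with the block reappears among the entries of
  \<open>W * Z\<close>.\<close>

lemma contraction_block:
  assumes W: "contraction (L * d) W" and l: "l < L"
  shows "contraction d (block d W l)"
proof -
  have Wc: "W \<in> carrier_mat (L * d) (L * d)" using W by (simp add: contraction_def)
  have Bc: "block d W l \<in> carrier_mat d d" by (simp add: block_def)
  have dL: "d \<le> L * d" using l by (cases L) auto
  have kd: "k < L * d" if "k < d" for k using that dL by (rule less_le_trans)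
  have "frob (block d W l * Y) \<le> frob Y" if Y: "Y \<in> carrier_mat d d" for Y
  proof -
    \<comment> \<open>\<open>contraction\<close> tests square matrices, so the columns from
      \<open>d\<close> on are filled with zeros.\<close>
    define Z where "Z = mat (L * d) (L * d) (\<lambda>(i, k). if i div d = l \<and> k < d then Y $$ (i mod d, k) else 0)"
    have Z: "Z \<in> carrier_mat (L * d) (L * d)" by (simp add: Z_def)
    have WZ: "W * Z \<in> carrier_mat (L * d) (L * d)" by (rule mult_carrier_mat[OF Wc Z])
    have idx: "l * d + a < L * d" if "a < d" for a using l that by (rule block_index_less)
    have ent: "(block d W l * Y) $$ (a, k) = (W * Z) $$ (l * d + a, k)" if a: "a < d" and k: "k < d" for a k
    proof -
      have "(W * Z) $$ (l * d + a, k) = (\<Sum>i<L * d. W $$ (l * d + a, i) * Z $$ (i, k))"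
        by (rule mult_mat_entry[OF Wc Z idx[OF a] less_le_trans[OF k dL]])
      also have "\<dots> = (\<Sum>i<L * d. if i div d = l then W $$ (l * d + a, i div d * d + i mod d) * Y $$ (i mod d, k) else 0)"
        using k less_le_trans[OF k dL] by (intro sum.cong refl) (auto simp: Z_def)
      also have "\<dots> = (\<Sum>c<L. \<Sum>b<d. if c = l then W $$ (l * d + a, c * d + b) * Y $$ (b, k) else 0)"
        by (rule sum_div_mod)
      also have "\<dots> = (\<Sum>b<d. W $$ (l * d + a, l * d + b) * Y $$ (b, k))"
        using l by (simp add: sum_if_const)
      also have "\<dots> = (block d W l * Y) $$ (a, k)"
        unfolding mult_mat_entry[OF Bc Y a k] using a by (simp add: block_def)
      finally show ?thesis by simp
    qed
    have BY: "block d W l * Y \<in> carrier_mat d d" by (rule mult_carrier_mat[OF Bc Y])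
    have "(frob (block d W l * Y))\<^sup>2 = (\<Sum>a<d. \<Sum>k<d. (cmod ((W * Z) $$ (l * d + a, k)))\<^sup>2)"
      unfolding frob_sq[OF BY] by (intro sum.cong refl) (simp add: ent del: index_mult_mat)
    also have "\<dots> \<le> (\<Sum>a<d. \<Sum>k<L * d. (cmod ((W * Z) $$ (l * d + a, k)))\<^sup>2)"
      using dL by (intro sum_mono sum_mono2) auto
    also have "\<dots> \<le> (\<Sum>c<L. \<Sum>a<d. \<Sum>k<L * d. (cmod ((W * Z) $$ (c * d + a, k)))\<^sup>2)"
      by (rule member_le_sum[of l "{..<L}" "\<lambda>c. \<Sum>a<d. \<Sum>k<L * d. (cmod ((W * Z) $$ (c * d + a, k)))\<^sup>2"])
        (use l in \<open>auto intro!: sum_nonneg\<close>)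
    also have "\<dots> = (\<Sum>i<L * d. \<Sum>k<L * d. (cmod ((W * Z) $$ (i div d * d + i mod d, k)))\<^sup>2)"
      by (rule sum_div_mod[symmetric])
    also have "\<dots> = (frob (W * Z))\<^sup>2" unfolding frob_sq[OF WZ] by simp
    also have "\<dots> \<le> (frob Z)\<^sup>2" using W Z by (intro power_mono) (auto simp: contraction_def)
    also have "(frob Z)\<^sup>2 = (\<Sum>i<L * d. if i div d = l then \<Sum>k<d. (cmod (Y $$ (i mod d, k)))\<^sup>2 else 0)"
      unfolding frob_sq[OF Z]
    proof (rule sum.cong[OF refl])
      fix i assume i: "i \<in> {..<L * d}"
      have "(\<Sum>k<L * d. (cmod (Z $$ (i, k)))\<^sup>2) = (\<Sum>k<d. (cmod (Z $$ (i, k)))\<^sup>2)"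
        by (rule sum.mono_neutral_right) (use i dL in \<open>auto simp: Z_def\<close>)
      also have "\<dots> = (if i div d = l then \<Sum>k<d. (cmod (Y $$ (i mod d, k)))\<^sup>2 else 0)"
        using i by (auto simp: Z_def kd intro!: sum.cong sum.neutral)
      finally show "(\<Sum>k<L * d. (cmod (Z $$ (i, k)))\<^sup>2) = (if i div d = l then \<Sum>k<d. (cmod (Y $$ (i mod d, k)))\<^sup>2 else 0)" .
    qed
    also have "\<dots> = (\<Sum>c<L. \<Sum>b<d. if c = l then \<Sum>k<d. (cmod (Y $$ (b, k)))\<^sup>2 else 0)"
      by (rule sum_div_mod)
    also have "\<dots> = (frob Y)\<^sup>2" unfolding frob_sq[OF Y] using l by (simp add: sum_if_const)
    finally show ?thesis by (simp add: power2_le_iff_abs_le)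
  qed
  then show ?thesis using Bc by (simp add: contraction_def)
qed

text \<open>The trace norm is attained at some contraction, whose diagonal blocks are contractions
  again.\<close>

lemma trace_norm_block_diag:
  assumes C: "\<And>l. C l \<in> carrier_mat d d" and herm: "\<And>l. mat_adjoint (C l) = C l"
    and bound: "\<And>V. (\<And>l. l < L \<Longrightarrow> contraction d (V l)) \<Longrightarrow> (\<Sum>l<L. Re (mat_trace (V l * C l))) \<le> b"
  shows "trace_norm (mat_sum (L * d) (\<lambda>l. kron (ketbra L l) (C l)) {..<L}) \<le> b"
proof -
  let ?F = "\<lambda>l. kron (ketbra L l) (C l)"
  have Fc: "?F l \<in> carrier_mat (L * d) (L * d)" for l
    by (rule kron_carrier[OF ketbra_carrier C])
  have "mat_adjoint (ketbra L l) = ketbra L l" for l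
    by (rule eq_matI) (auto simp: ketbra_def)
  then have Fh: "mat_adjoint (?F l) = ?F l" for l by (simp add: kron_adjoint herm)
  have "mat_adjoint (mat_sum (L * d) ?F {..<L}) = mat_sum (L * d) ?F {..<L}"
    by (simp only: adjoint_mat_sum[OF Fc] Fh)
  then obtain W where W: "contraction (L * d) W"
    and tn: "trace_norm (mat_sum (L * d) ?F {..<L}) = Re (mat_trace (W * mat_sum (L * d) ?F {..<L}))"
    using trace_norm_hermitian[OF mat_sum_carrier] by blast
  have "trace_norm (mat_sum (L * d) ?F {..<L}) = (\<Sum>l<L. Re (mat_trace (block d W l * C l)))"
    using W unfolding tn by (subst trace_block_diag[OF _ C]) (auto simp: contraction_def)
  also have "\<dots> \<le> b" by (rule bound) (rule contraction_block[OF W])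
  finally show ?thesis .
qed

text \<open>The ideal state of the secrecy condition: with \<sigma> Eve's averaged state, the
  message is uniform and independent of her system, whatever the key.\<close>

definition uniform_message_state :: "nat \<Rightarrow> nat \<Rightarrow> complex mat \<Rightarrow> complex mat" where
  "uniform_message_state L d \<sigma> = average (L * d) (\<lambda>_. 1 / L) (\<lambda>l. kron (ketbra L l) \<sigma>) {..<L}"

lemma density_op_uniform_message:
  assumes dec: "density_decomp d \<sigma> U e" and L: "0 < L"
  shows "density_op (L * d) (uniform_message_state L d \<sigma>)"
  unfolding uniform_message_state_def
proof (rule density_op_average)
  fix l assume "l \<in> {..<L}"
  then have l: "l < L" by simp
  note \<sigma> = density_decompD(1)[OF dec]
  note R = sqrt_factor_carrier[OF density_decompD(5)[OF dec], of e]
  have Ra: "mat_adjoint (sqrt_factor d U e) \<in> carrier_mat d d" using R by simp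
  have ka: "mat_adjoint (ketbra L l) = ketbra L l" by (rule eq_matI) (auto simp: ketbra_def)
  have kk: "ketbra L l * ketbra L l = ketbra L l"
  proof (rule eq_matI)
    fix i j assume "i < dim_row (ketbra L l)" "j < dim_col (ketbra L l)"
    then have ij: "i < L" "j < L" by (auto simp: ketbra_def)
    have "(ketbra L l * ketbra L l) $$ (i, j) = (\<Sum>k<L. if k = l then (if i = l \<and> j = l then 1 else 0) else 0)"
      unfolding mult_mat_entry[OF ketbra_carrier ketbra_carrier ij]
      by (intro sum.cong refl) (use ij in \<open>auto simp: ketbra_def\<close>)
    then show "(ketbra L l * ketbra L l) $$ (i, j) = ketbra L l $$ (i, j)"
      using ij l by (simp add: ketbra_def)
  qed (auto simp: ketbra_def)
  have "kron (ketbra L l) \<sigma> = kron (ketbra L l) (sqrt_factor d U e) * mat_adjoint (kron (ketbra L l) (sqrt_factor d U e))"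
    unfolding kron_adjoint ka kron_mult[OF ketbra_carrier R ketbra_carrier Ra] kk sqrt_factor_gram[OF dec] ..
  then have psd: "psd (L * d) (kron (ketbra L l) \<sigma>)"
    using psd_gram[OF kron_carrier[OF ketbra_carrier R]] by simp
  have "mat_trace (kron (ketbra L l) \<sigma>) = (\<Sum>i<L * d. if i div d = l then \<sigma> $$ (i mod d, i mod d) else 0)"
    using kron_carrier[OF ketbra_carrier \<sigma>, of L l]
    by (auto simp: mat_trace_def kron_ketbra_entry[OF \<sigma>] intro!: sum.cong)
  also have "\<dots> = (\<Sum>c<L. \<Sum>b<d. if c = l then \<sigma> $$ (b, b) else 0)" by (rule sum_div_mod)
  also have "\<dots> = mat_trace \<sigma>" using l \<sigma> by (auto simp: sum_if_const mat_trace_def)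
  also have "\<dots> = 1"
    using spectral_trace[OF \<sigma> density_decompD(2)[OF dec]] density_decompD(4)[OF dec] by simp
  finally show "density_op (L * d) (kron (ketbra L l) \<sigma>)" using psd by (simp add: density_op_def)
qed (use L in auto)

text \<open>Given the key \<open>m\<close>, the message \<open>l\<close> means the hash value
  \<open>message M m l\<close>. Block \<open>l\<close> of Eve's state is thus the share of that hash
  cell, and subtracting the ideal state centres it.\<close>

lemma eve_state_diff:
  fixes P :: "'x::finite pmf" and \<eta> :: "'x \<Rightarrow> complex mat"
  assumes M: "0 < M" and B: "0 < B" and m: "m < M" and \<eta>: "\<And>x. \<eta> x \<in> carrier_mat dE dE"
    and h: "\<And>xs. length xs = n \<Longrightarrow> h xs < B * M"
  defines "S \<equiv> {xs :: 'x list. length xs = n}" and "p \<equiv> seq_prob (pmf P)"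
  shows "eve_state dE \<eta> n (B * M) (protocol_law P \<beta> n M (hash_protocol M h) (shifted_povm M D)) m
      - uniform_message_state (B * M) (dE ^ n) (average (dE ^ n) p (product_state \<eta>) S)
    = mat_sum (B * M * dE ^ n) (\<lambda>l. kron (ketbra (B * M) l)
        (hash_state (dE ^ n) S (B * M) p (product_state \<eta>) h (message M m l))) {..<B * M}"
    (is "?E - ?U = mat_sum _ ?F _")
proof (rule eq_matI)
  let ?L = "B * M" and ?d = "dE ^ n"
  have \<eta>c: "product_state \<eta> xs \<in> carrier_mat ?d ?d" if "xs \<in> S" for xs
    using product_state_carrier[of \<eta> dE xs] \<eta> that by (simp add: S_def)
  have avg: "average ?d q (product_state \<eta>) S \<in> carrier_mat ?d ?d" for q by simp
  have Uc: "?U \<in> carrier_mat (?L * ?d) (?L * ?d)" by (simp add: uniform_message_state_def)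
  fix i j assume "i < dim_row (mat_sum (?L * ?d) ?F {..<?L})" "j < dim_col (mat_sum (?L * ?d) ?F {..<?L})"
  then have ij: "i < ?L * ?d" "j < ?L * ?d" by auto
  note b = div_mod_bounds[OF ij(1)] div_mod_bounds[OF ij(2)]
  let ?\<eta> = "\<lambda>xs. product_state \<eta> xs $$ (i mod ?d, j mod ?d)"
  let ?on = "\<lambda>l. i div ?d = l \<and> j div ?d = l"
  have "?E $$ (i, j) = (\<Sum>(xs, l)\<in>S \<times> {..<?L}. complex_of_real (p xs * of_bool (message M m (h xs) = l)) *
      (if ?on l then ?\<eta> xs else 0))"
    unfolding eve_state_def mat_sum_entry[OF ij] S_def[symmetric]
  proof (rule sum.cong[OF refl])
    fix z assume z: "z \<in> S \<times> {..<?L}"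
    obtain xs l where zx: "z = (xs, l)" "xs \<in> S" using z by auto
    have len: "length xs = n" using zx by (simp add: S_def)
    have kc: "kron (ketbra ?L l) (product_state \<eta> xs) \<in> carrier_mat (?L * ?d) (?L * ?d)"
      by (rule kron_carrier[OF ketbra_carrier \<eta>c[OF zx(2)]])
    show "(case z of (xs, l) \<Rightarrow> complex_of_real (\<P>((ys, l', k, k') in measure_pmf (protocol_law P \<beta> n M (hash_protocol M h) (shifted_povm M D)).
            ys = xs \<and> l' = l \<bar> k = m)) \<cdot>\<^sub>m kron (ketbra ?L l) (product_state \<eta> xs)) $$ (i, j)
       = (case z of (xs, l) \<Rightarrow> complex_of_real (p xs * of_bool (message M m (h xs) = l)) * (if ?on l then ?\<eta> xs else 0))"
      using carrier_matD[OF kc] ij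
      by (simp only: zx(1) prod.case protocol_message_prob[OF M m len] p_def index_smult_mat kron_ketbra_entry[OF \<eta>c[OF zx(2)] ij])
  qed
  also have "\<dots> = (\<Sum>xs\<in>S. \<Sum>l<?L. complex_of_real (p xs * of_bool (message M m (h xs) = l)) * (if ?on l then ?\<eta> xs else 0))"
    by (rule sum.cartesian_product[symmetric])
  also have "\<dots> = (\<Sum>l<?L. \<Sum>xs\<in>S. complex_of_real (p xs * of_bool (message M m (h xs) = l)) * (if ?on l then ?\<eta> xs else 0))"
    by (rule sum.swap)
  finally have E: "?E $$ (i, j) = (\<Sum>l<?L. \<Sum>xs\<in>S. complex_of_real (p xs * of_bool (message M m (h xs) = l)) * (if ?on l then ?\<eta> xs else 0))" .
  have avg_ij: "average ?d q (product_state \<eta>) S $$ (i mod ?d, j mod ?d) = (\<Sum>xs\<in>S. complex_of_real (q xs) * ?\<eta> xs)" for q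
    by (rule average_entry[OF \<eta>c b(2,4)])
  have U: "?U $$ (i, j) = (\<Sum>l<?L. \<Sum>xs\<in>S. complex_of_real (p xs * (1 / ?L)) * (if ?on l then ?\<eta> xs else 0))"
    unfolding uniform_message_state_def
      average_entry[where \<omega> = "\<lambda>l. kron (ketbra ?L l) (average ?d p (product_state \<eta>) S)", OF kron_carrier[OF ketbra_carrier avg] ij]
      kron_ketbra_entry[OF avg ij] avg_ij
    by (intro sum.cong refl) (auto simp: avg_ij sum_divide_distrib)
  have "(?E - ?U) $$ (i, j) = ?E $$ (i, j) - ?U $$ (i, j)"
    using ij carrier_matD[OF Uc] by (intro index_minus_mat) auto
  also have "\<dots> = (\<Sum>l<?L. \<Sum>xs\<in>S. complex_of_real (p xs * (of_bool (message M m (h xs) = l) - 1 / ?L)) * (if ?on l then ?\<eta> xs else 0))"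
    unfolding E U sum_subtractf[symmetric] left_diff_distrib[symmetric] of_real_diff[symmetric] right_diff_distrib[symmetric] ..
  also have "\<dots> = (\<Sum>l<?L. if ?on l then
      (\<Sum>xs\<in>S. complex_of_real (p xs * (of_bool (h xs = message M m l) - 1 / ?L)) * ?\<eta> xs) else 0)"
  proof (rule sum.cong[OF refl])
    fix l
    have "(message M m (h xs) = l) = (h xs = message M m l)" for xs
      using message_involution[OF M m] by metis
    then show "(\<Sum>xs\<in>S. complex_of_real (p xs * (of_bool (message M m (h xs) = l) - 1 / ?L)) * (if ?on l then ?\<eta> xs else 0))
      = (if ?on l then (\<Sum>xs\<in>S. complex_of_real (p xs * (of_bool (h xs = message M m l) - 1 / ?L)) * ?\<eta> xs) else 0)"
      by (cases "?on l") auto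
  qed
  also have "\<dots> = mat_sum (?L * ?d) ?F {..<?L} $$ (i, j)"
    unfolding mat_sum_entry[OF ij] hash_state_def kron_ketbra_entry[OF avg ij]
    by (simp only: avg_ij cong: if_cong)
  finally show "(?E - ?U) $$ (i, j) = mat_sum (?L * ?d) ?F {..<?L} $$ (i, j)" .
qed (auto simp: uniform_message_state_def carrier_matD[OF average_carrier])

lemma density_decomp_psd:
  assumes "density_decomp d \<omega> U e"
  shows "psd d \<omega>"
  using psd_gram[OF sqrt_factor_carrier[OF density_decompD(5)[OF assms], of e]] unfolding sqrt_factor_gram[OF assms] .

text \<open>The secrecy hypothesis ranges over all families of contractions, so for each key
  \<open>m\<close> the blocks can be relabelled by the involution
  \<open>message M m\<close>.\<close>

lemma hash_key_protocol:
  fixes P :: "'x::finite pmf" and \<rho> :: "'x \<Rightarrow> complex mat"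
  assumes decB: "\<And>x. density_decomp dB (trace_out_E dB dE (\<rho> x)) (UB x) (eB x)"
    and decE: "\<And>x. density_decomp dE (trace_out_B dB dE (\<rho> x)) (UE x) (eE x)"
    and M: "0 < M" and B: "0 < B" and h: "\<And>xs. length xs = n \<Longrightarrow> h xs < B * M"
    and D: "\<And>b. povm (dB ^ n) M (D b)" and \<epsilon>: "0 \<le> \<epsilon>"
    and err: "(\<Sum>xs | length xs = n. seq_prob (pmf P) xs * (1 - Re (mat_trace (D (h xs div M) (h xs mod M) *
       product_state (\<lambda>x. trace_out_E dB dE (\<rho> x)) xs)))) \<le> \<epsilon>"
    and sec: "\<And>V. (\<And>j. j < B * M \<Longrightarrow> contraction (dE ^ n) (V j)) \<Longrightarrow>
      (\<Sum>j<B * M. Re (mat_trace (V j * hash_state (dE ^ n) {xs. length xs = n} (B * M) (seq_prob (pmf P))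
        (product_state (\<lambda>x. trace_out_B dB dE (\<rho> x))) h j))) \<le> \<epsilon>"
  shows "key_protocol dB dE P \<rho> n \<epsilon> (B * M) M (hash_protocol M h) (shifted_povm M D)"
proof -
  let ?\<beta> = "\<lambda>x. trace_out_E dB dE (\<rho> x)" and ?\<eta> = "\<lambda>x. trace_out_B dB dE (\<rho> x)"
  let ?S = "{xs :: 'x list. length xs = n}" and ?p = "seq_prob (pmf P)" and ?d = "dE ^ n" and ?N = "B * M"
  let ?H = "hash_state ?d ?S ?N ?p (product_state ?\<eta>) h"
  let ?avg = "average ?d ?p (product_state ?\<eta>) ?S"
  let ?\<sigma> = "uniform_message_state ?N ?d ?avg"
  have N: "0 < ?N" using M B by simp
  have dec\<eta>: "density_decomp ?d (product_state ?\<eta> xs) (product_state UE xs) (product_weight dE eE xs)" if "xs \<in> ?S" for xs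
    using product_state_decomp[of dE ?\<eta> UE eE xs, OF decE] that by simp
  have herm: "mat_adjoint (?H j) = ?H j" for j
  proof -
    have c: "product_state ?\<eta> xs \<in> carrier_mat ?d ?d" if "xs \<in> ?S" for xs
      by (rule density_decompD(1)[OF dec\<eta>[OF that]])
    have a: "mat_adjoint (product_state ?\<eta> xs) = product_state ?\<eta> xs" if "xs \<in> ?S" for xs
      by (rule psd_hermitian[OF density_decomp_psd[OF dec\<eta>[OF that]]])
    show ?thesis
      unfolding hash_state_def average_def
      by (subst adjoint_mat_sum) (auto simp: c a adjoint_smult intro!: mat_sum_cong)
  qed
  have density: "density_op (?N * ?d) ?\<sigma>"
  proof -
    have "density_op ?d ?avg"
    proof (rule density_op_average)
      fix xs assume xs: "xs \<in> ?S"
      note dd = density_decompD[OF dec\<eta>[OF xs]]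
      show "density_op ?d (product_state ?\<eta> xs)"
        using density_decomp_psd[OF dec\<eta>[OF xs]] spectral_trace[OF dd(1,2)] dd(4) by (simp add: density_op_def)
    qed (auto intro!: seq_prob_nonneg simp: seq_prob_sum sum_pmf_eq_1)
    then obtain V f where "density_decomp ?d ?avg V f" using density_op_decomp by blast
    then show ?thesis using N by (rule density_op_uniform_message)
  qed
  have secret: "trace_norm (eve_state dE ?\<eta> n ?N (protocol_law P ?\<beta> n M (hash_protocol M h) (shifted_povm M D)) m - ?\<sigma>) \<le> \<epsilon>"
    if m: "m < M" for m
  proof -
    have "eve_state dE ?\<eta> n ?N (protocol_law P ?\<beta> n M (hash_protocol M h) (shifted_povm M D)) m - ?\<sigma>
      = mat_sum (?N * ?d) (\<lambda>l. kron (ketbra ?N l) (?H (message M m l))) {..<?N}"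
      by (rule eve_state_diff[OF M B m density_decompD(1)[OF decE] h])
    moreover have "trace_norm (mat_sum (?N * ?d) (\<lambda>l. kron (ketbra ?N l) (?H (message M m l))) {..<?N}) \<le> \<epsilon>"
    proof (rule trace_norm_block_diag)
      show "?H (message M m l) \<in> carrier_mat ?d ?d" for l by (simp add: hash_state_def)
      show "mat_adjoint (?H (message M m l)) = ?H (message M m l)" for l by (rule herm)
      fix V assume V: "\<And>l. l < ?N \<Longrightarrow> contraction ?d (V l)"
      have "(\<Sum>l<?N. Re (mat_trace (V l * ?H (message M m l)))) = (\<Sum>j<?N. Re (mat_trace (V (message M m j) * ?H j)))"
        by (rule sum.reindex_bij_witness[of _ "message M m" "message M m"])
          (auto simp: message_involution[OF M m] message_less[OF M])
      also have "\<dots> \<le> \<epsilon>" by (rule sec) (rule V[OF message_less[OF M]])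
      finally show "(\<Sum>l<?N. Re (mat_trace (V l * ?H (message M m l)))) \<le> \<epsilon>" .
    qed
    ultimately show ?thesis by (simp only:)
  qed
  have uniform: "(\<Sum>m<M. \<bar>\<P>((xs, l, k, k') in measure_pmf (protocol_law P ?\<beta> n M (hash_protocol M h) (shifted_povm M D)). k = m) - 1 / real M\<bar>) \<le> \<epsilon>"
    using \<epsilon> by (subst sum.neutral) (use protocol_key_prob[OF M, of _ P ?\<beta> n h D] in auto)
  have pos: "\<P>((xs, l, k, k') in measure_pmf (protocol_law P ?\<beta> n M (hash_protocol M h) (shifted_povm M D)). k = m) > 0"
    if "m < M" for m
    unfolding protocol_key_prob[OF M that] using M by simp
  show ?thesis
    unfolding key_protocol_def Let_def
    using one_way_hash_protocol[OF D M h] protocol_error_prob[where P = P and h = h, OF M D decB] err uniform pos secret density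
    by auto
qed

section \<open>Rates\<close>

text \<open>The averaged state is the \<open>n\<close>-fold power of the one-letter average,
  expressed as a product state over a list of units so that \<open>product_weight\<close> describes
  its spectrum too.\<close>

lemma iid_cq_ensemble:
  fixes P :: "'x::finite pmf"
  assumes dec: "\<And>x. density_decomp d (\<omega> x) (U x) (e x)" and avg: "density_decomp d (average d (pmf P) \<omega> UNIV) V f"
  shows "cq_ensemble {xs. length xs = n} (seq_prob (pmf P)) (d ^ n) (product_state \<omega>) (product_state U) (product_weight d e)
    (product_state (\<lambda>_. V) (replicate n ())) (product_weight d (\<lambda>_. f) (replicate n ()))"
proof
  show "finite {xs :: 'x list. length xs = n}" by simp
  show "0 \<le> seq_prob (pmf P) xs" for xs by (intro seq_prob_nonneg) simp
  show "(\<Sum>xs | length xs = n. seq_prob (pmf P) xs) = 1" by (simp add: seq_prob_sum sum_pmf_eq_1)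
  show "density_decomp (d ^ n) (product_state \<omega> xs) (product_state U xs) (product_weight d e xs)"
    if "xs \<in> {xs. length xs = n}" for xs
    using product_state_decomp[of d \<omega> U e xs, OF dec] that by simp
  have "average (d ^ n) (seq_prob (pmf P)) (product_state \<omega>) {xs. length xs = n}
     = product_state (\<lambda>_. average d (pmf P) \<omega> UNIV) (replicate n ())"
    unfolding seq_prob_def by (rule average_product_state) (simp_all add: density_decompD(1)[OF dec])
  then show "density_decomp (d ^ n) (average (d ^ n) (seq_prob (pmf P)) (product_state \<omega>) {xs. length xs = n})
     (product_state (\<lambda>_. V) (replicate n ())) (product_weight d (\<lambda>_. f) (replicate n ()))"
    using product_state_decomp[of d "\<lambda>_. average d (pmf P) \<omega> UNIV" "\<lambda>_. V" "\<lambda>_. f" "replicate n ()", OF avg]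
    by (simp only: length_replicate)
qed

text \<open>The averaged state as a joint one over a one-letter alphabet, so that equipartition is
  proved only once.\<close>

abbreviation (input) "avg_entropy d f \<equiv> joint_entropy d (\<lambda>_ :: unit. 1) (\<lambda>_. f)"
abbreviation (input) "avg_varentropy d f \<equiv> joint_varentropy d (\<lambda>_ :: unit. 1) (\<lambda>_. f)"

lemma aep_avg:
  assumes f: "\<And>k. 0 \<le> f k" "(\<Sum>k<d. f k) = 1" and n: "0 < n" and \<delta>: "0 < \<delta>"
  defines "F \<equiv> product_weight d (\<lambda>_. f) (replicate n ())"
  shows "(\<Sum>k | k < d ^ n \<and> F k < 2 powr (- real n * (avg_entropy d f + \<delta>)). F k) \<le> avg_varentropy d f / \<delta>\<^sup>2 / n"
    and "(\<Sum>k | k < d ^ n \<and> 2 powr (- real n * (avg_entropy d f - \<delta>)) < F k. F k) \<le> avg_varentropy d f / \<delta>\<^sup>2 / n"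
proof -
  have S: "{xs :: unit list. length xs = n} = {replicate n ()}"
    by (auto intro!: nth_equalityI)
  have p: "seq_prob (\<lambda>_. 1) xs = 1" for xs :: "unit list"
    by (induction xs) (simp_all add: seq_prob_def)
  show "(\<Sum>k | k < d ^ n \<and> F k < 2 powr (- real n * (avg_entropy d f + \<delta>)). F k) \<le> avg_varentropy d f / \<delta>\<^sup>2 / n"
    using aep_small[of "\<lambda>_ :: unit. 1" "\<lambda>_. f" d n \<delta>] f n \<delta> by (simp add: S p F_def)
  show "(\<Sum>k | k < d ^ n \<and> 2 powr (- real n * (avg_entropy d f - \<delta>)) < F k. F k) \<le> avg_varentropy d f / \<delta>\<^sup>2 / n"
    using aep_large[of "\<lambda>_ :: unit. 1" "\<lambda>_. f" d n \<delta>] f n \<delta> by (simp add: S p F_def)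
qed

text \<open>In terms of spectra the Holevo quantity is H(B) - H(XB) + H(X). The last term does not
  depend on the receiver and cancels in the difference.\<close>

lemma holevo_eq:
  fixes P :: "'x::finite pmf"
  assumes dec: "\<And>x. density_decomp d (\<omega> x) (U x) (e x)" and avg: "density_decomp d (average d (pmf P) \<omega> UNIV) V f"
  shows "holevo d P \<omega> = avg_entropy d f - joint_entropy d (pmf P) e - (\<Sum>x\<in>UNIV. pmf P x * log 2 (pmf P x))"
proof -
  have "vn_entropy (\<omega> x) = - (\<Sum>k<d. e x k * log 2 (e x k))" for x
    by (rule vn_entropy_eq[OF density_decompD(1,2)[OF dec]])
  moreover have "vn_entropy (average d (pmf P) \<omega> UNIV) = avg_entropy d f"
    unfolding vn_entropy_eq[OF density_decompD(1,2)[OF avg]] by (simp add: joint_entropy_def)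
  moreover have "joint_entropy d (pmf P) e = - (\<Sum>x\<in>UNIV. pmf P x * log 2 (pmf P x))
      - (\<Sum>x\<in>UNIV. pmf P x * (\<Sum>k<d. e x k * log 2 (e x k)))"
    by (rule joint_entropy_eq) (use density_decompD(3,4)[OF dec] in auto)
  ultimately show ?thesis
    by (simp add: holevo_def sum_negf flip: average_def)
qed

lemma powr_limit:
  fixes c :: real
  assumes "c < 0"
  shows "(\<lambda>n. 2 powr (real n * c)) \<longlonglongrightarrow> 0"
proof -
  have "2 powr c < 2 powr 0" using assms by (subst powr_less_cancel_iff) auto
  then have "(\<lambda>n. (2 powr c) ^ n) \<longlonglongrightarrow> 0" by (intro LIMSEQ_realpow_zero) auto
  moreover have "2 powr (real n * c) = (2 powr c) ^ n" for n
    by (simp add: powr_powr mult.commute flip: powr_realpow)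
  ultimately show ?thesis by simp
qed

section \<open>Many copies: thresholds, rates and capacity\<close>

locale iid_cqq =
  fixes P :: "'x::finite pmf" and dB dE :: nat and \<rho> :: "'x \<Rightarrow> complex mat"
    and UB UE :: "'x \<Rightarrow> complex mat" and eB eE :: "'x \<Rightarrow> nat \<Rightarrow> real"
    and VB VE :: "complex mat" and fB fE :: "nat \<Rightarrow> real"
  assumes decB: "\<And>x. density_decomp dB (trace_out_E dB dE (\<rho> x)) (UB x) (eB x)"
    and decE: "\<And>x. density_decomp dE (trace_out_B dB dE (\<rho> x)) (UE x) (eE x)"
    and avgB: "density_decomp dB (average dB (pmf P) (\<lambda>x. trace_out_E dB dE (\<rho> x)) UNIV) VB fB"
    and avgE: "density_decomp dE (average dE (pmf P) (\<lambda>x. trace_out_B dB dE (\<rho> x)) UNIV) VE fE"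
begin

abbreviation (input) "\<beta> \<equiv> \<lambda>x. trace_out_E dB dE (\<rho> x)"
abbreviation (input) "\<eta> \<equiv> \<lambda>x. trace_out_B dB dE (\<rho> x)"

text \<open>The conditional entropy H(X|B); \<open>condE\<close> is H(X|E).\<close>

definition condB :: real where "condB = joint_entropy dB (pmf P) eB - avg_entropy dB fB"
definition condE :: real where "condE = joint_entropy dE (pmf P) eE - avg_entropy dE fE"

lemma holevo_diff:
  "holevo dB P \<beta> - holevo dE P \<eta> = condE - condB"
  by (simp add: holevo_eq[OF decB avgB] holevo_eq[OF decE avgE] condB_def condE_def)

definition var_bound :: real where
  "var_bound = joint_varentropy dB (pmf P) eB + joint_varentropy dE (pmf P) eE + avg_varentropy dB fB + avg_varentropy dE fE"

text \<open>A single key value has rate zero and no error at all; it settles the case of a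
  nonpositive difference and keeps the supremum away from minus infinity.\<close>

lemma trivial_protocol: "key_protocol dB dE P \<rho> n 0 (1 * 1) 1 (hash_protocol 1 (\<lambda>_. 0)) (shifted_povm 1 (\<lambda>_ _. 1\<^sub>m (dB ^ n)))"
proof (rule hash_key_protocol[OF decB decE])
  have "1\<^sub>m (dB ^ n) = (1\<^sub>m (dB ^ n) :: complex mat) * mat_adjoint (1\<^sub>m (dB ^ n))" by simp
  then have psd1: "psd (dB ^ n) (1\<^sub>m (dB ^ n))" using psd_gram[of "1\<^sub>m (dB ^ n)" "dB ^ n" "dB ^ n"] by simp
  have "mat_sum (dB ^ n) (\<lambda>_ :: nat. 1\<^sub>m (dB ^ n)) {..<1} = 1\<^sub>m (dB ^ n)" by (rule eq_matI) auto
  then show "povm (dB ^ n) 1 (\<lambda>_. 1\<^sub>m (dB ^ n))" using psd1 by (simp add: povm_def)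
  have "seq_prob (pmf P) xs * (1 - Re (mat_trace (1\<^sub>m (dB ^ n) * product_state \<beta> xs))) = 0"
    if xs: "length xs = n" for xs
  proof -
    note dd = density_decompD[OF product_state_decomp[of dB \<beta> UB eB xs, OF decB], unfolded xs]
    show ?thesis using left_mult_one_mat[OF dd(1)] spectral_trace[OF dd(1,2)] dd(4) by simp
  qed
  then show "(\<Sum>xs | length xs = n. seq_prob (pmf P) xs * (1 - Re (mat_trace (1\<^sub>m (dB ^ n) *
       product_state \<beta> xs)))) \<le> 0"
    by (intro eq_refl sum.neutral) auto
  fix V :: "nat \<Rightarrow> complex mat" assume V: "\<And>j. j < 1 * 1 \<Longrightarrow> contraction (dE ^ n) (V j)"
  let ?H = "hash_state (dE ^ n) {xs. length xs = n} (1 * 1) (seq_prob (pmf P)) (product_state \<eta>) (\<lambda>_. 0) 0"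
  have "?H = 0\<^sub>m (dE ^ n) (dE ^ n)"
  proof (rule eq_matI)
    fix i j assume "i < dim_row (0\<^sub>m (dE ^ n) (dE ^ n))" "j < dim_col (0\<^sub>m (dE ^ n) (dE ^ n))"
    moreover have "product_state \<eta> xs \<in> carrier_mat (dE ^ n) (dE ^ n)"
      if "xs \<in> {xs. length xs = n}" for xs
      using product_state_carrier[of \<eta> dE xs, OF density_decompD(1)[OF decE]] that by simp
    ultimately show "?H $$ (i, j) = 0\<^sub>m (dE ^ n) (dE ^ n) $$ (i, j)"
      unfolding hash_state_def by (subst average_entry) auto
  qed (auto simp: hash_state_def average_def)
  then have "mat_trace (V 0 * ?H) = 0"
    using V[of 0] by (simp add: contraction_def trace_mult[of _ "dE ^ n" "dE ^ n"])
  then show "(\<Sum>j<1 * 1. Re (mat_trace (V j * hash_state (dE ^ n) {xs. length xs = n} (1 * 1) (seq_prob (pmf P))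
        (product_state \<eta>) (\<lambda>_. 0) j))) \<le> 0"
    by simp
qed auto

definition tail :: "nat \<Rightarrow> real \<Rightarrow> real" where "tail n \<delta> = var_bound / \<delta>\<^sup>2 / n"

context
  fixes n :: nat and \<delta> :: real
  assumes n: "0 < n" and \<delta>: "0 < \<delta>"
begin

interpretation bob: cq_ensemble "{xs :: 'x list. length xs = n}" "seq_prob (pmf P)" "dB ^ n"
  "product_state \<beta>" "product_state UB" "product_weight dB eB"
  "product_state (\<lambda>_. VB) (replicate n ())" "product_weight dB (\<lambda>_. fB) (replicate n ())"
  by (rule iid_cq_ensemble[OF decB avgB])

interpretation eve: cq_ensemble "{xs :: 'x list. length xs = n}" "seq_prob (pmf P)" "dE ^ n"
  "product_state \<eta>" "product_state UE" "product_weight dE eE"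
  "product_state (\<lambda>_. VE) (replicate n ())" "product_weight dE (\<lambda>_. fE) (replicate n ())"
  by (rule iid_cq_ensemble[OF decE avgE])

lemma varentropy_le:
  "joint_varentropy dB (pmf P) eB / \<delta>\<^sup>2 / n \<le> tail n \<delta>" "joint_varentropy dE (pmf P) eE / \<delta>\<^sup>2 / n \<le> tail n \<delta>"
  "avg_varentropy dB fB / \<delta>\<^sup>2 / n \<le> tail n \<delta>" "avg_varentropy dE fE / \<delta>\<^sup>2 / n \<le> tail n \<delta>"
proof -
  note nonneg = joint_varentropy_nonneg[of "pmf P" eB dB] joint_varentropy_nonneg[of "pmf P" eE dE]
    joint_varentropy_nonneg[of "\<lambda>_ :: unit. 1" "\<lambda>_. fB" dB] joint_varentropy_nonneg[of "\<lambda>_ :: unit. 1" "\<lambda>_. fE" dE]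
  show "joint_varentropy dB (pmf P) eB / \<delta>\<^sup>2 / n \<le> tail n \<delta>" "joint_varentropy dE (pmf P) eE / \<delta>\<^sup>2 / n \<le> tail n \<delta>"
    "avg_varentropy dB fB / \<delta>\<^sup>2 / n \<le> tail n \<delta>" "avg_varentropy dE fE / \<delta>\<^sup>2 / n \<le> tail n \<delta>"
    unfolding tail_def var_bound_def using nonneg density_decompD(3)[OF decB] density_decompD(3)[OF decE]
      density_decompD(3)[OF avgB] density_decompD(3)[OF avgE]
    by (auto intro!: divide_right_mono)
qed

text \<open>Each threshold is displaced by \<delta> so that it cuts off only atypical eigenvalues;
  the two displacements of a receiver add up to 2\<delta> in \<open>threshold_ratio\<close>.\<close>

abbreviation (input) "\<tau>B \<equiv> 2 powr (- real n * (avg_entropy dB fB - \<delta>))"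
abbreviation (input) "\<theta>B \<equiv> 2 powr (- real n * (joint_entropy dB (pmf P) eB + \<delta>))"
abbreviation (input) "\<tau>E \<equiv> 2 powr (- real n * (avg_entropy dE fE + \<delta>))"
abbreviation (input) "\<theta>E \<equiv> 2 powr (- real n * (joint_entropy dE (pmf P) eE - \<delta>))"

lemma tails:
  "bob.joint_tail (\<lambda>t. t < \<theta>B) \<le> tail n \<delta>" "bob.avg_tail (\<lambda>t. \<tau>B < t) \<le> tail n \<delta>"
  "eve.joint_tail (\<lambda>t. \<theta>E < t) \<le> tail n \<delta>" "eve.avg_tail (\<lambda>t. t < \<tau>E) \<le> tail n \<delta>"
proof -
  have p: "0 \<le> pmf P x" "(\<Sum>x\<in>UNIV. pmf P x) = 1" for x by (auto simp: sum_pmf_eq_1)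
  show "bob.joint_tail (\<lambda>t. t < \<theta>B) \<le> tail n \<delta>"
    unfolding bob.joint_tail_def
    by (rule order_trans[OF aep_small[OF p density_decompD(3,4)[OF decB] n \<delta>] varentropy_le(1)])
  show "eve.joint_tail (\<lambda>t. \<theta>E < t) \<le> tail n \<delta>"
    unfolding eve.joint_tail_def
    by (rule order_trans[OF aep_large[OF p density_decompD(3,4)[OF decE] n \<delta>] varentropy_le(2)])
  show "bob.avg_tail (\<lambda>t. \<tau>B < t) \<le> tail n \<delta>"
    unfolding bob.avg_tail_def
    by (rule order_trans[OF aep_avg(2)[OF density_decompD(3,4)[OF avgB] n \<delta>] varentropy_le(3)])
  show "eve.avg_tail (\<lambda>t. t < \<tau>E) \<le> tail n \<delta>"
    unfolding eve.avg_tail_def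
    by (rule order_trans[OF aep_avg(1)[OF density_decompD(3,4)[OF avgE] n \<delta>] varentropy_le(4)])
qed

lemma threshold_ratio:
  "\<tau>B / \<theta>B = 2 powr (n * (condB + 2 * \<delta>))" "\<theta>E / \<tau>E = 2 powr (- (n * (condE - 2 * \<delta>)))"
  unfolding powr_diff[symmetric] condB_def condE_def by (simp_all add: algebra_simps)

text \<open>The constant is 2 + 3 from \<open>bob_dimension_bound\<close>, with each tail bounded by
  \<open>tail n \<delta>\<close>.\<close>

lemma cond_entropy_bound: "1 - 5 * tail n \<delta> \<le> 2 powr (n * (condB + 2 * \<delta>))"
proof -
  have "1 - 2 * bob.joint_tail (\<lambda>t. t < \<theta>B) - 3 * bob.avg_tail (\<lambda>t. \<tau>B < t) \<le> \<tau>B / \<theta>B"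
    by (rule bob.bob_dimension_bound) auto
  then show ?thesis using tails unfolding threshold_ratio by linarith
qed

text \<open>Bob's and Eve's bounds are added before averaging, so a single hash function is good for
  both; each is nonnegative and hence below the sum. The constants are 2 + 2 tails under Bob's root
  and 4 times two roots for Eve.\<close>

lemma key_protocol_exists:
  assumes B: "0 < B" and M: "0 < M"
  shows "\<exists>T D. key_protocol dB dE P \<rho> n (tail n \<delta> + 2 * sqrt (4 * tail n \<delta> + 2 powr (n * (condB + 2 * \<delta>)) / B)
      + 8 * sqrt (tail n \<delta>) + sqrt (B * M * 2 powr (- (n * (condE - 2 * \<delta>))))) (B * M) M T D"
    (is "\<exists>T D. key_protocol dB dE P \<rho> n ?\<epsilon> (B * M) M T D")
proof -
  let ?S = "{xs :: 'x list. length xs = n}" and ?N = "B * M"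
  have N: "0 < ?N" using B M by simp
  have pos: "0 < \<tau>B" "0 < \<theta>B" "0 < \<tau>E" "0 < \<theta>E" by auto
  let ?b = "bob.bob_bound \<tau>B \<theta>B M" and ?e = "eve.eve_bound \<tau>E \<theta>E ?N"
  have "hash_mean ?S ?N ?b \<le> bob.avg_tail (\<lambda>t. \<tau>B < t) + 2 * sqrt (2 * bob.joint_tail (\<lambda>t. t < \<theta>B)
      + 2 * bob.avg_tail (\<lambda>t. \<tau>B < t) + \<tau>B / \<theta>B / B)"
    by (rule bob.bob_bound_mean[OF pos(1,2) B M])
  also have "\<dots> \<le> tail n \<delta> + 2 * sqrt (4 * tail n \<delta> + 2 powr (n * (condB + 2 * \<delta>)) / B)"
    unfolding threshold_ratio using tails by (intro add_mono mult_left_mono real_sqrt_le_mono) auto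
  finally have mb: "hash_mean ?S ?N ?b \<le> tail n \<delta> + 2 * sqrt (4 * tail n \<delta> + 2 powr (n * (condB + 2 * \<delta>)) / B)" .
  have "hash_mean ?S ?N ?e \<le> 4 * (sqrt (eve.avg_tail (\<lambda>t. t < \<tau>E)) + sqrt (eve.joint_tail (\<lambda>t. \<theta>E < t))) + sqrt (?N * \<theta>E / \<tau>E)"
    by (rule eve.eve_bound_mean[OF pos(3,4) N])
  also have "\<dots> \<le> 4 * (sqrt (tail n \<delta>) + sqrt (tail n \<delta>)) + sqrt (?N * \<theta>E / \<tau>E)"
    using tails by (intro add_mono mult_left_mono real_sqrt_le_mono) auto
  also have "?N * \<theta>E / \<tau>E = B * M * 2 powr (- (n * (condE - 2 * \<delta>)))"
    by (simp only: times_divide_eq_right[symmetric] threshold_ratio of_nat_mult)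
  finally have me: "hash_mean ?S ?N ?e \<le> 8 * sqrt (tail n \<delta>) + sqrt (B * M * 2 powr (- (n * (condE - 2 * \<delta>))))" by simp
  obtain h where h: "h \<in> ?S \<rightarrow>\<^sub>E {..<?N}" and "?b h + ?e h \<le> hash_mean ?S ?N (\<lambda>h. ?b h + ?e h)"
    using hash_mean_witness[of ?S ?N "\<lambda>h. ?b h + ?e h"] N by auto
  then have "?b h + ?e h \<le> ?\<epsilon>" using mb me by (simp add: hash_mean_add)
  moreover have "0 \<le> ?b h" "0 \<le> ?e h"
    using bob.bob_bound_nonneg[OF pos(1,2)] eve.eve_bound_nonneg[OF pos(3,4)] by auto
  ultimately have be: "?b h \<le> ?\<epsilon>" "?e h \<le> ?\<epsilon>" "0 \<le> ?\<epsilon>" by linarith+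
  have hN: "h xs < ?N" if "length xs = n" for xs using h that by auto
  obtain D where D: "\<And>b. povm (dB ^ n) M (D b)"
    and err: "(\<Sum>xs | length xs = n. seq_prob (pmf P) xs * (1 - Re (mat_trace (D (h xs div M) (h xs mod M) *
       product_state \<beta> xs)))) \<le> ?b h"
    using bob.bob_decoder[OF pos(1,2) M, of h] by blast
  have "key_protocol dB dE P \<rho> n ?\<epsilon> (B * M) M (hash_protocol M h) (shifted_povm M D)"
  proof (rule hash_key_protocol[OF decB decE M B hN D be(3) order_trans[OF err be(1)]])
    fix V assume V: "\<And>j. j < B * M \<Longrightarrow> contraction (dE ^ n) (V j)"
    have "(\<Sum>j<B * M. Re (mat_trace (V j * hash_state (dE ^ n) ?S (B * M) (seq_prob (pmf P))
        (product_state \<eta>) h j))) \<le> ?e h"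
      by (rule eve.eve_secrecy[OF pos(3,4) V _ N]) (use hN in auto)
    then show "(\<Sum>j<B * M. Re (mat_trace (V j * hash_state (dE ^ n) ?S (B * M) (seq_prob (pmf P))
        (product_state \<eta>) h j))) \<le> ?\<epsilon>" using be(2) by linarith
  qed
  then show ?thesis by blast
qed

end

lemma tail_limit: "(\<lambda>n. tail n \<delta>) \<longlonglongrightarrow> 0"
  unfolding tail_def by (rule lim_const_over_n)

text \<open>Otherwise \<open>cond_entropy_bound\<close> would read 1 \<le> 0 in the limit. It makes
  the exponent of the number of bins nonnegative.\<close>

lemma cond_entropy_nonneg:
  assumes \<delta>: "0 < \<delta>"
  shows "0 \<le> condB + 2 * \<delta>"
proof (rule ccontr)
  assume "\<not> ?thesis"
  then have neg: "condB + 2 * \<delta> < 0" by simp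
  have "(\<lambda>n. 2 powr (real n * (condB + 2 * \<delta>))) \<longlonglongrightarrow> 0" by (rule powr_limit[OF neg])
  moreover have "(\<lambda>n. 1 - 5 * tail n \<delta>) \<longlonglongrightarrow> 1 - 5 * 0" by (intro tendsto_intros tail_limit)
  moreover have "\<forall>\<^sub>F n in sequentially. 1 - 5 * tail n \<delta> \<le> 2 powr (real n * (condB + 2 * \<delta>))"
    using eventually_gt_at_top[of 0] by eventually_elim (rule cond_entropy_bound[OF _ \<delta>])
  ultimately have "(1 :: real) - 5 * 0 \<le> 0" by (intro tendsto_le[OF sequentially_bot])
  then show False by simp
qed

text \<open>The bins get the exponent \<open>b\<close>, one \<delta> above the overlap exponent
  H(X|B) + 2\<delta> of Bob, and \<open>b + r\<close> is H(X|E) - 3\<delta>, one \<delta> below what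
  Eve's bound tolerates. Both error terms then decay exponentially.\<close>

lemma achievable:
  assumes \<delta>: "0 < \<delta>" and r: "0 \<le> r" and r_le: "r = condE - condB - 6 * \<delta>"
  shows "achievable_rate dB dE P \<rho> r"
proof -
  define b where "b = condB + 3 * \<delta>"
  have b: "0 \<le> b" using cond_entropy_nonneg[OF \<delta>] \<delta> by (simp add: b_def)
  \<comment> \<open>Rounding up keeps enough bins for Bob, rounding down keeps the range of the hash
    small for Eve. Both powers are at least one, so each rounding costs at most a factor
    two.\<close>
  define B M :: "nat \<Rightarrow> nat" where "B n = nat \<lceil>2 powr (real n * b)\<rceil>" and "M n = nat \<lfloor>2 powr (real n * r)\<rfloor>" for n
  have pb: "1 \<le> 2 powr (real n * b)" and pr: "1 \<le> 2 powr (real n * r)" for n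
    using b r by (auto intro!: ge_one_powr_ge_zero)
  have B_ge: "2 powr (real n * b) \<le> B n" for n unfolding B_def by linarith
  have B_le: "B n \<le> 2 * 2 powr (real n * b)" for n
    using pb[of n] unfolding B_def by linarith
  have M_le: "M n \<le> 2 powr (real n * r)" for n using pr[of n] unfolding M_def by linarith
  have M_ge: "2 powr (real n * r) / 2 \<le> M n" for n
  proof -
    let ?t = "2 powr (real n * r)"
    have "1 \<le> \<lfloor>?t\<rfloor>" using pr[of n] by simp
    moreover have "?t < \<lfloor>?t\<rfloor> + 1" by linarith
    ultimately have "?t / 2 \<le> real_of_int \<lfloor>?t\<rfloor>" by linarith
    then show ?thesis using \<open>1 \<le> \<lfloor>?t\<rfloor>\<close> by (simp add: M_def)
  qed
  have Bpos: "0 < B n" and Mpos: "0 < M n" for n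
    using B_ge[of n] M_ge[of n] pb[of n] pr[of n] by (auto intro!: gr0I)
  define \<epsilon> where "\<epsilon> n = tail n \<delta> + 2 * sqrt (4 * tail n \<delta> + 2 powr (real n * (condB + 2 * \<delta>)) / B n)
      + 8 * sqrt (tail n \<delta>) + sqrt (B n * M n * 2 powr (- (real n * (condE - 2 * \<delta>))))" for n
  \<comment> \<open>The factor two from rounding is absorbed by the summand \<open>1\<close> in the
    exponent, as \<open>1 \<le> n\<close>.\<close>
  have rate: "real (B n * M n) \<le> 2 powr (real n * (1 + b + r))" if n: "1 \<le> n" for n
  proof -
    have "real (B n * M n) \<le> (2 * 2 powr (real n * b)) * 2 powr (real n * r)"
      unfolding of_nat_mult using B_le[of n] M_le[of n] by (intro mult_mono) auto
    also have "\<dots> = 2 powr 1 * 2 powr (real n * b) * 2 powr (real n * r)" by simp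
    also have "\<dots> = 2 powr (1 + real n * b + real n * r)" by (simp only: powr_add)
    also have "\<dots> \<le> 2 powr (real n * (1 + b + r))" using n by (intro powr_mono) (auto simp: algebra_simps)
    finally show ?thesis .
  qed
  have lim1: "(\<lambda>n. 2 powr (real n * (condB + 2 * \<delta>)) / B n) \<longlonglongrightarrow> 0"
  proof (rule tendsto_sandwich[of "\<lambda>_. 0" _ _ "\<lambda>n. 2 powr (- (real n * \<delta>))"])
    have "2 powr (real n * (condB + 2 * \<delta>)) / B n \<le> 2 powr (real n * (condB + 2 * \<delta>)) / 2 powr (real n * b)" for n
      using B_ge[of n] by (intro divide_left_mono mult_pos_pos) (use Bpos in auto)
    also have "2 powr (real n * (condB + 2 * \<delta>)) / 2 powr (real n * b) = 2 powr (- (real n * \<delta>))" for n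
      unfolding powr_diff[symmetric] b_def by (simp add: algebra_simps)
    finally show "\<forall>\<^sub>F n in sequentially. 2 powr (real n * (condB + 2 * \<delta>)) / B n \<le> 2 powr (- (real n * \<delta>))"
      by (rule always_eventually[OF allI])
    show "(\<lambda>n. 2 powr (- (real n * \<delta>))) \<longlonglongrightarrow> 0" using powr_limit[of "- \<delta>"] \<delta> by simp
  qed auto
  have lim2: "(\<lambda>n. B n * M n * 2 powr (- (real n * (condE - 2 * \<delta>)))) \<longlonglongrightarrow> 0"
  proof (rule tendsto_sandwich[of "\<lambda>_. 0" _ _ "\<lambda>n. 2 * 2 powr (- (real n * \<delta>))"])
    have "B n * M n * 2 powr (- (real n * (condE - 2 * \<delta>))) \<le> (2 * 2 powr (real n * b)) * 2 powr (real n * r) * 2 powr (- (real n * (condE - 2 * \<delta>)))" for n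
      using mult_mono[OF B_le[of n] M_le[of n]] by (intro mult_right_mono) auto
    also have "(2 * 2 powr (real n * b)) * 2 powr (real n * r) * 2 powr (- (real n * (condE - 2 * \<delta>)))
        = 2 * 2 powr (real n * b + real n * r + - (real n * (condE - 2 * \<delta>)))" for n
      by (simp only: powr_add mult.assoc)
    also have "real n * b + real n * r + - (real n * (condE - 2 * \<delta>)) = - (real n * \<delta>)" for n
      by (simp add: b_def r_le algebra_simps)
    finally show "\<forall>\<^sub>F n in sequentially. B n * M n * 2 powr (- (real n * (condE - 2 * \<delta>))) \<le> 2 * 2 powr (- (real n * \<delta>))"
      by (rule always_eventually[OF allI])
    show "(\<lambda>n. 2 * 2 powr (- (real n * \<delta>))) \<longlonglongrightarrow> 0"
      using tendsto_mult_right_zero[OF powr_limit[of "- \<delta>"], of 2] \<delta> by simp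
  qed auto
  have "\<epsilon> \<longlonglongrightarrow> 0 + 2 * sqrt (4 * 0 + 0) + 8 * sqrt 0 + sqrt 0"
    unfolding \<epsilon>_def by (intro tendsto_intros tail_limit lim1 lim2)
  then have eps: "\<epsilon> \<longlonglongrightarrow> 0" by simp
  have key: "\<exists>T D. key_protocol dB dE P \<rho> n (\<epsilon> n) (B n * M n) (M n) T D" if "1 \<le> n" for n
    using key_protocol_exists[OF _ \<delta> Bpos[of n] Mpos[of n], of n] that by (simp add: \<epsilon>_def)
  have lim3: "(\<lambda>n. log 2 (M n) / n) \<longlonglongrightarrow> r"
  proof (rule tendsto_sandwich[of "\<lambda>n. r - 1 / real n" _ _ "\<lambda>_. r"])
    have lower: "real n * r - 1 \<le> log 2 (M n)" for n
    proof -
      have "real n * r - 1 = log 2 (2 powr (real n * r) / 2)" by (simp add: log_divide)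
      also have "\<dots> \<le> log 2 (M n)" using M_ge[of n] Mpos[of n] by simp
      finally show ?thesis .
    qed
    have upper: "log 2 (M n) \<le> n * r" for n
    proof -
      have "log 2 (M n) \<le> log 2 (2 powr (real n * r))" using M_le[of n] Mpos[of n] by (subst log_le_cancel_iff) auto
      then show ?thesis by simp
    qed
    show "\<forall>\<^sub>F n in sequentially. r - 1 / n \<le> log 2 (M n) / n"
      using eventually_gt_at_top[of 0]
    proof eventually_elim
      case (elim n)
      then have "r - 1 / n = (real n * r - 1) / n" by (simp add: field_simps)
      also have "\<dots> \<le> log 2 (M n) / n" using lower by (rule divide_right_mono) simp
      finally show ?case .
    qed
    show "\<forall>\<^sub>F n in sequentially. log 2 (M n) / n \<le> r"
      using eventually_gt_at_top[of 0]
    proof eventually_elim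
      case (elim n)
      then show ?case using upper[of n] by (simp add: pos_divide_le_eq mult.commute)
    qed
    show "(\<lambda>n. r - 1 / real n) \<longlonglongrightarrow> r"
      using tendsto_diff[OF tendsto_const lim_1_over_n, of r] by simp
  qed auto
  show ?thesis
    unfolding achievable_rate_def
    by (rule exI[of _ "1 + b + r"], rule exI[of _ \<epsilon>], rule exI[of _ "\<lambda>n. B n * M n"], rule exI[of _ M])
      (use rate key eps lim3 in auto)
qed

lemma achievable_zero: "achievable_rate dB dE P \<rho> 0"
  unfolding achievable_rate_def
  by (rule exI[of _ 0], rule exI[of _ "\<lambda>_. 0"], rule exI[of _ "\<lambda>_. 1 * 1"], rule exI[of _ "\<lambda>_. 1"])
    (use trivial_protocol in auto)

text \<open>If the capacity were a smaller real \<open>c\<close>, the midpoint between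
  \<open>c\<close> and the difference would be an achievable rate above \<open>c\<close>.\<close>

lemma capacity_bound: "ereal (condE - condB) \<le> key_capacity dB dE P \<rho>"
proof (rule ccontr)
  assume less: "\<not> ?thesis"
  have upper: "ereal r \<le> key_capacity dB dE P \<rho>" if "achievable_rate dB dE P \<rho> r" for r
    unfolding key_capacity_def using that by (intro Sup_upper) auto
  \<comment> \<open>Infinity is excluded by the assumption, minus infinity by the achievable rate
    zero.\<close>
  obtain c where c: "key_capacity dB dE P \<rho> = ereal c"
    using less upper[OF achievable_zero] by (cases "key_capacity dB dE P \<rho>") auto
  have "0 \<le> c" "c < condE - condB" using upper[OF achievable_zero] less by (auto simp: c)
  \<comment> \<open>A twelfth of the gap as slack makes the loss of six slacks end exactly at the
    midpoint.\<close>
  then have "achievable_rate dB dE P \<rho> ((condE - condB + c) / 2)"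
    by (intro achievable[of "(condE - condB - c) / 12"]) (auto simp: field_simps)
  from upper[OF this] \<open>c < condE - condB\<close> show False by (simp add: c field_simps)
qed

end

theorem theorem1:
  fixes P :: "'x::finite pmf"
    and dB dE :: nat
    and \<rho> :: "'x \<Rightarrow> complex mat"
  assumes "\<And>x. density_op (dB * dE) (\<rho> x)"
  shows "key_capacity dB dE P \<rho> \<ge>
    ereal (holevo dB P (\<lambda>x. trace_out_E dB dE (\<rho> x)) - holevo dE P (\<lambda>x. trace_out_B dB dE (\<rho> x)))"
proof -
  let ?\<beta> = "\<lambda>x. trace_out_E dB dE (\<rho> x)" and ?\<eta> = "\<lambda>x. trace_out_B dB dE (\<rho> x)"
  have B: "density_op dB (?\<beta> x)" and E: "density_op dE (?\<eta> x)" for x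
    using density_op_trace_out_E density_op_trace_out_B assms by auto
  have "\<forall>x. \<exists>U e. density_decomp dB (?\<beta> x) U e" "\<forall>x. \<exists>U e. density_decomp dE (?\<eta> x) U e"
    using density_op_decomp B E by auto
  then obtain UB eB UE eE where "\<And>x. density_decomp dB (?\<beta> x) (UB x) (eB x)"
    "\<And>x. density_decomp dE (?\<eta> x) (UE x) (eE x)"
    unfolding choice_iff by blast
  moreover have "density_op dB (average dB (pmf P) ?\<beta> UNIV)" "density_op dE (average dE (pmf P) ?\<eta> UNIV)"
    using B E by (auto intro!: density_op_average simp: sum_pmf_eq_1)
  then obtain VB fB VE fE where "density_decomp dB (average dB (pmf P) ?\<beta> UNIV) VB fB"
    "density_decomp dE (average dE (pmf P) ?\<eta> UNIV) VE fE"
    using density_op_decomp by blast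
  ultimately interpret iid_cqq P dB dE \<rho> UB UE eB eE VB VE fB fE
    by unfold_locales
  show ?thesis using capacity_bound by (simp only: holevo_diff)
qed

end
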